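(* Let $\{S_i\}_{i\in\mathcal{I}}$ be an IFS satisfying the weak separation condition, with attractor $K$ and associated self-similar measure $\mu_{\mathbf p}$. Then there exists a sequence of compact sets $(K_m)_{m=1}^\infty$ with $K_m\subseteq K_{m+1}\subseteq K$ for each $m\in\mathbb{N}$ such that (i) $\lim_{m\to\infty}\mu_{\mathbf p}(K_m)=1$, (ii) each $\mu_m:=\mu_{\mathbf p}|_{K_m}$ satisfies the multifractal formalism, and (iii) $\tau(\mu_m,q)$ and $D(\mu_m)$ do not depend on the index $m$.
   Context: IFS. An iterated function system of similarities (IFS) is a finite set of maps $S_i(x)=r_ix+d_i$ on $\mathbb{R}$, $i\in\mathcal{I}$, with $0<|r_i|<1$ and $\#\mathcal{I}\ge 2$. Its attractor $K$ is the unique non-empty compact set with $K=\bigcup_{i}S_i(K)$. Standing assumptions: $K$ is not a singleton and (normalization) the convex hull of $K$ is $[0,1]$. Given $\mathbf p=(p_i)_{i\in\mathcal I}$ with $p_i>0$, $\sum p_i=1$, the associated self-similar measure $\mu_{\mathbf p}$ is the unique Borel probability measure with $\mu_{\mathbf p}(E)=\sum_i p_i\mu_{\mathbf p}(S_i^{-1}(E))$ for all Borel $E$. $\mathcal{I}^*$ is the set of finite words; for $\sigma=(\sigma_1,\dots,\sigma_n)$, $S_\sigma=S_{\sigma_1}\circ\cdots\circ S_{\sigma_n}$, $r_\sigma=\prod r_{\sigma_k}$, and $\sigma^-$ is $\sigma$ with the last letter deleted; for the empty word $S_\emptyset=\mathrm{id}$, $r_\emptyset=1$. For $t>0$, $\Lambda_t=\{\sigma\in\mathcal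 I^*:|r_\sigma|<t\le|r_{\sigma^-}|\}$ (convention: $|r_{\emptyset^-}|=\infty$, so $\Lambda_t=\{\emptyset\}$ for $t>1$). Weak separation condition. $U(x,t)$ is the open ball of centre $x$ and radius $t$. For Borel $E$, $\mathcal{S}_t(E)=\{S_\sigma:\sigma\in\Lambda_t,\ S_\sigma(K)\cap E\ne\emptyset\}$ (a set of functions). The weak separation condition is $\sup_{x\in\mathbb{R},t>0}\#\mathcal{S}_t(U(x,t))<\infty$. Multifractal formalism. $B(x,t)$ is the closed ball. For a compactly supported finite Borel measure $\mu$, $\dim_{\mathrm{loc}}\mu(x)=\lim_{t\to0}\frac{\log\mu(B(x,t))}{\log t}$ ($x\in\operatorname{supp}\mu$, when the limit exists). The $L^q$-spectrum is $\tau(\mu,q)=\liminf_{t\downarrow0}\frac{\log\sup\sum_i\mu(B(x_i,t))^q}{\log t}$, $q\in\mathbb R$, the supremum being over families of disjoint closed balls $\{B(x_i,t)\}_i$ with $x_i\in\operatorname{supp}\mu$; $\tau^*(\mu,\alpha)=\inf_{q\in\mathbb R}\{\alpha q-\tau(\mu,q)\}$. Let $D(\mu)=\{\alpha\in\mathbb R:\dim_{\mathrm{loc}}\mu(x)=\alpha\text{ for some }x\in\operatorname{supp}\mu\}$ and $K(\mu,\alpha)=\{x\in\operatorname{supp}\mu:\dim_{\mathrm{loc}}\mu(x)=\alpha\}$. A measure $\mu\neq0$ satisfies the (complete) multifractal formalism if $D(\mu)=[\alpha_{\min},\alpha_{\max}]$ where $\alpha_{\min}=\lim_{q\to+\infty}\tau(\mu,q)/q$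 and $\alpha_{\max}=\lim_{q\to-\infty}\tau(\mu,q)/q$, and $\tau^*(\mu,\alpha)=\dim_H K(\mu,\alpha)$ (Hausdorff dimension) for every $\alpha\in[\alpha_{\min},\alpha_{\max}]$. *)

theory Defs
  imports "HOL-Analysis.Analysis" "HOL-Probability.Probability_Measure"
begin

section \<open>Iterated function systems of similarities on the real line\<close>

definition sim :: "('i \<Rightarrow> real) \<Rightarrow> ('i \<Rightarrow> real) \<Rightarrow> 'i \<Rightarrow> real \<Rightarrow> real" where
  "sim r d i x = r i * x + d i"

definition similarity_ifs :: "'i set \<Rightarrow> ('i \<Rightarrow> real) \<Rightarrow> bool" where
  "similarity_ifs I r \<longleftrightarrow>
     finite I \<and> card I \<ge> 2 \<and> (\<forall>i\<in>I. 0 < \<bar>r i\<bar> \<and> \<bar>r i\<bar> < 1)"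

definition is_attractor ::
    "'i set \<Rightarrow> ('i \<Rightarrow> real) \<Rightarrow> ('i \<Rightarrow> real) \<Rightarrow> real set \<Rightarrow> bool" where
  "is_attractor I r d K \<longleftrightarrow>
     K \<noteq> {} \<and> compact K \<and> K = (\<Union>i\<in>I. sim r d i ` K)"

definition probability_vector :: "'i set \<Rightarrow> ('i \<Rightarrow> real) \<Rightarrow> bool" where
  "probability_vector I p \<longleftrightarrow> (\<forall>i\<in>I. p i > 0) \<and> (\<Sum>i\<in>I. p i) = 1"

definition is_self_similar_measure ::
    "'i set \<Rightarrow> ('i \<Rightarrow> real) \<Rightarrow> ('i \<Rightarrow> real) \<Rightarrow> ('i \<Rightarrow> real) \<Rightarrow> real measure \<Rightarrow> bool" where
  "is_self_similar_measure I r d p \<mu> \<longleftrightarrow>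
     prob_space \<mu> \<and> sets \<mu> = sets borel \<and>
     (\<forall>E\<in>sets borel. measure \<mu> E = (\<Sum>i\<in>I. p i * measure \<mu> (sim r d i -` E)))"

definition word_ratio :: "('i \<Rightarrow> real) \<Rightarrow> 'i list \<Rightarrow> real" where
  "word_ratio r \<sigma> = prod_list (map r \<sigma>)"

primrec word_map :: "('i \<Rightarrow> real) \<Rightarrow> ('i \<Rightarrow> real) \<Rightarrow> 'i list \<Rightarrow> real \<Rightarrow> real" where
  "word_map r d [] = id"
| "word_map r d (i # \<sigma>) = sim r d i \<circ> word_map r d \<sigma>"

text \<open>The disjunct for the empty word is the convention that the parent of the empty word has
  ratio infinity; \<^term>\<open>butlast []\<close> would give it ratio 1.\<close>

definition Lambda :: "'i set \<Rightarrow> ('i \<Rightarrow> real) \<Rightarrow> real \<Rightarrow> 'i list set" where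
  "Lambda I r t =
     {\<sigma> \<in> lists I. \<bar>word_ratio r \<sigma>\<bar> < t \<and> (\<sigma> = [] \<or> t \<le> \<bar>word_ratio r (butlast \<sigma>)\<bar>)}"

text \<open>A set of functions: words with the same map are counted once.\<close>

definition level_maps ::
    "'i set \<Rightarrow> ('i \<Rightarrow> real) \<Rightarrow> ('i \<Rightarrow> real) \<Rightarrow> real set \<Rightarrow> real \<Rightarrow> real set \<Rightarrow> (real \<Rightarrow> real) set" where
  "level_maps I r d K t E =
     {word_map r d \<sigma> | \<sigma>. \<sigma> \<in> Lambda I r t \<and> word_map r d \<sigma> ` K \<inter> E \<noteq> {}}"

definition weak_separation ::
    "'i set \<Rightarrow> ('i \<Rightarrow> real) \<Rightarrow> ('i \<Rightarrow> real) \<Rightarrow> real set \<Rightarrow> bool" where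
  "weak_separation I r d K \<longleftrightarrow>
     (\<exists>N::nat. \<forall>x. \<forall>t>0. finite (level_maps I r d K t (ball x t)) \<and>
                          card (level_maps I r d K t (ball x t)) \<le> N)"

section \<open>Hausdorff dimension\<close>

text \<open>The diameter raised to the power s, where the 0-th power is 1 on nonempty sets
  (whereas \<^term>\<open>0 powr 0 = (0::real)\<close>), so that the measure for s = 0 is counting measure.\<close>

definition diam_pow :: "real \<Rightarrow> 'a::metric_space set \<Rightarrow> ennreal" where
  "diam_pow s U = (if U = {} then 0 else if s = 0 then 1 else ennreal (diameter U powr s))"

text \<open>Boundedness is required because \<^const>\<open>diameter\<close> is unspecified on unbounded sets.\<close>

definition hausdorff_premeasure :: "real \<Rightarrow> real \<Rightarrow> 'a::metric_space set \<Rightarrow> ennreal" where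
  "hausdorff_premeasure s \<delta> E =
     (INF U \<in> {U :: nat \<Rightarrow> 'a set. E \<subseteq> (\<Union>n. U n) \<and> (\<forall>n. bounded (U n) \<and> diameter (U n) \<le> \<delta>)}.
        \<Sum>n. diam_pow s (U n))"

definition hausdorff_measure :: "real \<Rightarrow> 'a::metric_space set \<Rightarrow> ennreal" where
  "hausdorff_measure s E = (SUP \<delta>\<in>{0<..}. hausdorff_premeasure s \<delta> E)"

definition hausdorff_dim :: "'a::metric_space set \<Rightarrow> ereal" where
  "hausdorff_dim E = Inf {ereal s | s. 0 \<le> s \<and> hausdorff_measure s E = 0}"

section \<open>Multifractal formalism\<close>

definition supp :: "real measure \<Rightarrow> real set" where
  "supp \<mu> = {x. \<forall>U. open U \<and> x \<in> U \<longrightarrow> emeasure \<mu> U > 0}"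

definition has_local_dim :: "real measure \<Rightarrow> real \<Rightarrow> real \<Rightarrow> bool" where
  "has_local_dim \<mu> x \<alpha> \<longleftrightarrow>
     ((\<lambda>t. ln (measure \<mu> (cball x t)) / ln t) \<longlongrightarrow> \<alpha>) (at_right 0)"

text \<open>Balls of a fixed radius t > 0 are nonempty, so a disjoint family of them is given by its
  set A of centres. For a compactly supported measure every such A is finite, and the sums are
  bounded, so that the real supremum is the true one.\<close>

definition packing_sum_sup :: "real measure \<Rightarrow> real \<Rightarrow> real \<Rightarrow> real" where
  "packing_sum_sup \<mu> q t =
     (SUP A \<in> {A. finite A \<and> A \<subseteq> supp \<mu> \<and> disjoint_family_on (\<lambda>x. cball x t) A}.
        \<Sum>x\<in>A. measure \<mu> (cball x t) powr q)"

definition Lq_spectrum :: "real measure \<Rightarrow> real \<Rightarrow> ereal" where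
  "Lq_spectrum \<mu> q = Liminf (at_right 0) (\<lambda>t. ereal (ln (packing_sum_sup \<mu> q t) / ln t))"

definition Lq_conjugate :: "real measure \<Rightarrow> real \<Rightarrow> ereal" where
  "Lq_conjugate \<mu> \<alpha> = (INF q::real. ereal (\<alpha> * q) - Lq_spectrum \<mu> q)"

definition level_set :: "real measure \<Rightarrow> real \<Rightarrow> real set" where
  "level_set \<mu> \<alpha> = {x \<in> supp \<mu>. has_local_dim \<mu> x \<alpha>}"

definition local_dims :: "real measure \<Rightarrow> real set" where
  "local_dims \<mu> = {\<alpha>. \<exists>x \<in> supp \<mu>. has_local_dim \<mu> x \<alpha>}"

definition multifractal_formalism :: "real measure \<Rightarrow> bool" where
  "multifractal_formalism \<mu> \<longleftrightarrow>
     emeasure \<mu> (space \<mu>) \<noteq> 0 \<and>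
     (\<exists>\<alpha>min \<alpha>max :: real.
        ((\<lambda>q. Lq_spectrum \<mu> q / ereal q) \<longlongrightarrow> ereal \<alpha>min) at_top \<and>
        ((\<lambda>q. Lq_spectrum \<mu> q / ereal q) \<longlongrightarrow> ereal \<alpha>max) at_bot \<and>
        local_dims \<mu> = {\<alpha>min..\<alpha>max} \<and>
        (\<forall>\<alpha>\<in>{\<alpha>min..\<alpha>max}. Lq_conjugate \<mu> \<alpha> = hausdorff_dim (level_set \<mu> \<alpha>)))"

text \<open>The measure E \<open>\<mapsto>\<close> \<open>\<mu>\<close>(E \<open>\<inter>\<close> A) on the whole line. This is not \<^const>\<open>restrict_space\<close>,
  whose underlying space is A, so that balls not contained in A are not measurable for it.\<close>

definition restrict_to :: "real measure \<Rightarrow> real set \<Rightarrow> real measure" where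
  "restrict_to \<mu> A = density \<mu> (indicator A)"

end

theory Submission
  imports Defs
begin

text \<open>
  The sets \<open>K\<^sub>m\<close> are chosen so that the restricted measures are monofractal. Under the weak separation
  condition the self-similar measure has some local dimension \<open>\<alpha>\<close> at almost every point, and by an
  Egorov-type argument it is carried, up to small mass, by compact sets A for which
  \<open>t\<^bsup>\<alpha>+\<epsilon>\<^esup> \<le> \<mu>(A \<inter> B(x,t)) \<le> t\<^bsup>\<alpha>-\<epsilon>\<^esup>\<close> for small t, uniformly in \<open>x \<in> A\<close>. For such an A one has
  \<open>\<tau>(q) = \<alpha>(q - 1)\<close>, all local dimensions are \<open>\<alpha>\<close>, and the Hausdorff dimension of A is \<open>\<alpha>\<close>. Finite unions
  of such sets are of the same kind, which gives an increasing sequence.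

  The dimension is \<open>\<alpha> = h/\<lambda>\<close> with h the asymptotic entropy of the random walk on the maps (words with the same
  map counted once) and \<open>\<lambda>\<close> the Lyapunov exponent. Cut a random word into k blocks of length m. By Chernoff
  bounds, the block maps have joint weight \<open>e\<^bsup>-kH\<^esup>\<close> up to small errors in the exponent. By weak
  separation at most \<open>M\<^sup>k\<close> tuples of block maps have the same composition, where M is linear in m, so the
  weight of the composition has the same exponent up to \<open>k ln M\<close>, which is negligible against km for large m.
\<close>

section \<open>Measures of uniform local dimension\<close>

text \<open>The obstacle is the lower bound: it concerns
  \<open>\<mu> (A \<inter> cball x t)\<close>, while an Egorov argument alone controls only
  \<open>\<mu> (cball x t)\<close>. So every dyadic interval in which the good set has too little
  mass is deleted from it. This is affordable because about 2^(n(\<alpha>+\<epsilon>)) typical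
  intervals exist at level n, and thresholds 2^(-n(\<alpha>+2\<epsilon>)) over them have a geometric
  sum. For this reason the working notion \<open>concentrated\<close> counts intervals instead of
  speaking of pointwise limits, and the errors must be summable in n, which the exponential Chernoff
  bounds provide. The limit that defines h is never taken. Each \<epsilon> gets its own block length
  m and its own exponent H / L, with H the entropy of the block maps and L their mean logarithmic
  contraction; this exponent is right only up to \<epsilon>. Two exponents for the same measure must
  nearly agree, because two families of intervals that each carry most of the mass overlap. Hence
  the exponents for \<epsilon> = 1/(j+1) form a Cauchy sequence, and \<alpha> is its limit.\<close>

text \<open>The upper bound is required at every x, not just at points of A, which makes the notion stable
  under finite unions.\<close>

definition uniform_dim :: "real measure \<Rightarrow> real \<Rightarrow> real set \<Rightarrow> bool" where
  "uniform_dim \<mu> \<alpha> A \<longleftrightarrow>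
     (\<forall>\<epsilon>>0. \<exists>b>0. \<forall>t. 0 < t \<and> t < b \<longrightarrow>
        (\<forall>x. measure \<mu> (A \<inter> cball x t) \<le> t powr (\<alpha> - \<epsilon>)) \<and>
        (\<forall>x\<in>A. t powr (\<alpha> + \<epsilon>) \<le> measure \<mu> (A \<inter> cball x t)))"

lemma uniform_dimD:
  assumes "uniform_dim \<mu> \<alpha> A" "0 < \<epsilon>"
  obtains b where "0 < b" "b \<le> 1"
    "\<And>t x. 0 < t \<Longrightarrow> t < b \<Longrightarrow> measure \<mu> (A \<inter> cball x t) \<le> t powr (\<alpha> - \<epsilon>)"
    "\<And>t x. 0 < t \<Longrightarrow> t < b \<Longrightarrow> x \<in> A \<Longrightarrow> t powr (\<alpha> + \<epsilon>) \<le> measure \<mu> (A \<inter> cball x t)"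
proof -
  obtain b where b: "b > 0" "\<forall>t. 0 < t \<and> t < b \<longrightarrow>
        (\<forall>x. measure \<mu> (A \<inter> cball x t) \<le> t powr (\<alpha> - \<epsilon>)) \<and>
        (\<forall>x\<in>A. t powr (\<alpha> + \<epsilon>) \<le> measure \<mu> (A \<inter> cball x t))"
    using assms unfolding uniform_dim_def by blast
  show ?thesis
    by (rule that[of "min b 1"]) (use b in auto)
qed

text \<open>Division by \<open>ln t < 0\<close> swaps the bounds: the lower bound on v caps the
  quotient from above.\<close>

lemma ln_div_ln_bounds:
  fixes t v a b :: real
  assumes "0 < t" "t < 1" "t powr a \<le> v" "v \<le> t powr b"
  shows "b \<le> ln v / ln t \<and> ln v / ln t \<le> a"
proof -
  have ln: "ln t < 0" using assms by simp
  have "0 < t powr a" using assms by simp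
  then have v: "v > 0" using assms by linarith
  have "a * ln t \<le> ln v"
    using assms v by (metis ln_le_cancel_iff ln_powr powr_gt_zero less_irrefl)
  moreover have "ln v \<le> b * ln t"
    using assms v by (metis ln_le_cancel_iff ln_powr powr_gt_zero less_irrefl)
  ultimately show ?thesis using ln by (simp add: field_simps)
qed

lemma tendsto_ln_div_ln:
  fixes f :: "real \<Rightarrow> real"
  assumes "\<And>\<epsilon>. 0 < \<epsilon> \<Longrightarrow> \<exists>b>0. \<forall>t. 0 < t \<and> t < b \<longrightarrow> t powr (c + \<epsilon>) \<le> f t \<and> f t \<le> t powr (c - \<epsilon>)"
  shows "((\<lambda>t. ln (f t) / ln t) \<longlongrightarrow> c) (at_right 0)"
proof (rule tendstoI)
  fix e :: real assume "e > 0"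
  then obtain b where b: "b > 0"
    "\<forall>t. 0 < t \<and> t < b \<longrightarrow> t powr (c + e/2) \<le> f t \<and> f t \<le> t powr (c - e/2)"
    using assms[of "e/2"] by auto
  have "dist (ln (f t) / ln t) c < e" if "0 < t" "t < min b 1" for t
    using ln_div_ln_bounds[of t "c + e/2" "f t" "c - e/2"] b that \<open>e > 0\<close>
    by (auto simp: dist_real_def abs_if)
  then show "\<forall>\<^sub>F t in at_right 0. dist (ln (f t) / ln t) c < e"
    unfolding eventually_at_right_field using b by (intro exI[of _ "min b 1"]) auto
qed

text \<open>The sign of q decides which bound on v yields which bound on \<open>v powr q\<close>.
  The symmetric form with \<bar>q\<bar> hides this, so that negative q need no separate treatment in
  the spectrum.\<close>

lemma powr_bounds_powr:
  fixes t v a \<epsilon> q :: real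
  assumes "0 < t" "t < 1" "0 < \<epsilon>" "t powr (a + \<epsilon>) \<le> v" "v \<le> t powr (a - \<epsilon>)"
  shows "t powr (a * q + \<epsilon> * \<bar>q\<bar>) \<le> v powr q" "v powr q \<le> t powr (a * q - \<epsilon> * \<bar>q\<bar>)"
proof -
  have "0 < t powr (a + \<epsilon>)" using assms by simp
  then have v: "v > 0" using assms by linarith
  have "t powr (a * q + \<epsilon> * \<bar>q\<bar>) \<le> v powr q \<and> v powr q \<le> t powr (a * q - \<epsilon> * \<bar>q\<bar>)"
  proof (cases "q \<ge> 0")
    case True
    have "(t powr (a + \<epsilon>)) powr q \<le> v powr q" "v powr q \<le> (t powr (a - \<epsilon>)) powr q"
      using True assms v by (auto intro!: powr_mono2)
    then show ?thesis using True by (simp add: powr_powr algebra_simps)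
  next
    case False
    have "(t powr (a - \<epsilon>)) powr q \<le> v powr q" "v powr q \<le> (t powr (a + \<epsilon>)) powr q"
      using False assms v by (auto intro!: powr_mono2')
    then show ?thesis using False by (simp add: powr_powr algebra_simps)
  qed
  then show "t powr (a * q + \<epsilon> * \<bar>q\<bar>) \<le> v powr q" "v powr q \<le> t powr (a * q - \<epsilon> * \<bar>q\<bar>)" by auto
qed

text \<open>The device by which multiplicative constants are absorbed into an arbitrarily small
  change of exponent.\<close>

lemma powr_eventually_le:
  fixes c \<epsilon> :: real
  assumes "0 < c" "0 < \<epsilon>"
  obtains b where "0 < b" "\<And>t. 0 < t \<Longrightarrow> t < b \<Longrightarrow> t powr \<epsilon> \<le> c"
proof (rule that[of "c powr (1/\<epsilon>)"])
  show "0 < c powr (1/\<epsilon>)" using assms by simp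
  fix t assume t: "0 < t" "t < c powr (1/\<epsilon>)"
  then have "t powr \<epsilon> \<le> (c powr (1/\<epsilon>)) powr \<epsilon>" using assms by (intro powr_mono2) auto
  then show "t powr \<epsilon> \<le> c" using assms by (simp add: powr_powr)
qed

locale uniform_set = finite_measure \<mu> for \<mu> :: "real measure" +
  fixes \<alpha> :: real and A :: "real set"
  assumes sets_mu: "sets \<mu> = sets borel"
    and compact_A: "compact A"
    and uniform: "uniform_dim \<mu> \<alpha> A"
    and pos_A: "0 < measure \<mu> A"
    and alpha_nonneg: "0 \<le> \<alpha>"
begin

lemma meas [measurable]: "A \<in> sets \<mu>" "cball x t \<in> sets \<mu>"
  using compact_A sets_mu by (auto intro: borel_closed compact_imp_closed)

lemma measure_restrict:
  assumes "B \<in> sets borel"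
  shows "measure (restrict_to \<mu> A) B = measure \<mu> (A \<inter> B)"
  unfolding restrict_to_def using assms sets_mu meas(1) by (simp add: measure_restricted)

lemma emeasure_restrict:
  assumes "B \<in> sets borel"
  shows "emeasure (restrict_to \<mu> A) B = emeasure \<mu> (A \<inter> B)"
  unfolding restrict_to_def using assms sets_mu meas(1) by (simp add: emeasure_restricted)

text \<open>A point off the compact set A has a null neighbourhood, and at a point of A the lower
  bound of \<open>uniform_dim\<close> charges every ball. Hence the packings in the spectrum are
  centred exactly in A.\<close>

lemma supp_restrict: "supp (restrict_to \<mu> A) = A"
proof (intro equalityI subsetI)
  fix x assume x: "x \<in> supp (restrict_to \<mu> A)"
  show "x \<in> A"
  proof (rule ccontr)
    assume "x \<notin> A"
    moreover have "open (- A)" using compact_A by (simp add: compact_imp_closed open_Compl)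
    ultimately have "emeasure (restrict_to \<mu> A) (- A) > 0" using x by (auto simp: supp_def)
    then show False using \<open>open (- A)\<close> by (subst (asm) emeasure_restrict) auto
  qed
next
  fix x assume x: "x \<in> A"
  obtain b where b: "0 < b" "b \<le> 1"
    "\<And>t x. 0 < t \<Longrightarrow> t < b \<Longrightarrow> x \<in> A \<Longrightarrow> t powr (\<alpha> + 1) \<le> measure \<mu> (A \<inter> cball x t)"
    using uniform_dimD[OF uniform, of 1] by (metis zero_less_one)
  show "x \<in> supp (restrict_to \<mu> A)"
    unfolding supp_def
  proof safe
    fix U :: "real set" assume U: "open U" "x \<in> U"
    then obtain e where e: "e > 0" "cball x e \<subseteq> U" by (metis open_contains_cball)
    define t where "t = min e (b/2)"
    have t: "0 < t" "t < b" "t \<le> e" using e b by (auto simp: t_def)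
    have "0 < t powr (\<alpha> + 1)" using t by simp
    also have "\<dots> \<le> measure \<mu> (A \<inter> cball x t)" using b t x by auto
    also have "\<dots> \<le> measure \<mu> (A \<inter> U)"
      using t e U sets_mu meas by (intro finite_measure_mono) (auto simp: subset_iff)
    finally show "0 < emeasure (restrict_to \<mu> A) U"
      using U by (subst emeasure_restrict) (auto simp: emeasure_eq_measure)
  qed
qed

lemma A_nonempty: "A \<noteq> {}"
  using pos_A by auto

lemma has_local_dim_restrict:
  assumes "x \<in> A"
  shows "has_local_dim (restrict_to \<mu> A) x \<alpha>"
  unfolding has_local_dim_def
proof (rule tendsto_ln_div_ln)
  fix \<epsilon> :: real assume "\<epsilon> > 0"
  from uniform_dimD[OF uniform this] obtain b where "0 < b"
    "\<And>t x. 0 < t \<Longrightarrow> t < b \<Longrightarrow> measure \<mu> (A \<inter> cball x t) \<le> t powr (\<alpha> - \<epsilon>)"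
    "\<And>t x. 0 < t \<Longrightarrow> t < b \<Longrightarrow> x \<in> A \<Longrightarrow> t powr (\<alpha> + \<epsilon>) \<le> measure \<mu> (A \<inter> cball x t)" by metis
  then show "\<exists>b>0. \<forall>t. 0 < t \<and> t < b \<longrightarrow>
      t powr (\<alpha> + \<epsilon>) \<le> measure (restrict_to \<mu> A) (cball x t) \<and>
      measure (restrict_to \<mu> A) (cball x t) \<le> t powr (\<alpha> - \<epsilon>)"
    using assms by (intro exI[of _ b]) (auto simp: measure_restrict)
qed

lemma local_dims_restrict: "local_dims (restrict_to \<mu> A) = {\<alpha>}"
proof -
  have "\<beta> = \<alpha>" if "x \<in> A" "has_local_dim (restrict_to \<mu> A) x \<beta>" for x \<beta>
    using that has_local_dim_restrict[OF that(1)] unfolding has_local_dim_def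
    by (metis tendsto_unique trivial_limit_at_right_real)
  then show ?thesis using A_nonempty has_local_dim_restrict
    unfolding local_dims_def supp_restrict by blast
qed

lemma level_set_restrict: "level_set (restrict_to \<mu> A) \<alpha> = A"
  unfolding level_set_def supp_restrict using has_local_dim_restrict by auto

section \<open>Packings and the spectrum of the restricted measure\<close>

definition packings :: "real \<Rightarrow> real set set" where
  "packings t = {P. finite P \<and> P \<subseteq> A \<and> disjoint_family_on (\<lambda>x. cball x t) P}"

lemma card_packing_le:
  assumes "P \<in> packings t" "0 < c" "\<And>x. x \<in> A \<Longrightarrow> c \<le> measure \<mu> (A \<inter> cball x t)"
  shows "real (card P) * c \<le> measure \<mu> A"
proof -
  have P: "finite P" "P \<subseteq> A" "disjoint_family_on (\<lambda>x. cball x t) P"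
    using assms by (auto simp: packings_def)
  have "real (card P) * c = (\<Sum>x\<in>P. c)" by simp
  also have "\<dots> \<le> (\<Sum>x\<in>P. measure \<mu> (A \<inter> cball x t))"
    using assms P by (intro sum_mono) auto
  also have "\<dots> = measure \<mu> (\<Union>x\<in>P. A \<inter> cball x t)"
    using P by (intro finite_measure_finite_Union[symmetric]) (auto simp: meas disjoint_family_on_def)
  also have "\<dots> \<le> measure \<mu> A" by (intro finite_measure_mono) (auto simp: meas)
  finally show ?thesis .
qed

text \<open>Disjoint balls of mass at least c number at most \<open>measure \<mu> A / c\<close>, so
  a packing of greatest cardinality exists. A point further than 2t from all its centres could be
  added, so the doubled balls cover A.\<close>

lemma exists_maximal_packing:
  assumes "0 < t" "0 < c" "\<And>x. x \<in> A \<Longrightarrow> c \<le> measure \<mu> (A \<inter> cball x t)"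
  obtains P where "P \<in> packings t" "A \<subseteq> (\<Union>x\<in>P. cball x (2 * t))"
proof -
  have "card P < Suc (nat \<lceil>measure \<mu> A / c\<rceil>)" if "P \<in> packings t" for P
  proof -
    have "real (card P) \<le> measure \<mu> A / c"
      using card_packing_le[OF that assms(2,3)] assms(2) by (simp add: field_simps)
    then show ?thesis by linarith
  qed
  moreover have "{} \<in> packings t" by (auto simp: packings_def disjoint_family_on_def)
  ultimately obtain P where P: "P \<in> packings t" "\<And>P'. P' \<in> packings t \<Longrightarrow> card P' \<le> card P"
    using ex_has_greatest_nat[of "\<lambda>P. P \<in> packings t" "{}" card] by (metis less_imp_le)
  have "A \<subseteq> (\<Union>x\<in>P. cball x (2 * t))"
  proof (rule ccontr)
    assume "\<not> ?thesis"
    then obtain y where "y \<in> A" "y \<notin> (\<Union>x\<in>P. cball x (2 * t))" by blast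
    then have y: "y \<in> A" "\<And>x. x \<in> P \<Longrightarrow> dist x y > 2 * t"
      by (auto simp: not_le)
    then have "y \<notin> P" using \<open>t > 0\<close> by fastforce
    have "cball x t \<inter> cball y t = {}" if "x \<in> P" for x
    proof (rule ccontr)
      assume "cball x t \<inter> cball y t \<noteq> {}"
      then obtain z where "dist x z \<le> t" "dist y z \<le> t" by auto
      then have "dist x y \<le> 2 * t" using dist_triangle2[of x y z] by simp
      then show False using y(2)[OF that] by simp
    qed
    then have "insert y P \<in> packings t"
      using P y unfolding packings_def disjoint_family_on_def by (auto simp: Int_commute)
    then have "card (insert y P) \<le> card P" using P by blast
    then show False using P \<open>y \<notin> P\<close> by (simp add: packings_def)
  qed
  then show ?thesis using that P by blast
qed

text \<open>Every ball centred in A has mass about t^\<alpha>, so a packing P contributes about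
  \<open>card P\<close> times t^(\<alpha> q). Total mass bounds \<open>card P\<close> by about
  t^(-\<alpha>) for every packing; a maximal one attains this order because its doubled balls cover
  A.\<close>

lemma packing_sum_sup_bounds:
  assumes "0 < \<epsilon>"
  shows "\<exists>b>0. \<forall>t. 0 < t \<and> t < b \<longrightarrow>
           t powr (\<alpha> * (q - 1) + \<epsilon>) \<le> packing_sum_sup (restrict_to \<mu> A) q t \<and>
           packing_sum_sup (restrict_to \<mu> A) q t \<le> t powr (\<alpha> * (q - 1) - \<epsilon>)"
proof -
  \<comment> \<open>The error budget: taking q-th powers costs e \<bar>q\<bar>, and counting the
    balls costs 2e, one e for the ball masses and one to absorb the constants.\<close>
  define e where "e = \<epsilon> / (\<bar>q\<bar> + 2)"
  have "\<epsilon> = e * (\<bar>q\<bar> + 2)" unfolding e_def by (simp add: add_nonneg_eq_0_iff)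
  then have "\<epsilon> = e * \<bar>q\<bar> + 2 * e" by (simp only: distrib_left mult.commute)
  moreover have "e > 0" unfolding e_def using assms by (intro divide_pos_pos) auto
  ultimately have e: "e > 0" "\<epsilon> = e * \<bar>q\<bar> + 2 * e" by auto
  obtain b where b: "0 < b" "b \<le> 1"
    "\<And>t x. 0 < t \<Longrightarrow> t < b \<Longrightarrow> measure \<mu> (A \<inter> cball x t) \<le> t powr (\<alpha> - e)"
    "\<And>t x. 0 < t \<Longrightarrow> t < b \<Longrightarrow> x \<in> A \<Longrightarrow> t powr (\<alpha> + e) \<le> measure \<mu> (A \<inter> cball x t)"
    using uniform_dimD[OF uniform e(1)] by metis
  obtain b1 where b1: "0 < b1" "\<And>t. 0 < t \<Longrightarrow> t < b1 \<Longrightarrow> t powr e \<le> 1 / measure \<mu> A"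
    using powr_eventually_le[of "1 / measure \<mu> A" e] e pos_A by (metis zero_less_divide_1_iff)
  have "0 < measure \<mu> A / 2 powr (\<alpha> - e)" using pos_A by simp
  then obtain b2 where b2: "0 < b2" "\<And>t. 0 < t \<Longrightarrow> t < b2 \<Longrightarrow> t powr e \<le> measure \<mu> A / 2 powr (\<alpha> - e)"
    using powr_eventually_le[of "measure \<mu> A / 2 powr (\<alpha> - e)" e] e(1) by metis
  have main: "t powr (\<alpha> * (q - 1) + \<epsilon>) \<le> packing_sum_sup (restrict_to \<mu> A) q t \<and>
           packing_sum_sup (restrict_to \<mu> A) q t \<le> t powr (\<alpha> * (q - 1) - \<epsilon>)"
    if t: "0 < t" "t < Min {b / 2, b1, b2}" for t
  proof -
    have t': "0 < t" "t < b" "2 * t < b" "t < b1" "t < b2" "t < 1" using t b by auto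
    let ?S = "\<lambda>P. \<Sum>x\<in>P. measure (restrict_to \<mu> A) (cball x t) powr q"
    have bd: "t powr (\<alpha> * q + e * \<bar>q\<bar>) \<le> measure (restrict_to \<mu> A) (cball x t) powr q"
       "measure (restrict_to \<mu> A) (cball x t) powr q \<le> t powr (\<alpha> * q - e * \<bar>q\<bar>)" if "x \<in> A" for x
      using powr_bounds_powr[of t e \<alpha> "measure (restrict_to \<mu> A) (cball x t)" q] b t' that e
      by (auto simp: measure_restrict)
    have upper: "?S P \<le> t powr (\<alpha> * (q - 1) - \<epsilon>)" if P: "P \<in> packings t" for P
    proof -
      have "real (card P) * t powr (\<alpha> + e) \<le> measure \<mu> A"
        using P t' b by (intro card_packing_le) auto
      moreover have "measure \<mu> A * t powr e \<le> 1"
        using b1(2)[of t] t' pos_A by (simp add: field_simps)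
      ultimately have "real (card P) * t powr (\<alpha> + e) * t powr e \<le> 1"
        by (smt (verit) mult_right_mono powr_ge_zero)
      then have c: "real (card P) \<le> t powr (-\<alpha> - 2 * e)"
      proof -
        have "real (card P) = real (card P) * t powr (\<alpha> + e) * t powr e * t powr (-\<alpha> - 2 * e)"
          using t' by (simp add: powr_add[symmetric] mult.assoc)
        also have "\<dots> \<le> 1 * t powr (-\<alpha> - 2 * e)"
          using \<open>real (card P) * t powr (\<alpha> + e) * t powr e \<le> 1\<close> by (intro mult_right_mono) auto
        finally show ?thesis by simp
      qed
      have "?S P \<le> (\<Sum>x\<in>P. t powr (\<alpha> * q - e * \<bar>q\<bar>))"
        using P bd by (intro sum_mono) (auto simp: packings_def)
      also have "\<dots> = real (card P) * t powr (\<alpha> * q - e * \<bar>q\<bar>)" by simp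
      also have "\<dots> \<le> t powr (-\<alpha> - 2 * e) * t powr (\<alpha> * q - e * \<bar>q\<bar>)"
        using c by (intro mult_right_mono) auto
      also have "\<dots> = t powr (\<alpha> * (q - 1) - \<epsilon>)"
        by (simp add: powr_add[symmetric] e(2) algebra_simps)
      finally show ?thesis .
    qed
    obtain P where P: "P \<in> packings t" "A \<subseteq> (\<Union>x\<in>P. cball x (2 * t))"
      using exists_maximal_packing[of t "t powr (\<alpha> + e)"] t' b by auto
    have finP: "finite P" "P \<subseteq> A" using P by (auto simp: packings_def)
    have lower: "t powr (\<alpha> * (q - 1) + \<epsilon>) \<le> ?S P"
    proof -
      have "measure \<mu> A \<le> measure \<mu> (\<Union>x\<in>P. A \<inter> cball x (2 * t))"
        using P finP by (intro finite_measure_mono sets.finite_UN sets.Int meas) blast+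
      also have "\<dots> \<le> (\<Sum>x\<in>P. measure \<mu> (A \<inter> cball x (2 * t)))"
        using finP by (intro finite_measure_subadditive_finite) (auto simp: meas)
      also have "\<dots> \<le> (\<Sum>x\<in>P. (2 * t) powr (\<alpha> - e))"
        using b t' by (intro sum_mono) auto
      finally have "measure \<mu> A \<le> real (card P) * (2 powr (\<alpha> - e) * t powr (\<alpha> - e))"
        using t' by (simp add: powr_mult)
      then have "measure \<mu> A / 2 powr (\<alpha> - e) \<le> real (card P) * t powr (\<alpha> - e)"
        by (simp add: field_simps)
      then have "t powr e \<le> real (card P) * t powr (\<alpha> - e)" using b2(2)[of t] t' by linarith
      then have "t powr e * t powr (-(\<alpha> - e)) \<le> real (card P) * t powr (\<alpha> - e) * t powr (-(\<alpha> - e))"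
        by (intro mult_right_mono) auto
      then have c: "t powr (- \<alpha> + 2 * e) \<le> real (card P)"
        using t' by (simp add: powr_add[symmetric] mult.assoc algebra_simps)
      have "t powr (\<alpha> * (q - 1) + \<epsilon>) = t powr (-\<alpha> + 2 * e) * t powr (\<alpha> * q + e * \<bar>q\<bar>)"
        by (simp add: powr_add[symmetric] e(2) algebra_simps)
      also have "\<dots> \<le> real (card P) * t powr (\<alpha> * q + e * \<bar>q\<bar>)"
        using c by (intro mult_right_mono) auto
      also have "\<dots> = (\<Sum>x\<in>P. t powr (\<alpha> * q + e * \<bar>q\<bar>))" by simp
      also have "\<dots> \<le> ?S P" using finP bd by (intro sum_mono) auto
      finally show ?thesis .
    qed
    have eq: "packing_sum_sup (restrict_to \<mu> A) q t = (SUP P\<in>packings t. ?S P)"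
      unfolding packing_sum_sup_def supp_restrict packings_def ..
    have bdd: "bdd_above (?S ` packings t)" using upper by (auto intro!: bdd_aboveI)
    have "t powr (\<alpha> * (q - 1) + \<epsilon>) \<le> (SUP P\<in>packings t. ?S P)"
      using cSUP_upper[OF P(1) bdd] lower by linarith
    moreover have "(SUP P\<in>packings t. ?S P) \<le> t powr (\<alpha> * (q - 1) - \<epsilon>)"
      using upper P(1) by (intro cSUP_least) auto
    ultimately show ?thesis unfolding eq by auto
  qed
  show ?thesis
    using main b(1) b1(1) b2(1) by (intro exI[of _ "Min {b / 2, b1, b2}"]) auto
qed

lemma Lq_spectrum_restrict: "Lq_spectrum (restrict_to \<mu> A) q = ereal (\<alpha> * (q - 1))"
  unfolding Lq_spectrum_def
proof (rule lim_imp_Liminf)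
  show "at_right (0::real) \<noteq> bot" by (simp add: trivial_limit_at_right_real)
  have "((\<lambda>t. ln (packing_sum_sup (restrict_to \<mu> A) q t) / ln t) \<longlongrightarrow> \<alpha> * (q - 1)) (at_right 0)"
    by (rule tendsto_ln_div_ln[OF packing_sum_sup_bounds])
  then show "((\<lambda>t. ereal (ln (packing_sum_sup (restrict_to \<mu> A) q t) / ln t))
      \<longlongrightarrow> ereal (\<alpha> * (q - 1))) (at_right 0)"
    by simp
qed

lemma Lq_conjugate_restrict: "Lq_conjugate (restrict_to \<mu> A) \<alpha> = ereal \<alpha>"
proof -
  have "ereal (\<alpha> * q) - Lq_spectrum (restrict_to \<mu> A) q = ereal \<alpha>" for q
    unfolding Lq_spectrum_restrict by (simp add: algebra_simps)
  then show ?thesis unfolding Lq_conjugate_def by simp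
qed

lemma Lq_spectrum_div_tendsto:
  assumes "F = at_top \<or> F = at_bot"
  shows "((\<lambda>q. Lq_spectrum (restrict_to \<mu> A) q / ereal q) \<longlongrightarrow> ereal \<alpha>) F"
proof -
  have inv: "((\<lambda>q::real. inverse q) \<longlongrightarrow> 0) F"
    using assms tendsto_inverse_0[where 'a = real] at_top_le_at_infinity at_bot_le_at_infinity
    by (auto intro: tendsto_mono)
  have nz: "\<forall>\<^sub>F q in F. q \<noteq> (0::real)"
    using assms eventually_gt_at_top[of "0::real"] eventually_gt_at_bot[of "0::real"]
    by (auto elim: eventually_mono)
  have "((\<lambda>q. \<alpha> - \<alpha> * inverse q) \<longlongrightarrow> \<alpha> - \<alpha> * 0) F"
    by (intro tendsto_intros inv)
  then have "((\<lambda>q. ereal (\<alpha> - \<alpha> * inverse q)) \<longlongrightarrow> ereal \<alpha>) F" by simp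
  then show ?thesis
    by (rule Lim_transform_eventually)
       (use nz in \<open>eventually_elim, simp add: Lq_spectrum_restrict field_simps\<close>)
qed

section \<open>Hausdorff dimension of A\<close>

lemma hausdorff_measure_eq_0:
  assumes "\<alpha> < s"
  shows "hausdorff_measure s A = 0"
proof -
  \<comment> \<open>The doubled balls of a maximal packing cover A economically: their number is at
    most a constant times t^(-\<alpha>-e), and each contributes a constant times t^s. With s =
    \<alpha> + 3e a factor t^(2e) is left over; one t^e absorbs the constants.\<close>
  define e where "e = (s - \<alpha>) / 3"
  have e: "e > 0" "s = \<alpha> + 3 * e" using assms by (auto simp: e_def diff_divide_distrib)
  obtain b where b: "0 < b" "b \<le> 1"
    "\<And>t x. 0 < t \<Longrightarrow> t < b \<Longrightarrow> x \<in> A \<Longrightarrow> t powr (\<alpha> + e) \<le> measure \<mu> (A \<inter> cball x t)"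
    using uniform_dimD[OF uniform e(1)] by metis
  have pre: "hausdorff_premeasure s \<delta> A \<le> ennreal \<eta>" if \<delta>: "\<delta> > 0" and \<eta>: "\<eta> > 0" for \<delta> \<eta>
  proof -
    have "0 < \<eta> / (measure \<mu> A * 4 powr s)" using \<eta> pos_A by simp
    then obtain b1 where b1: "0 < b1" "\<And>t. 0 < t \<Longrightarrow> t < b1 \<Longrightarrow> t powr e \<le> \<eta> / (measure \<mu> A * 4 powr s)"
      using powr_eventually_le[of _ e] e(1) by metis
    define t where "t = Min {b / 2, b1 / 2, \<delta> / 4}"
    have t: "0 < t" "t < b" "t < b1" "4 * t \<le> \<delta>" "t < 1" using b b1 \<delta> by (auto simp: t_def)
    obtain P where P: "P \<in> packings t" "A \<subseteq> (\<Union>x\<in>P. cball x (2 * t))"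
      using exists_maximal_packing[of t "t powr (\<alpha> + e)"] t b by auto
    have finP: "finite P" "P \<subseteq> A" using P by (auto simp: packings_def)
    obtain xs where xs: "set xs = P" "distinct xs" using finite_distinct_list[OF finP(1)] by blast
    define U where "U n = (if n < length xs then cball (xs ! n) (2 * t) else {})" for n
    have diam: "diameter (cball x (2 * t)) = 4 * t" for x :: real
      using t by (simp add: diameter_cball)
    have "A \<subseteq> (\<Union>n. U n)"
    proof
      fix y assume "y \<in> A"
      then obtain x where "x \<in> set xs" "y \<in> cball x (2 * t)" using P xs by blast
      then show "y \<in> (\<Union>n. U n)" unfolding U_def by (auto simp: in_set_conv_nth)
    qed
    moreover have "bounded (U n) \<and> diameter (U n) \<le> \<delta>" for n
      using t diam \<delta> by (auto simp: U_def)
    ultimately have "hausdorff_premeasure s \<delta> A \<le> (\<Sum>n. diam_pow s (U n))"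
      unfolding hausdorff_premeasure_def by (intro INF_lower) auto
    also have "\<dots> = (\<Sum>n<length xs. diam_pow s (U n))"
      by (rule suminf_finite) (auto simp: U_def diam_pow_def)
    also have "\<dots> = (\<Sum>n<length xs. ennreal ((4 * t) powr s))"
      using t diam e alpha_nonneg by (intro sum.cong) (auto simp: U_def diam_pow_def)
    also have "\<dots> = ennreal (real (card P) * (4 * t) powr s)"
      using xs distinct_card[of xs] by (simp add: ennreal_mult ennreal_of_nat_eq_real_of_nat)
    also have "\<dots> \<le> ennreal \<eta>"
    proof (rule ennreal_leI)
      have "real (card P) * (4 * t) powr s = real (card P) * t powr (\<alpha> + e) * 4 powr s * t powr (2 * e)"
        using t by (simp add: powr_mult e(2) powr_add[symmetric] algebra_simps)
      also have "\<dots> \<le> measure \<mu> A * 4 powr s * t powr (2 * e)"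
        using card_packing_le[OF P(1), of "t powr (\<alpha> + e)"] t b
        by (intro mult_right_mono) auto
      also have "\<dots> \<le> measure \<mu> A * 4 powr s * t powr e"
        using t e pos_A by (intro mult_left_mono powr_mono') auto
      also have "\<dots> \<le> \<eta>"
        using b1(2)[of t] t pos_A by (simp add: field_simps)
      finally show "real (card P) * (4 * t) powr s \<le> \<eta>" .
    qed
    finally show ?thesis .
  qed
  have "hausdorff_premeasure s \<delta> A = 0" if "\<delta> > 0" for \<delta>
  proof (rule ccontr)
    assume nz: "hausdorff_premeasure s \<delta> A \<noteq> 0"
    have "hausdorff_premeasure s \<delta> A \<le> 0"
      by (rule ennreal_le_epsilon) (use pre[OF that] in simp)
    then show False using nz by simp
  qed
  then show ?thesis unfolding hausdorff_measure_def by (auto intro!: SUP_eq_const)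
qed

text \<open>The mass distribution principle: the part of A inside a set of small diameter lies in a
  ball of that radius about a point of A, whose mass is at most the s-th power of the diameter. So
  no fine cover can have a sum below the mass of A.\<close>

lemma hausdorff_measure_pos:
  assumes "0 \<le> s" "s < \<alpha>"
  shows "hausdorff_measure s A \<noteq> 0"
proof
  assume H: "hausdorff_measure s A = 0"
  define e where "e = \<alpha> - s"
  have e: "e > 0" "\<alpha> - e = s" using assms by (auto simp: e_def)
  obtain b where b: "0 < b" "b \<le> 1"
    "\<And>t x. 0 < t \<Longrightarrow> t < b \<Longrightarrow> measure \<mu> (A \<inter> cball x t) \<le> t powr s"
    using uniform_dimD[OF uniform e(1)] unfolding e(2) by metis
  have "hausdorff_premeasure s (b/2) A = 0"
    using H b unfolding hausdorff_measure_def
    by (metis SUP_upper half_gt_zero greaterThan_iff le_zero_eq)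
  moreover have "emeasure \<mu> A \<le> hausdorff_premeasure s (b/2) A"
    unfolding hausdorff_premeasure_def
  proof (rule INF_greatest, safe)
    fix U :: "nat \<Rightarrow> real set"
    assume U: "A \<subseteq> (\<Union>n. U n)" "\<forall>n. bounded (U n) \<and> diameter (U n) \<le> b/2"
    define c where "c n = (SOME x. x \<in> A \<inter> U n)" for n
    \<comment> \<open>Covering sets are arbitrary and may fail to be measurable. \<open>V n\<close>
      is a measurable set that contains \<open>A \<inter> U n\<close> and obeys the same mass
      bound.\<close>
    define V where "V n = (if A \<inter> U n = {} then {} else A \<inter> cball (c n) (diameter (U n)))" for n
    have c: "c n \<in> A \<inter> U n" if "A \<inter> U n \<noteq> {}" for n
      unfolding c_def using that by (metis ex_in_conv someI_ex)
    have V: "V n \<in> sets \<mu>" for n unfolding V_def by (auto simp: meas)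
    have sub: "A \<subseteq> (\<Union>n. V n)"
    proof
      fix y assume y: "y \<in> A"
      then obtain n where n: "y \<in> U n" using U by auto
      then have "c n \<in> U n" "A \<inter> U n \<noteq> {}" using c[of n] y by auto
      then have "dist (c n) y \<le> diameter (U n)"
        using U n by (intro diameter_bounded_bound) auto
      then have "y \<in> V n" using y \<open>A \<inter> U n \<noteq> {}\<close> by (auto simp: V_def)
      then show "y \<in> (\<Union>n. V n)" by blast
    qed
    have "emeasure \<mu> A \<le> emeasure \<mu> (\<Union>n. V n)"
      using sub V by (intro emeasure_mono) auto
    also have "\<dots> \<le> (\<Sum>n. emeasure \<mu> (V n))"
      using V by (intro emeasure_subadditive_countably) auto
    also have "\<dots> \<le> (\<Sum>n. diam_pow s (U n))"
    proof (rule suminf_le)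
      fix n
      show "emeasure \<mu> (V n) \<le> diam_pow s (U n)"
      proof (cases "A \<inter> U n = {}")
        case True then show ?thesis by (simp add: V_def)
      next
        case False
        then have ne: "U n \<noteq> {}" by auto
        let ?r = "diameter (U n)"
        have r0: "0 \<le> ?r" using U by (intro diameter_ge_0) auto
        have rb: "?r < b" using U b by (smt (verit) field_sum_of_halves)
        have "measure \<mu> (V n) \<le> (if s = 0 then 1 else ?r powr s)"
        \<comment> \<open>A set of diameter 0 offers no positive radius, so balls shrinking to its
          point are used. For s = 0 the bound is 1, as in \<open>diam_pow\<close>, and not
          \<open>0 powr 0\<close>.\<close>
        proof (cases "?r = 0")
          case True
          have small: "measure \<mu> (V n) \<le> t powr s" if "0 < t" "t < b" for t
          proof -
            have "measure \<mu> (V n) \<le> measure \<mu> (A \<inter> cball (c n) t)"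
              using True that False by (intro finite_measure_mono) (auto simp: V_def meas)
            then show ?thesis using b(3)[OF that] by (meson order_trans)
          qed
          show ?thesis
          proof (cases "s = 0")
            case True
            then show ?thesis using small[of "b/2"] b by auto
          next
            case sn: False
            have "measure \<mu> (V n) \<le> 0"
            proof (rule field_le_epsilon)
              fix \<eta> :: real assume "\<eta> > 0"
              then obtain b1 where b1: "0 < b1" "\<And>t. 0 < t \<Longrightarrow> t < b1 \<Longrightarrow> t powr s \<le> \<eta>"
                using powr_eventually_le[of \<eta> s] sn assms by auto
              have "0 < min b b1 / 2" "min b b1 / 2 < b" "min b b1 / 2 < b1" using b b1 by auto
              then show "measure \<mu> (V n) \<le> 0 + \<eta>"
                using small[of "min b b1 / 2"] b1(2)[of "min b b1 / 2"] by linarith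
            qed
            then show ?thesis using sn by (smt (verit) powr_ge_zero)
          qed
        next
          case rn: False
          then have "?r > 0" using r0 by simp
          then have "measure \<mu> (V n) \<le> ?r powr s"
            using b(3)[of ?r "c n"] rb False by (auto simp: V_def)
          then show ?thesis using \<open>?r > 0\<close> by auto
        qed
        then have "ennreal (measure \<mu> (V n)) \<le> ennreal (if s = 0 then 1 else ?r powr s)"
          by (rule ennreal_leI)
        then show ?thesis using ne by (simp add: diam_pow_def emeasure_eq_measure split: if_splits)
      qed
    qed auto
    finally show "emeasure \<mu> A \<le> (\<Sum>n. diam_pow s (U n))" .
  qed
  ultimately show False using pos_A by (simp add: emeasure_eq_measure)
qed

lemma hausdorff_dim_eq: "hausdorff_dim A = ereal \<alpha>"
  unfolding hausdorff_dim_def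
proof (rule antisym)
  show "ereal \<alpha> \<le> Inf {ereal s |s. 0 \<le> s \<and> hausdorff_measure s A = 0}"
    using hausdorff_measure_pos by (auto intro!: Inf_greatest) (meson not_le)
  show "Inf {ereal s |s. 0 \<le> s \<and> hausdorff_measure s A = 0} \<le> ereal \<alpha>"
  proof (rule ereal_le_epsilon2)
    fix e :: real assume "e > 0"
    then show "Inf {ereal s |s. 0 \<le> s \<and> hausdorff_measure s A = 0} \<le> ereal \<alpha> + ereal e"
      using alpha_nonneg hausdorff_measure_eq_0[of "\<alpha> + e"] by (intro Inf_lower) auto
  qed
qed

lemma multifractal_formalism_restrict: "multifractal_formalism (restrict_to \<mu> A)"
proof -
  have "space (restrict_to \<mu> A) = UNIV"
    using sets_eq_imp_space_eq[OF sets_mu] by (simp add: restrict_to_def)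
  then have "emeasure (restrict_to \<mu> A) (space (restrict_to \<mu> A)) \<noteq> 0"
    using pos_A by (simp add: emeasure_restrict emeasure_eq_measure)
  then show ?thesis
    unfolding multifractal_formalism_def
    by (intro conjI exI[of _ \<alpha>])
       (auto intro: Lq_spectrum_div_tendsto simp: local_dims_restrict Lq_conjugate_restrict
          level_set_restrict hausdorff_dim_eq)
qed

end

text \<open>The masses of the two parts add, and the half of \<epsilon> held back absorbs the factor
  2. A ball centred in A may see much of B, which is where the upper bound at arbitrary centres
  enters. The lower bound is inherited from whichever set contains the centre.\<close>

lemma uniform_dim_Un:
  assumes fin: "finite_measure \<mu>" and meas: "A \<in> sets \<mu>" "B \<in> sets \<mu>" and sets: "sets \<mu> = sets borel"
    and A: "uniform_dim \<mu> \<alpha> A" and B: "uniform_dim \<mu> \<alpha> B"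
  shows "uniform_dim \<mu> \<alpha> (A \<union> B)"
  unfolding uniform_dim_def
proof (intro allI impI)
  interpret finite_measure \<mu> by fact
  fix \<epsilon> :: real assume "\<epsilon> > 0"
  then have e2: "\<epsilon> / 2 > 0" by simp
  obtain b where b: "0 < b" "b \<le> 1"
    "\<And>t x. 0 < t \<Longrightarrow> t < b \<Longrightarrow> measure \<mu> (A \<inter> cball x t) \<le> t powr (\<alpha> - \<epsilon> / 2)"
    "\<And>t x. 0 < t \<Longrightarrow> t < b \<Longrightarrow> x \<in> A \<Longrightarrow> t powr (\<alpha> + \<epsilon> / 2) \<le> measure \<mu> (A \<inter> cball x t)"
    using uniform_dimD[OF A e2] by metis
  obtain c where c: "0 < c" "c \<le> 1"
    "\<And>t x. 0 < t \<Longrightarrow> t < c \<Longrightarrow> measure \<mu> (B \<inter> cball x t) \<le> t powr (\<alpha> - \<epsilon> / 2)"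
    "\<And>t x. 0 < t \<Longrightarrow> t < c \<Longrightarrow> x \<in> B \<Longrightarrow> t powr (\<alpha> + \<epsilon> / 2) \<le> measure \<mu> (B \<inter> cball x t)"
    using uniform_dimD[OF B e2] by metis
  obtain h where h: "0 < h" "\<And>t. 0 < t \<Longrightarrow> t < h \<Longrightarrow> t powr (\<epsilon> / 2) \<le> 1 / 2"
    using powr_eventually_le[of "1/2" "\<epsilon> / 2"] e2 by auto
  have bl: "cball x t \<in> sets \<mu>" for x t using sets by simp
  show "\<exists>b>0. \<forall>t. 0 < t \<and> t < b \<longrightarrow>
      (\<forall>x. measure \<mu> ((A \<union> B) \<inter> cball x t) \<le> t powr (\<alpha> - \<epsilon>)) \<and>
      (\<forall>x\<in>A \<union> B. t powr (\<alpha> + \<epsilon>) \<le> measure \<mu> ((A \<union> B) \<inter> cball x t))"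
  proof (intro exI[of _ "Min {b, c, h}"] conjI allI impI ballI)
    show "0 < Min {b, c, h}" using b c h by simp
  next
    fix t x :: real assume "0 < t \<and> t < Min {b, c, h}"
    then have t: "0 < t" "t < b" "t < c" "t < h" by auto
    have "measure \<mu> ((A \<union> B) \<inter> cball x t) \<le> measure \<mu> (A \<inter> cball x t) + measure \<mu> (B \<inter> cball x t)"
      unfolding Int_Un_distrib2 using meas bl by (intro measure_Un_le) auto
    also have "\<dots> \<le> t powr (\<alpha> - \<epsilon> / 2) * 2" using b(3)[of t x] c(3)[of t x] t by simp
    also have "\<dots> = t powr (\<alpha> - \<epsilon>) * t powr (\<epsilon> / 2) * 2"
      by (simp add: powr_add[symmetric])
    also have "\<dots> \<le> t powr (\<alpha> - \<epsilon>) * (1 / 2) * 2"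
      using h(2)[of t] t by (intro mult_right_mono mult_left_mono) auto
    finally show "measure \<mu> ((A \<union> B) \<inter> cball x t) \<le> t powr (\<alpha> - \<epsilon>)" by simp
  next
    fix t x :: real assume "0 < t \<and> t < Min {b, c, h}"
    then have t: "0 < t" "t < b" "t < c" "t < 1" using b by auto
    assume x: "x \<in> A \<union> B"
    have "t powr (\<alpha> + \<epsilon>) \<le> t powr (\<alpha> + \<epsilon> / 2)"
      using t \<open>\<epsilon> > 0\<close> by (intro powr_mono') auto
    also have "\<dots> \<le> max (measure \<mu> (A \<inter> cball x t)) (measure \<mu> (B \<inter> cball x t))"
      using x b(4)[of t x] c(4)[of t x] t by (auto simp: max_def)
    also have "\<dots> \<le> measure \<mu> ((A \<union> B) \<inter> cball x t)"
      unfolding max.bounded_iff using meas bl by (intro conjI finite_measure_mono) auto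
    finally show "t powr (\<alpha> + \<epsilon>) \<le> measure \<mu> ((A \<union> B) \<inter> cball x t)" .
  qed
qed

section \<open>Dyadic concentration\<close>

definition dyadic :: "nat \<Rightarrow> int \<Rightarrow> real set" where
  "dyadic n i = {x. \<lfloor>x * 2 ^ n\<rfloor> = i}"

lemma dyadic_floor: "x \<in> dyadic n \<lfloor>x * 2 ^ n\<rfloor>"
  by (simp add: dyadic_def)

lemma dyadic_borel [measurable, simp]: "dyadic n i \<in> sets borel"
proof -
  have "dyadic n i = (\<lambda>x. \<lfloor>x * 2 ^ n\<rfloor>) -` {i} \<inter> space borel" by (auto simp: dyadic_def)
  also have "\<dots> \<in> sets borel" by measurable
  finally show ?thesis .
qed

lemma dyadic_eq_atLeastLessThan: "dyadic n i = {of_int i / 2 ^ n ..< of_int (i + 1) / 2 ^ n}"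
  by (auto simp: dyadic_def floor_eq_iff field_simps)

lemma disjoint_dyadic: "i \<noteq> j \<Longrightarrow> dyadic n i \<inter> dyadic n j = {}"
  by (auto simp: dyadic_def)

lemma dyadic_subset_cball:
  assumes "x \<in> dyadic n i"
  shows "dyadic n i \<subseteq> cball x ((1/2) ^ n)"
  using assms unfolding dyadic_eq_atLeastLessThan
  by (auto simp: dist_real_def power_one_over abs_le_iff field_simps)

text \<open>A radius of at most two cell lengths moves the index by at most two, hence five cells
  and the factor 5 in the later ball estimate.\<close>

lemma cball_subset_dyadic:
  assumes "t \<le> 2 * (1/2) ^ n"
  shows "cball x t \<subseteq> (\<Union>i\<in>{\<lfloor>x * 2 ^ n\<rfloor> - 2 .. \<lfloor>x * 2 ^ n\<rfloor> + 2}. dyadic n i)"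
proof
  fix y assume "y \<in> cball x t"
  then have "\<bar>x - y\<bar> \<le> 2 * (1/2) ^ n" using assms by (simp add: dist_real_def)
  then have "\<bar>x - y\<bar> * 2 ^ n \<le> 2" by (simp add: power_one_over field_simps)
  then have "\<bar>x * 2 ^ n - y * 2 ^ n\<bar> \<le> 2"
    by (simp add: abs_mult left_diff_distrib[symmetric])
  then have "\<lfloor>y * 2 ^ n\<rfloor> \<in> {\<lfloor>x * 2 ^ n\<rfloor> - 2 .. \<lfloor>x * 2 ^ n\<rfloor> + 2}" by (auto; linarith)
  then show "y \<in> (\<Union>i\<in>{\<lfloor>x * 2 ^ n\<rfloor> - 2 .. \<lfloor>x * 2 ^ n\<rfloor> + 2}. dyadic n i)"
    using dyadic_floor by blast
qed

lemma exists_dyadic_scale: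
  fixes t :: real
  assumes "0 < t" "t < 1"
  obtains n where "(1/2) ^ n \<le> t" "t < 2 * (1/2) ^ n"
proof -
  define n where "n = (LEAST n. (1/2::real) ^ n \<le> t)"
  have "\<exists>n. (1/2::real) ^ n \<le> t" using real_arch_pow_inv[of t "1/2"] assms by (auto intro: less_imp_le)
  then have n: "(1/2) ^ n \<le> t" unfolding n_def by (rule LeastI_ex)
  then have "n \<noteq> 0" using assms by (cases n) auto
  then have "\<not> (1/2) ^ (n - 1) \<le> t" using not_less_Least[of "n - 1" "\<lambda>n. (1/2) ^ n \<le> t"] by (simp add: n_def)
  then have "t < 2 * (1/2) ^ n" using \<open>n \<noteq> 0\<close> by (cases n) auto
  with n that show ?thesis by blast
qed

lemma half_power_powr: "((1/2::real) ^ n) powr p = 2 powr (- (real n * p))"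
  by (simp add: powr_powr powr_realpow[symmetric] powr_minus powr_divide powr_mult inverse_eq_divide)

text \<open>Exchanges a radius and a neighbouring dyadic scale at the cost of a constant, whatever
  the sign of p.\<close>

lemma powr_comparable:
  fixes u t p :: real
  assumes "0 < t" "t / 2 \<le> u" "u \<le> t"
  shows "2 powr (-\<bar>p\<bar>) * t powr p \<le> u powr p" "u powr p \<le> 2 powr \<bar>p\<bar> * t powr p"
proof -
  have u: "u > 0" using assms by linarith
  have half: "(t / 2) powr p = 2 powr (-p) * t powr p"
    using assms by (simp add: powr_divide powr_minus field_simps)
  have "2 powr (-\<bar>p\<bar>) * t powr p \<le> u powr p \<and> u powr p \<le> 2 powr \<bar>p\<bar> * t powr p"
  proof (cases "p \<ge> 0")
    case True
    have "(t / 2) powr p \<le> u powr p" "u powr p \<le> t powr p"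
      using assms True by (auto intro!: powr_mono2)
    moreover have "1 * t powr p \<le> 2 powr \<bar>p\<bar> * t powr p"
      by (intro mult_right_mono ge_one_powr_ge_zero) auto
    ultimately show ?thesis using True half by simp
  next
    case False
    have "u powr p \<le> (t / 2) powr p" "t powr p \<le> u powr p"
      using assms u False by (auto intro!: powr_mono2')
    moreover have "2 powr (-\<bar>p\<bar>) * t powr p \<le> 1 * t powr p"
      by (intro mult_right_mono) (auto simp: powr_minus field_simps intro: ge_one_powr_ge_zero)
    ultimately show ?thesis using False half by simp
  qed
  then show "2 powr (-\<bar>p\<bar>) * t powr p \<le> u powr p" "u powr p \<le> 2 powr \<bar>p\<bar> * t powr p" by auto
qed

text \<open>A quantitative form of exact dimensionality up to \<epsilon>. The bound on the number of
  intervals stands in for a lower bound on their individual masses: an interval that is too light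
  may be thrown away, and the count says that all of these together cost little.\<close>

definition concentrated :: "real measure \<Rightarrow> real \<Rightarrow> real \<Rightarrow> bool" where
  "concentrated \<mu> \<alpha> \<epsilon> \<longleftrightarrow>
     (\<exists>\<eta> D n0. summable \<eta> \<and>
        (\<forall>n\<ge>n0. finite (D n) \<and> real (card (D n)) \<le> 2 powr (real n * (\<alpha> + \<epsilon>)) \<and>
           (\<forall>i\<in>D n. measure \<mu> (dyadic n i) \<le> 2 powr (- (real n * (\<alpha> - \<epsilon>)))) \<and>
           1 - \<eta> n \<le> measure \<mu> (\<Union>i\<in>D n. dyadic n i)))"

text \<open>A maximal family of removed sets whose mass is paid for by its thresholds exists by Zorn's lemma;
  a light set that survived could be added to it.\<close>

lemma (in finite_measure) prune_light_sets:
  fixes B :: "'i :: countable \<Rightarrow> 'a set" and \<theta> :: "'i \<Rightarrow> real"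
  assumes B: "\<And>k. B k \<in> sets M" and E: "E \<in> sets M"
    and nonneg: "\<And>k. 0 \<le> \<theta> k" and bounded: "\<And>F. finite F \<Longrightarrow> sum \<theta> F \<le> s"
  shows "\<exists>A\<in>sets M. A \<subseteq> E \<and> measure M E - s \<le> measure M A \<and>
    (\<forall>k. A \<inter> B k = {} \<or> \<theta> k \<le> measure M (A \<inter> B k))"
proof -
  define U where "U R = (\<Union>k\<in>R. E \<inter> B k)" for R
  have U: "U R \<in> sets M" for R unfolding U_def using B E by (intro sets.countable_UN') auto
  have "\<theta> summable_on UNIV"
    using nonneg bounded by (intro nonneg_bdd_above_summable_on bdd_aboveI[of _ s]) auto
  then have sm: "\<theta> summable_on R" for R using summable_on_subset_banach by blast
  have le_s: "infsum \<theta> R \<le> s" for R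
    using sm bounded by (intro infsum_le_finite_sums) auto
  define \<R> where "\<R> = {R. measure M (U R) \<le> infsum \<theta> R}"
  have "\<exists>R\<in>\<R>. \<forall>X\<in>\<R>. R \<subseteq> X \<longrightarrow> X = R"
  proof (rule subset_Zorn')
    fix \<C> assume C: "subset.chain \<R> \<C>"
    have fin: "measure M (U F) \<le> infsum \<theta> (\<Union>\<C>)" if F: "finite F" "F \<subseteq> \<Union>\<C>" for F
    proof (cases "F = {}")
      case True
      then show ?thesis using nonneg by (auto simp: U_def intro!: infsum_nonneg)
    next
      case False
      then have "\<C> \<noteq> {}" using F by auto
      obtain R where R: "R \<in> \<C>" "F \<subseteq> R"
        by (rule finite_subset_Union_chain[OF F \<open>\<C> \<noteq> {}\<close> C])
      from R have "measure M (U F) \<le> measure M (U R)"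
        using U by (intro finite_measure_mono) (auto simp: U_def)
      also have "\<dots> \<le> infsum \<theta> R" using R C by (auto simp: \<R>_def subset.chain_def)
      also have "\<dots> \<le> infsum \<theta> (\<Union>\<C>)"
        using R sm nonneg by (intro infsum_mono2) auto
      finally show ?thesis .
    qed
    \<comment> \<open>The chain may be uncountable. Countability of the index type exhausts its
      union by the finite sets \<open>V n\<close>; each lies in a single member of the chain, so its
      mass is already paid for.\<close>
    define V where "V n = {k \<in> \<Union>\<C>. to_nat k < n}" for n
    have V: "finite (V n)" for n
      by (rule finite_subset[of _ "from_nat ` {..<n}"]) (auto simp: V_def image_iff intro: from_nat_to_nat[symmetric])
    have "incseq (\<lambda>n. U (V n))" unfolding incseq_def U_def V_def by fastforce
    then have "(\<lambda>n. measure M (U (V n))) \<longlonglongrightarrow> measure M (\<Union>n. U (V n))"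
      using U by (intro finite_Lim_measure_incseq) auto
    moreover have "(\<Union>n. U (V n)) = U (\<Union>\<C>)" unfolding U_def V_def by blast
    moreover have le: "measure M (U (V n)) \<le> infsum \<theta> (\<Union>\<C>)" for n
      by (rule fin[OF V]) (auto simp: V_def)
    ultimately have "measure M (U (\<Union>\<C>)) \<le> infsum \<theta> (\<Union>\<C>)"
      using LIMSEQ_le_const2 le by (metis (no_types, lifting))
    then show "\<Union>\<C> \<in> \<R>" by (simp add: \<R>_def)
  qed
  then obtain R where R: "R \<in> \<R>" and max: "\<And>X. X \<in> \<R> \<Longrightarrow> R \<subseteq> X \<Longrightarrow> X = R" by blast
  define A where "A = E - U R"
  have AM: "A \<in> sets M" unfolding A_def using U E by auto
  have "measure M A = measure M E - measure M (U R)"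
    unfolding A_def using U E by (intro finite_measure_Diff) (auto simp: U_def)
  then have m: "measure M E - s \<le> measure M A" using R le_s[of R] by (simp add: \<R>_def)
  have heavy: "A \<inter> B k = {} \<or> \<theta> k \<le> measure M (A \<inter> B k)" for k
  proof (rule ccontr)
    assume H: "\<not> ?thesis"
    then have "k \<notin> R" by (auto simp: A_def U_def)
    have "U (insert k R) \<subseteq> U R \<union> (A \<inter> B k)" by (auto simp: U_def A_def)
    then have "measure M (U (insert k R)) \<le> measure M (U R \<union> (A \<inter> B k))"
      using U AM B by (intro finite_measure_mono) auto
    also have "\<dots> \<le> measure M (U R) + measure M (A \<inter> B k)"
      using U AM B by (intro measure_Un_le) auto
    also have "\<dots> \<le> infsum \<theta> R + \<theta> k" using R H by (simp add: \<R>_def)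
    also have "\<dots> = infsum \<theta> (insert k R)" using \<open>k \<notin> R\<close> sm by (subst infsum_insert) auto
    finally have "insert k R \<in> \<R>" by (simp add: \<R>_def)
    then show False using max[of "insert k R"] \<open>k \<notin> R\<close> by auto
  qed
  show ?thesis using AM m heavy by (intro bexI[of _ A]) (auto simp: A_def)
qed

section \<open>Extraction of a compact set of uniform dimension\<close>

lemma (in finite_measure) measure_UN_le:
  assumes "\<And>i::nat. A i \<in> sets M" "\<And>N. (\<Sum>i<N. measure M (A i)) \<le> x"
  shows "measure M (\<Union>i. A i) \<le> x"
proof -
  have "summable (\<lambda>i. measure M (A i))"
    using assms(2) by (intro summableI_nonneg_bounded[where x = x]) auto
  then show ?thesis
    using finite_measure_subadditive_countably[of A] suminf_le_const[of "\<lambda>i. measure M (A i)" x] assms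
    by (auto intro: order_trans)
qed

lemma sum_half_powers_le: "(\<Sum>j<N. \<delta> / 2 ^ Suc j) \<le> \<delta>" if "0 \<le> \<delta>" for \<delta> :: real
proof -
  have "(\<Sum>j<N. \<delta> / 2 ^ Suc j) = \<delta> * (1 - 1 / 2 ^ N)" by (induction N) (auto simp: field_simps)
  also have "\<dots> \<le> \<delta> * 1" using that by (intro mult_left_mono) auto
  finally show ?thesis by simp
qed

text \<open>Starting at a late level m makes two costs at most \<delta>: the mass outside the
  typical intervals, and the sum of the pruning thresholds. The second is a geometric tail, since
  the threshold exponent \<alpha> + 2\<epsilon> beats the counting exponent \<alpha> + \<epsilon> by
  2^(-\<epsilon>) per level.\<close>

lemma concentrated_tail:
  assumes "prob_space \<mu>" "sets \<mu> = sets borel" "concentrated \<mu> \<alpha> \<epsilon>" "0 < \<epsilon>" "0 < \<delta>"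
  shows "\<exists>D m. (\<forall>n\<ge>m. finite (D n) \<and> (\<forall>i\<in>D n. measure \<mu> (dyadic n i) \<le> 2 powr (- (real n * (\<alpha> - \<epsilon>)))))
     \<and> (\<forall>N. (\<Sum>n\<in>{m..<N}. measure \<mu> (UNIV - (\<Union>i\<in>D n. dyadic n i))) \<le> \<delta>)
     \<and> (\<forall>N. (\<Sum>n\<in>{m..<N}. real (card (D n)) * 2 powr (- (real n * (\<alpha> + 2 * \<epsilon>)))) \<le> \<delta>)"
proof -
  interpret prob_space \<mu> by fact
  have space: "space \<mu> = UNIV" using sets_eq_imp_space_eq[OF assms(2)] by simp
  obtain \<eta> D n0 where \<eta>: "summable \<eta>" and D: "\<And>n. n \<ge> n0 \<Longrightarrow> finite (D n)"
    "\<And>n. n \<ge> n0 \<Longrightarrow> real (card (D n)) \<le> 2 powr (real n * (\<alpha> + \<epsilon>))"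
    "\<And>n i. n \<ge> n0 \<Longrightarrow> i \<in> D n \<Longrightarrow> measure \<mu> (dyadic n i) \<le> 2 powr (- (real n * (\<alpha> - \<epsilon>)))"
    "\<And>n. n \<ge> n0 \<Longrightarrow> 1 - \<eta> n \<le> measure \<mu> (\<Union>i\<in>D n. dyadic n i)"
    using assms(3) unfolding concentrated_def by blast
  have "2 powr (- \<epsilon>) < 1" using assms(4) by (simp add: powr_less_one)
  then have "summable (\<lambda>n. (2 powr (- \<epsilon>)) ^ n)" by (intro summable_geometric) auto
  then obtain m1 where m1: "\<And>m n. m \<ge> m1 \<Longrightarrow> norm (\<Sum>k=m..n. (2 powr (- \<epsilon>)) ^ k) < \<delta>"
    using assms(5) summable_partial_sum_bound by metis
  obtain m2 where m2: "\<And>m n. m \<ge> m2 \<Longrightarrow> norm (\<Sum>k=m..n. \<eta> k) < \<delta>"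
    using assms(5) \<eta> summable_partial_sum_bound by metis
  define m where "m = Max {n0, m1, m2}"
  have m: "m \<ge> n0" "m \<ge> m1" "m \<ge> m2" by (auto simp: m_def)
  have tail: "sum f {m..<N} \<le> \<delta>" if "\<And>n. norm (sum f {m..n}) < \<delta>" for N and f :: "nat \<Rightarrow> real"
    using that[of "N - 1"] assms(5)
    by (cases N) (auto simp: atLeastLessThanSuc_atLeastAtMost abs_less_iff less_imp_le)
  have Um: "(\<Union>i\<in>D n. dyadic n i) \<in> sets \<mu>" if "n \<ge> m" for n
    using D(1)[of n] that m by (intro sets.finite_UN) (auto simp: assms(2))
  have "(\<Sum>n\<in>{m..<N}. measure \<mu> (UNIV - (\<Union>i\<in>D n. dyadic n i))) \<le> sum \<eta> {m..<N}" for N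
  proof (rule sum_mono)
    fix n assume "n \<in> {m..<N}"
    then show "measure \<mu> (UNIV - (\<Union>i\<in>D n. dyadic n i)) \<le> \<eta> n"
      using prob_compl[OF Um[of n]] D(4)[of n] m by (simp add: space)
  qed
  then have A: "(\<Sum>n\<in>{m..<N}. measure \<mu> (UNIV - (\<Union>i\<in>D n. dyadic n i))) \<le> \<delta>" for N
    using tail[of \<eta> N] m2 m by (meson order_trans)
  have "(\<Sum>n\<in>{m..<N}. real (card (D n)) * 2 powr (- (real n * (\<alpha> + 2 * \<epsilon>)))) \<le> (\<Sum>n\<in>{m..<N}. (2 powr (- \<epsilon>)) ^ n)" for N
  proof (rule sum_mono)
    fix n assume "n \<in> {m..<N}"
    then have "real (card (D n)) * 2 powr (- (real n * (\<alpha> + 2 * \<epsilon>)))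
        \<le> 2 powr (real n * (\<alpha> + \<epsilon>)) * 2 powr (- (real n * (\<alpha> + 2 * \<epsilon>)))"
      using D(2)[of n] m by (intro mult_right_mono) auto
    also have "\<dots> = 2 powr (- \<epsilon> * real n)" by (simp add: powr_add[symmetric] algebra_simps)
    also have "\<dots> = (2 powr (- \<epsilon>)) ^ n" by (simp add: powr_powr powr_realpow[symmetric])
    finally show "real (card (D n)) * 2 powr (- (real n * (\<alpha> + 2 * \<epsilon>))) \<le> (2 powr (- \<epsilon>)) ^ n" .
  qed
  then have B: "(\<Sum>n\<in>{m..<N}. real (card (D n)) * 2 powr (- (real n * (\<alpha> + 2 * \<epsilon>)))) \<le> \<delta>" for N
    using tail[of "\<lambda>n. (2 powr (- \<epsilon>)) ^ n" N] m1 m by (meson order_trans)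
  show ?thesis using A B D m by (intro exI[of _ D] exI[of _ m]) auto
qed

text \<open>One set has to serve all tolerances at once, so a sequence \<open>e j\<close> tending to
  0 is treated simultaneously. The loss \<delta> is split into thirds: points outside the typical
  intervals, inner approximation by a compact set, and pruning.\<close>

lemma exists_uniform_set:
  assumes prob: "prob_space \<mu>" and sets: "sets \<mu> = sets borel"
    and K: "compact K" "measure \<mu> K = 1"
    and conc: "\<And>\<epsilon>. 0 < \<epsilon> \<Longrightarrow> concentrated \<mu> \<alpha> \<epsilon>"
    and "0 < \<delta>"
  shows "\<exists>A. compact A \<and> A \<subseteq> K \<and> 1 - \<delta> \<le> measure \<mu> A \<and> uniform_dim \<mu> \<alpha> A"
proof -
  interpret prob_space \<mu> by fact
  have space: "space \<mu> = UNIV" using sets_eq_imp_space_eq[OF sets] by simp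
  define e where "e j = 1 / (real j + 1)" for j
  have e: "e j > 0" for j by (simp add: e_def)
  \<comment> \<open>The share of one tolerance. The shares sum to at most \<delta> / 3, and the same
    shares are spent twice: on the exceptional sets \<open>C j n\<close> and on the pruning
    thresholds.\<close>
  define d where "d j = (\<delta> / 3) / 2 ^ Suc j" for j
  have d: "d j > 0" for j using \<open>0 < \<delta>\<close> by (simp add: d_def)
  define P where "P j D m \<longleftrightarrow>
     (\<forall>n\<ge>m. finite (D n) \<and> (\<forall>i\<in>D n. measure \<mu> (dyadic n i) \<le> 2 powr (- (real n * (\<alpha> - e j)))))
     \<and> (\<forall>N. (\<Sum>n\<in>{m..<N}. measure \<mu> (UNIV - (\<Union>i\<in>D n. dyadic n i))) \<le> d j)
     \<and> (\<forall>N. (\<Sum>n\<in>{m..<N}. real (card (D n)) * 2 powr (- (real n * (\<alpha> + 2 * e j)))) \<le> d j)" for j D m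
  have "\<exists>D m. P j D m" for j
    unfolding P_def using concentrated_tail[OF prob sets conc[OF e] e d] .
  then obtain D m where P: "\<And>j. P j (D j) (m j)" by metis
  have D: "\<And>j n. n \<ge> m j \<Longrightarrow> finite (D j n)"
    "\<And>j n i. n \<ge> m j \<Longrightarrow> i \<in> D j n \<Longrightarrow> measure \<mu> (dyadic n i) \<le> 2 powr (- (real n * (\<alpha> - e j)))"
    "\<And>j N. (\<Sum>n\<in>{m j..<N}. measure \<mu> (UNIV - (\<Union>i\<in>D j n. dyadic n i))) \<le> d j"
    "\<And>j N. (\<Sum>n\<in>{m j..<N}. real (card (D j n)) * 2 powr (- (real n * (\<alpha> + 2 * e j)))) \<le> d j"
    using P unfolding P_def by blast+
  have Dm: "(\<Union>i\<in>D j n. dyadic n i) \<in> sets \<mu>" if "n \<ge> m j" for j n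
    using D(1)[of j n] that by (intro sets.finite_UN) (auto simp: sets)
  have sumd: "(\<Sum>j<J. d j) \<le> \<delta> / 3" for J
    unfolding d_def using sum_half_powers_le[of "\<delta> / 3" J] \<open>0 < \<delta>\<close> by simp

  define C where "C j n = (if m j \<le> n then UNIV - (\<Union>i\<in>D j n. dyadic n i) else {})" for j n
  have C: "C j n \<in> sets \<mu>" for j n
    unfolding C_def using Dm sets.compl_sets[of _ \<mu>] by (auto simp: space)
  have Cj: "measure \<mu> (\<Union>n. C j n) \<le> d j" for j
  proof (rule measure_UN_le[OF C])
    fix N
    have "(\<Sum>n<N. measure \<mu> (C j n)) = (\<Sum>n\<in>{m j..<N}. measure \<mu> (UNIV - (\<Union>i\<in>D j n. dyadic n i)))"
      by (rule sum.mono_neutral_cong_right) (auto simp: C_def)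
    then show "(\<Sum>n<N. measure \<mu> (C j n)) \<le> d j" using D(3) by simp
  qed
  have "measure \<mu> (\<Union>j. \<Union>n. C j n) \<le> \<delta> / 3"
  proof (rule measure_UN_le)
    show "(\<Sum>j<J. measure \<mu> (\<Union>n. C j n)) \<le> \<delta> / 3" for J
      using sum_mono[of "{..<J}" "\<lambda>j. measure \<mu> (\<Union>n. C j n)" d] Cj sumd[of J] by fastforce
  qed (use C in auto)
  define E where "E = K - (\<Union>j. \<Union>n. C j n)"
  have Km: "K \<in> sets \<mu>" using K sets by (simp add: borel_compact)
  have Em: "E \<in> sets \<mu>" unfolding E_def using C Km by auto
  have "measure \<mu> K \<le> measure \<mu> (E \<union> (\<Union>j. \<Union>n. C j n))"
    using Em C Km by (intro finite_measure_mono) (auto simp: E_def)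
  also have "\<dots> \<le> measure \<mu> E + measure \<mu> (\<Union>j. \<Union>n. C j n)"
    using Em C by (intro measure_Un_le) auto
  finally have mE: "1 - \<delta> / 3 \<le> measure \<mu> E"
    using \<open>measure \<mu> (\<Union>j. \<Union>n. C j n) \<le> \<delta> / 3\<close> K by simp
  have ED: "\<lfloor>x * 2 ^ n\<rfloor> \<in> D j n" if "x \<in> E" "n \<ge> m j" for x n j
  proof -
    have "x \<notin> C j n" using that by (auto simp: E_def)
    then show ?thesis using that by (auto simp: C_def dyadic_def)
  qed

  obtain A0 where A0: "compact A0" "A0 \<subseteq> E" "1 - 2 * \<delta> / 3 \<le> measure \<mu> A0"
  \<comment> \<open>When the required mass is not positive the empty set will do; the split keeps
    the number nonnegative before it is embedded into \<open>ennreal\<close>.\<close>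
  proof (cases "2 * \<delta> / 3 \<ge> 1")
    case True
    show ?thesis by (rule that[of "{}"]) (use True in auto)
  next
    case False
    have "ennreal (1 - 2 * \<delta> / 3) < emeasure \<mu> E"
      using mE \<open>0 < \<delta>\<close> False unfolding emeasure_eq_measure by (intro ennreal_lessI) auto
    also have "emeasure \<mu> E = (SUP K \<in> {K. K \<subseteq> E \<and> compact K}. emeasure \<mu> K)"
      using sets Em by (intro inner_regular) (auto simp: emeasure_eq_measure)
    finally obtain K where "K \<subseteq> E" "compact K" "ennreal (1 - 2 * \<delta> / 3) < emeasure \<mu> K"
      unfolding less_SUP_iff by auto
    then show ?thesis using that[of K] \<open>0 < \<delta>\<close> False
      by (auto simp: emeasure_eq_measure ennreal_less_iff)
  qed

  \<comment> \<open>An index records tolerance, level and cell. A threshold of 0 never forces a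
    deletion; at levels n with \<open>m j \<le> n\<close> the cells that get it do not meet E
    anyway.\<close>
  define \<theta> where "\<theta> = (\<lambda>(j, n, i). if m j \<le> n \<and> i \<in> D j n then 2 powr (- (real n * (\<alpha> + 2 * e j))) else (0::real))"
  have sum\<theta>: "sum \<theta> F \<le> \<delta> / 3" if F: "finite F" for F
  proof -
    define J N S where "J = Suc (Max (insert 0 (fst ` F)))" "N = Suc (Max (insert 0 ((fst \<circ> snd) ` F)))"
      "S = (snd \<circ> snd) ` F"
    have finS: "finite S" using F by (simp add: J_N_S_def)
    have "F \<subseteq> {..<J} \<times> {..<N} \<times> S"
    proof
      fix x assume x: "x \<in> F"
      have "fst x \<le> Max (insert 0 (fst ` F))" "(fst \<circ> snd) x \<le> Max (insert 0 ((fst \<circ> snd) ` F))"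
        using F x by (intro Max_ge; simp)+
      then show "x \<in> {..<J} \<times> {..<N} \<times> S"
        using x unfolding J_N_S_def by (cases x) (force simp: less_Suc_eq_le)
    qed
    then have "sum \<theta> F \<le> sum \<theta> ({..<J} \<times> {..<N} \<times> S)"
      using finS by (intro sum_mono2) (auto simp: \<theta>_def)
    also have "\<dots> = (\<Sum>j<J. \<Sum>n<N. \<Sum>i\<in>S. \<theta> (j, n, i))"
      by (simp add: sum.cartesian_product)
    also have "\<dots> \<le> (\<Sum>j<J. d j)"
    proof (rule sum_mono)
      fix j
      have "(\<Sum>n<N. \<Sum>i\<in>S. \<theta> (j, n, i)) \<le> (\<Sum>n<N. if m j \<le> n then real (card (D j n)) * 2 powr (- (real n * (\<alpha> + 2 * e j))) else 0)"
      proof (rule sum_mono)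
        fix n
        show "(\<Sum>i\<in>S. \<theta> (j, n, i)) \<le> (if m j \<le> n then real (card (D j n)) * 2 powr (- (real n * (\<alpha> + 2 * e j))) else 0)"
        proof (cases "m j \<le> n")
          case True
          have "(\<Sum>i\<in>S. \<theta> (j, n, i)) = (\<Sum>i\<in>S \<inter> D j n. 2 powr (- (real n * (\<alpha> + 2 * e j))))"
            using True finS by (subst sum.inter_restrict) (auto simp: \<theta>_def)
          also have "\<dots> \<le> real (card (D j n)) * 2 powr (- (real n * (\<alpha> + 2 * e j)))"
            using D(1)[OF True] by (auto intro!: mult_right_mono card_mono)
          finally show ?thesis using True by simp
        qed (simp add: \<theta>_def)
      qed
      also have "\<dots> = (\<Sum>n\<in>{m j..<N}. real (card (D j n)) * 2 powr (- (real n * (\<alpha> + 2 * e j))))"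
        by (rule sum.mono_neutral_cong_right) auto
      finally show "(\<Sum>n<N. \<Sum>i\<in>S. \<theta> (j, n, i)) \<le> d j" using D(4) by (meson order_trans)
    qed
    finally show ?thesis using sumd[of J] by simp
  qed
  define B where "B = (\<lambda>(j::nat, n, i). dyadic n i)"
  have Bm: "B k \<in> sets \<mu>" for k by (auto simp: B_def sets split: prod.split)
  have A0m: "A0 \<in> sets \<mu>" using A0 sets by (simp add: borel_compact)
  have \<theta>0: "0 \<le> \<theta> k" for k by (auto simp: \<theta>_def split: prod.split)
  obtain A where A: "A \<in> sets \<mu>" "A \<subseteq> A0" "measure \<mu> A0 - \<delta> / 3 \<le> measure \<mu> A"
    "\<And>k. A \<inter> B k = {} \<or> \<theta> k \<le> measure \<mu> (A \<inter> B k)"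
    using prune_light_sets[where B = B, OF Bm A0m \<theta>0 sum\<theta>] by metis
  \<comment> \<open>Pruning yields a set that is merely measurable. Passing to the closure keeps it
    inside the compact \<open>A0\<close> and preserves the lower bound up to constants: a point of
    the closure has a point of A within t/2, and the heavy cell of that point, of length at most
    t/2, lies in the ball of radius t.\<close>
  define A' where "A' = closure A"
  have A': "A \<subseteq> A'" "A' \<subseteq> A0" unfolding A'_def using A A0
    by (intro closure_subset closure_minimal compact_imp_closed; simp)+
  have "compact A'"
    using compact_Int_closed[OF A0(1) closed_closure[of A]] A' by (simp add: A'_def Int_absorb1)
  then have A'm: "A' \<in> sets \<mu>" using sets by (simp add: borel_compact)
  have mA': "1 - \<delta> \<le> measure \<mu> A'"
    using finite_measure_mono[OF A'(1) A'm] A(3) A0(3) by linarith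
  have A'E: "A' \<subseteq> E" and "A' \<subseteq> K" using A' A0 by (auto simp: E_def)
  have "uniform_dim \<mu> \<alpha> A'"
    unfolding uniform_dim_def
  proof (intro allI impI)
    fix \<epsilon> :: real assume "\<epsilon> > 0"
    obtain j where j: "4 / \<epsilon> < real j" using reals_Archimedean2 by blast
    have ej: "e j < \<epsilon> / 4" using j \<open>\<epsilon> > 0\<close> unfolding e_def by (auto simp: field_simps)
    obtain b1 where b1: "0 < b1" "\<And>t. 0 < t \<Longrightarrow> t < b1 \<Longrightarrow> t powr (\<epsilon> - e j) \<le> 1 / (5 * 2 powr \<bar>\<alpha> - e j\<bar>)"
      using powr_eventually_le[of "1 / (5 * 2 powr \<bar>\<alpha> - e j\<bar>)" "\<epsilon> - e j"] ej \<open>\<epsilon> > 0\<close> by auto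
    let ?p = "\<alpha> + 2 * e j"
    obtain b2 where b2: "0 < b2" "\<And>t. 0 < t \<Longrightarrow> t < b2 \<Longrightarrow> t powr (\<epsilon> - 2 * e j) \<le> 2 powr (-\<bar>?p\<bar>) * 2 powr (-\<bar>?p\<bar>)"
      using powr_eventually_le[of "2 powr (-\<bar>?p\<bar>) * 2 powr (-\<bar>?p\<bar>)" "\<epsilon> - 2 * e j"] ej \<open>\<epsilon> > 0\<close> by auto
    let ?b = "Min {b1, b2, (1/2) ^ m j}"
    have scale: "n \<ge> m j" if "(1/2::real) ^ n \<le> t" "t < (1/2) ^ m j" for n t
    proof (rule ccontr)
      assume "\<not> m j \<le> n"
      then have "(1/2::real) ^ m j \<le> (1/2) ^ n" by (intro power_decreasing) auto
      then show False using that by linarith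
    qed
    have le1: "(1/2::real) ^ m j \<le> 1" by (simp add: power_le_one)
    show "\<exists>b>0. \<forall>t. 0 < t \<and> t < b \<longrightarrow>
        (\<forall>x. measure \<mu> (A' \<inter> cball x t) \<le> t powr (\<alpha> - \<epsilon>)) \<and>
        (\<forall>x\<in>A'. t powr (\<alpha> + \<epsilon>) \<le> measure \<mu> (A' \<inter> cball x t))"
    proof (intro exI[of _ ?b] conjI allI impI ballI)
      show "0 < ?b" using b1 b2 by simp
    next
      fix t x :: real assume "0 < t \<and> t < ?b"
      then have t: "0 < t" "t < b1" "t < (1/2) ^ m j" "t < 1" using le1 by auto
      obtain n where n: "(1/2) ^ n \<le> t" "t < 2 * (1/2) ^ n" using exists_dyadic_scale t by metis
      have nm: "n \<ge> m j" using scale n t by blast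
      let ?I = "{\<lfloor>x * 2 ^ n\<rfloor> - 2 .. \<lfloor>x * 2 ^ n\<rfloor> + 2}"
      have each: "measure \<mu> (A' \<inter> dyadic n i) \<le> ((1/2) ^ n) powr (\<alpha> - e j)" for i
      proof (cases "A' \<inter> dyadic n i = {}")
        case False
        then obtain y where y: "y \<in> A'" "y \<in> dyadic n i" by auto
        then have "i \<in> D j n" using ED[of y j n] A'E nm by (auto simp: dyadic_def)
        then have "measure \<mu> (dyadic n i) \<le> ((1/2) ^ n) powr (\<alpha> - e j)"
          unfolding half_power_powr using D(2)[OF nm] by simp
        moreover have "measure \<mu> (A' \<inter> dyadic n i) \<le> measure \<mu> (dyadic n i)"
          using sets by (intro finite_measure_mono) auto
        ultimately show ?thesis by simp
      qed simp
      have fm: "A' \<inter> dyadic n i \<in> sets \<mu>" for i using A'm sets by simp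
      have "measure \<mu> (A' \<inter> cball x t) \<le> measure \<mu> (\<Union>i\<in>?I. A' \<inter> dyadic n i)"
      proof (rule finite_measure_mono)
        show "A' \<inter> cball x t \<subseteq> (\<Union>i\<in>?I. A' \<inter> dyadic n i)"
          using cball_subset_dyadic[OF less_imp_le[OF n(2)], of x] by blast
        show "(\<Union>i\<in>?I. A' \<inter> dyadic n i) \<in> sets \<mu>"
          by (intro sets.finite_UN fm) simp
      qed
      also have "\<dots> \<le> (\<Sum>i\<in>?I. measure \<mu> (A' \<inter> dyadic n i))"
        by (rule finite_measure_subadditive_finite) (use fm in \<open>auto simp del: atLeastAtMost_iff\<close>)
      also have "\<dots> \<le> (\<Sum>i\<in>?I. ((1/2) ^ n) powr (\<alpha> - e j))" by (intro sum_mono each)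
      also have "\<dots> = 5 * ((1/2) ^ n) powr (\<alpha> - e j)" by simp
      also have "\<dots> \<le> 5 * (2 powr \<bar>\<alpha> - e j\<bar> * t powr (\<alpha> - e j))"
        using powr_comparable(2)[of t "(1/2) ^ n" "\<alpha> - e j"] n t by simp
      also have "\<dots> = 5 * 2 powr \<bar>\<alpha> - e j\<bar> * t powr (\<epsilon> - e j) * t powr (\<alpha> - \<epsilon>)"
        by (simp add: powr_add[symmetric])
      also have "\<dots> \<le> 1 * t powr (\<alpha> - \<epsilon>)"
        using b1(2)[OF t(1,2)] by (intro mult_right_mono) (auto simp: field_simps)
      finally show "measure \<mu> (A' \<inter> cball x t) \<le> t powr (\<alpha> - \<epsilon>)" by simp
    next
      fix t x :: real assume "0 < t \<and> t < ?b" and x: "x \<in> A'"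
      then have t: "0 < t" "t < b2" "t < (1/2) ^ m j" "t / 2 < 1" using le1 by auto
      have "0 < t / 2" using t by simp
      then obtain n where n: "(1/2) ^ n \<le> t / 2" "t / 2 < 2 * (1/2) ^ n"
        using exists_dyadic_scale t by metis
      have nm: "n \<ge> m j" using scale[of n "t/2"] n t by linarith
      obtain y where y: "y \<in> A" "dist y x < t / 2"
        using x \<open>0 < t / 2\<close> unfolding A'_def closure_approachable by blast
      let ?i = "\<lfloor>y * 2 ^ n\<rfloor>"
      have i: "?i \<in> D j n" using ED[of y j n] y A A0 nm by blast
      have "A \<inter> B (j, n, ?i) \<noteq> {}" using y dyadic_floor[of y n] by (auto simp: B_def)
      then have "\<theta> (j, n, ?i) \<le> measure \<mu> (A \<inter> B (j, n, ?i))" using A(4) by blast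
      then have th: "((1/2) ^ n) powr ?p \<le> measure \<mu> (A \<inter> dyadic n ?i)"
        using i nm unfolding half_power_powr by (simp add: \<theta>_def B_def)
      have "t powr (\<alpha> + \<epsilon>) = t powr (\<epsilon> - 2 * e j) * t powr ?p" by (simp add: powr_add[symmetric] add.commute)
      also have "\<dots> \<le> 2 powr (-\<bar>?p\<bar>) * 2 powr (-\<bar>?p\<bar>) * t powr ?p"
        using b2(2)[OF t(1,2)] by (intro mult_right_mono) auto
      also have "\<dots> = 2 powr (-\<bar>?p\<bar>) * (2 powr (-\<bar>?p\<bar>) * t powr ?p)" by simp
      also have "\<dots> \<le> 2 powr (-\<bar>?p\<bar>) * (t / 2) powr ?p"
        using powr_comparable(1)[of t "t / 2" ?p] t by (intro mult_left_mono) auto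
      also have "\<dots> \<le> ((1/2) ^ n) powr ?p"
        using powr_comparable(1)[of "t / 2" "(1/2) ^ n" ?p] t n by auto
      also have "\<dots> \<le> measure \<mu> (A \<inter> dyadic n ?i)" by (rule th)
      also have "\<dots> \<le> measure \<mu> (A' \<inter> cball x t)"
      proof (rule finite_measure_mono)
        have "dyadic n ?i \<subseteq> cball y ((1/2) ^ n)" by (rule dyadic_subset_cball[OF dyadic_floor])
        also have "\<dots> \<subseteq> cball x t"
        proof
          fix z assume "z \<in> cball y ((1/2) ^ n)"
          then show "z \<in> cball x t" using y n dist_triangle[of x z y] by (simp add: dist_commute)
        qed
        finally show "A \<inter> dyadic n ?i \<subseteq> A' \<inter> cball x t" using A' by auto
      qed (use A'm sets in auto)
      finally show "t powr (\<alpha> + \<epsilon>) \<le> measure \<mu> (A' \<inter> cball x t)" .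
    qed
  qed
  then show ?thesis using \<open>compact A'\<close> \<open>A' \<subseteq> K\<close> mA' by blast
qed

text \<open>Uniting the first sets of a sequence with losses 1/(j+2) makes it increasing and keeps
  the exponent \<alpha>, on which alone the spectrum and the local dimensions depend. The shift by 2
  gives positive mass already at index 0.\<close>

lemma multifractal_decomposition_of_concentrated:
  assumes prob: "prob_space \<mu>" and sets: "sets \<mu> = sets borel"
    and K: "compact K" "measure \<mu> K = 1"
    and conc: "\<And>\<epsilon>. 0 < \<epsilon> \<Longrightarrow> concentrated \<mu> \<alpha> \<epsilon>" and \<alpha>: "0 \<le> \<alpha>"
  shows "\<exists>Km :: nat \<Rightarrow> real set.
           (\<forall>m. compact (Km m) \<and> Km m \<subseteq> Km (Suc m) \<and> Km (Suc m) \<subseteq> K) \<and>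
           (\<lambda>m. measure \<mu> (Km m)) \<longlonglongrightarrow> 1 \<and>
           (\<forall>m. multifractal_formalism (restrict_to \<mu> (Km m))) \<and>
           (\<forall>m n. \<forall>q. Lq_spectrum (restrict_to \<mu> (Km m)) q = Lq_spectrum (restrict_to \<mu> (Km n)) q) \<and>
           (\<forall>m n. local_dims (restrict_to \<mu> (Km m)) = local_dims (restrict_to \<mu> (Km n)))"
proof -
  interpret prob_space \<mu> by fact
  have "\<forall>j. \<exists>A. compact A \<and> A \<subseteq> K \<and> 1 - 1 / (real j + 2) \<le> measure \<mu> A \<and> uniform_dim \<mu> \<alpha> A"
    using exists_uniform_set[OF prob sets K conc] by simp
  then obtain G where G: "\<And>j. compact (G j)" "\<And>j. G j \<subseteq> K"
    "\<And>j. 1 - 1 / (real j + 2) \<le> measure \<mu> (G j)" "\<And>j. uniform_dim \<mu> \<alpha> (G j)" by metis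
  define Km where "Km m = (\<Union>j\<le>m. G j)" for m
  have cpt: "compact (Km m)" for m unfolding Km_def using G by (intro compact_UN) auto
  have ms: "Km m \<in> sets \<mu>" "G m \<in> sets \<mu>" for m using cpt[of m] G(1)[of m] sets by (auto simp: borel_compact)
  have uni: "uniform_dim \<mu> \<alpha> (Km m)" for m
  proof (induction m)
    case 0 then show ?case using G by (simp add: Km_def)
  next
    case (Suc m)
    have "Km (Suc m) = Km m \<union> G (Suc m)" by (auto simp: Km_def le_Suc_eq)
    then show ?case
      using uniform_dim_Un[OF finite_measure_axioms ms sets Suc.IH G(4)] by simp
  qed
  have big: "1 - 1 / (real m + 2) \<le> measure \<mu> (Km m)" for m
  proof -
    have "measure \<mu> (G m) \<le> measure \<mu> (Km m)"
      using ms by (intro finite_measure_mono) (auto simp: Km_def)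
    then show ?thesis using G(3)[of m] by simp
  qed
  have us: "uniform_set \<mu> \<alpha> (Km m)" for m
  proof
    have "1 / (real m + 2) < 1" by simp
    then show "0 < measure \<mu> (Km m)" using big[of m] by linarith
  qed (use cpt uni sets \<alpha> in auto)
  have "(\<lambda>m. 1 - 1 / (real m + 2)) \<longlonglongrightarrow> 1"
  proof -
    have "(\<lambda>m. 1 / (real (m + 2))) \<longlonglongrightarrow> 0"
      by (rule LIMSEQ_ignore_initial_segment[of "\<lambda>m. 1 / real m" 0 2]) (rule lim_1_over_n)
    from tendsto_diff[OF tendsto_const[of 1] this] show ?thesis by (simp add: add.commute)
  qed
  then have "(\<lambda>m. measure \<mu> (Km m)) \<longlonglongrightarrow> 1"
    by (rule tendsto_sandwich[OF _ _ _ tendsto_const, rotated 2]) (use big in auto)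
  moreover have "Km m \<subseteq> Km (Suc m)" "Km (Suc m) \<subseteq> K" for m
    using G(2) unfolding Km_def by fastforce+
  ultimately show ?thesis
    using uniform_set.multifractal_formalism_restrict[OF us] uniform_set.Lq_spectrum_restrict[OF us]
      uniform_set.local_dims_restrict[OF us] cpt by (intro exI[of _ Km]) auto
qed

section \<open>Typical words\<close>

definition words :: "'a set \<Rightarrow> nat \<Rightarrow> 'a list set" where
  "words A k = {xs. set xs \<subseteq> A \<and> length xs = k}"

lemma finite_words [simp]: "finite A \<Longrightarrow> finite (words A k)"
  unfolding words_def by (rule finite_lists_length_eq)

lemma words_0 [simp]: "words A 0 = {[]}"
  by (auto simp: words_def)

lemma words_Suc: "words A (Suc k) = (\<lambda>(a, xs). a # xs) ` (A \<times> words A k)"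
  by (auto simp: words_def length_Suc_conv image_iff)

lemma sum_words_Suc:
  fixes f :: "'a list \<Rightarrow> 'b::comm_monoid_add"
  shows "sum f (words A (Suc k)) = (\<Sum>a\<in>A. \<Sum>xs\<in>words A k. f (a # xs))"
proof -
  have "sum f (words A (Suc k)) = (\<Sum>(a, xs)\<in>A \<times> words A k. f (a # xs))"
    unfolding words_Suc by (subst sum.reindex) (auto simp: inj_on_def case_prod_unfold)
  then show ?thesis by (simp add: sum.cartesian_product)
qed

lemma sum_words_prod_list:
  fixes u :: "'a \<Rightarrow> real"
  shows "(\<Sum>xs\<in>words A k. prod_list (map u xs)) = (\<Sum>a\<in>A. u a) ^ k"
  by (induction k) (simp_all add: sum_words_Suc sum_distrib_right flip: sum_distrib_left)

lemma prod_list_map_nonneg: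
  fixes u :: "'a \<Rightarrow> real"
  assumes "\<And>a. a \<in> A \<Longrightarrow> 0 \<le> u a" "set xs \<subseteq> A"
  shows "0 \<le> prod_list (map u xs)"
  using assms by (induction xs) auto

lemma prod_list_map_exp_tilt:
  fixes w X :: "'a \<Rightarrow> real"
  shows "prod_list (map (\<lambda>a. w a * exp (s * (X a - c))) xs) =
    prod_list (map w xs) * exp (s * (sum_list (map X xs) - real (length xs) * c))"
  by (induction xs) (auto simp: algebra_simps exp_add[symmetric] mult_exp_exp)

text \<open>Exponential tilting: the moment generating function of \<open>X - c\<close> has derivative \<open>-\<delta>\<close> at 0, hence is
  below 1 at some positive s.\<close>

lemma chernoff_words:
  fixes w X :: "'a \<Rightarrow> real"
  assumes fin: "finite A" and w: "\<And>a. a \<in> A \<Longrightarrow> 0 \<le> w a" "(\<Sum>a\<in>A. w a) = 1" and \<delta>: "0 < \<delta>"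
  shows "\<exists>\<rho>. 0 \<le> \<rho> \<and> \<rho> < 1 \<and>
    (\<forall>k. (\<Sum>xs | xs \<in> words A k \<and> real k * ((\<Sum>a\<in>A. w a * X a) + \<delta>) \<le> sum_list (map X xs).
        prod_list (map w xs)) \<le> \<rho> ^ k)"
proof -
  define c where "c = (\<Sum>a\<in>A. w a * X a) + \<delta>"
  define g where "g s = (\<Sum>a\<in>A. w a * exp (s * (X a - c)))" for s
  have "(g has_real_derivative (\<Sum>a\<in>A. w a * (exp (0 * (X a - c)) * (X a - c)))) (at 0)"
    unfolding g_def by (auto intro!: derivative_eq_intros sum.cong)
  moreover have "(\<Sum>a\<in>A. w a * (exp (0 * (X a - c)) * (X a - c))) = - \<delta>"
    using w by (simp add: right_diff_distrib sum_subtractf flip: sum_distrib_right) (simp add: c_def)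
  ultimately obtain d where d: "d > 0" "\<And>h. 0 < h \<Longrightarrow> h < d \<Longrightarrow> g (0 + h) < g 0"
    using DERIV_neg_dec_right[of g "-\<delta>" 0] \<delta> by auto
  define s where "s = d / 2"
  have s: "0 < s" "g s < 1" using d(1) d(2)[of s] w by (auto simp: s_def g_def)
  have "0 \<le> g s" unfolding g_def using w by (intro sum_nonneg) auto
  moreover have "(\<Sum>xs | xs \<in> words A k \<and> real k * c \<le> sum_list (map X xs). prod_list (map w xs)) \<le> g s ^ k" for k
  proof -
    have "(\<Sum>xs | xs \<in> words A k \<and> real k * c \<le> sum_list (map X xs). prod_list (map w xs))
        \<le> (\<Sum>xs | xs \<in> words A k \<and> real k * c \<le> sum_list (map X xs).
            prod_list (map (\<lambda>a. w a * exp (s * (X a - c))) xs))"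
    proof (rule sum_mono)
      fix xs assume xs: "xs \<in> {xs \<in> words A k. real k * c \<le> sum_list (map X xs)}"
      then have "0 \<le> prod_list (map w xs)" using w(1)
        by (intro prod_list_map_nonneg[of A]) (auto simp: words_def)
      moreover have "1 \<le> exp (s * (sum_list (map X xs) - real (length xs) * c))"
        using xs s by (simp add: words_def)
      ultimately show "prod_list (map w xs) \<le> prod_list (map (\<lambda>a. w a * exp (s * (X a - c))) xs)"
        unfolding prod_list_map_exp_tilt using mult_left_mono[of 1] by fastforce
    qed
    also have "\<dots> \<le> (\<Sum>xs\<in>words A k. prod_list (map (\<lambda>a. w a * exp (s * (X a - c))) xs))"
    proof (rule sum_mono2)
      fix xs assume "xs \<in> words A k - {xs \<in> words A k. real k * c \<le> sum_list (map X xs)}"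
      then show "0 \<le> prod_list (map (\<lambda>a. w a * exp (s * (X a - c))) xs)"
        using w(1) by (intro prod_list_map_nonneg[of A]) (auto simp: words_def)
    qed (use fin in auto)
    also have "\<dots> = g s ^ k" unfolding sum_words_prod_list g_def ..
    finally show ?thesis .
  qed
  ultimately show ?thesis using s unfolding c_def by blast
qed

section \<open>Compositions, their fibres and typical weights\<close>

definition compose_list :: "('x \<Rightarrow> 'x) list \<Rightarrow> 'x \<Rightarrow> 'x" where
  "compose_list gs = foldr (\<circ>) gs id"

lemma compose_list_simps [simp]:
  "compose_list [] = id" "compose_list (g # gs) = g \<circ> compose_list gs"
  by (simp_all add: compose_list_def)

lemma compose_list_in:
  assumes "\<And>g. g \<in> \<Gamma> \<Longrightarrow> g ` K \<subseteq> K" "set gs \<subseteq> \<Gamma>" "x \<in> K"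
  shows "compose_list gs x \<in> K"
  using assms(2) by (induction gs) (use assms(1,3) in auto)

lemma card_compose_list_fibre:
  assumes fin: "finite \<Gamma>" and inj: "\<And>g. g \<in> \<Gamma> \<Longrightarrow> inj g" and K: "\<And>g. g \<in> \<Gamma> \<Longrightarrow> g ` K \<subseteq> K"
    and x: "x \<in> K" and M: "\<And>y. real (card {g \<in> \<Gamma>. y \<in> g ` K}) \<le> M"
  shows "real (card {G \<in> words \<Gamma> k. compose_list G = F}) \<le> M ^ k"
proof (induction k arbitrary: F)
  case 0
  have "card {G \<in> words \<Gamma> 0. compose_list G = F} \<le> card {[] :: ('a \<Rightarrow> 'a) list}"
    by (intro card_mono) auto
  then show ?case by simp
next
  case (Suc k)
  have M0: "0 \<le> M" using M[of x] by linarith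
  define S where "S = {g \<in> \<Gamma>. F x \<in> g ` K}"
  define T where "T g = {G \<in> words \<Gamma> k. g \<circ> compose_list G = F}" for g
  have finS: "finite S" using fin by (simp add: S_def)
  have T: "real (card (T g)) \<le> M ^ k" if "g \<in> S" for g
  proof (cases "T g = {}")
    case True
    then show ?thesis using M0 by simp
  next
    case False
    then obtain G0 where G0: "g \<circ> compose_list G0 = F" by (auto simp: T_def)
    have "T g \<subseteq> {G \<in> words \<Gamma> k. compose_list G = compose_list G0}"
    proof
      fix G assume "G \<in> T g"
      then have "G \<in> words \<Gamma> k" "g \<circ> compose_list G = g \<circ> compose_list G0" using G0 by (auto simp: T_def)
      moreover have "inj g" using that inj by (simp add: S_def)
      ultimately show "G \<in> {G \<in> words \<Gamma> k. compose_list G = compose_list G0}"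
        by (simp add: fun.inj_map_strong inj_def fun_eq_iff)
    qed
    then have "card (T g) \<le> card {G \<in> words \<Gamma> k. compose_list G = compose_list G0}"
      using fin by (intro card_mono) auto
    then show ?thesis using Suc.IH[of "compose_list G0"] by linarith
  qed
  have "{G \<in> words \<Gamma> (Suc k). compose_list G = F} \<subseteq> (\<Union>g\<in>S. (#) g ` T g)"
  proof
    fix G assume "G \<in> {G \<in> words \<Gamma> (Suc k). compose_list G = F}"
    then obtain g G' where G: "G = g # G'" "g \<in> \<Gamma>" "G' \<in> words \<Gamma> k" "g \<circ> compose_list G' = F"
      by (auto simp: words_Suc)
    have "compose_list G' x \<in> K"
      using G(3) x by (intro compose_list_in[OF K]) (auto simp: words_def)
    then have "g \<in> S" using G unfolding S_def by auto
    then show "G \<in> (\<Union>g\<in>S. (#) g ` T g)" using G by (auto simp: T_def)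
  qed
  then have "card {G \<in> words \<Gamma> (Suc k). compose_list G = F} \<le> card (\<Union>g\<in>S. (#) g ` T g)"
    using fin finS by (intro card_mono) (auto simp: T_def)
  also have "\<dots> \<le> (\<Sum>g\<in>S. card ((#) g ` T g))" by (rule card_UN_le[OF finS])
  also have "\<dots> = (\<Sum>g\<in>S. card (T g))" by (intro sum.cong card_image) (auto simp: inj_on_def)
  finally have "real (card {G \<in> words \<Gamma> (Suc k). compose_list G = F}) \<le> real (\<Sum>g\<in>S. card (T g))"
    by (rule of_nat_mono)
  also have "\<dots> = (\<Sum>g\<in>S. real (card (T g)))" by simp
  also have "\<dots> \<le> (\<Sum>g\<in>S. M ^ k)" using T by (intro sum_mono) auto
  also have "\<dots> \<le> M * M ^ k" using M[of "F x"] M0 by (simp add: S_def mult_right_mono)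
  finally show ?case by simp
qed

text \<open>A light element has less than \<theta>/C times the mass of its fibre, and a fibre has at
  most C elements, so the light ones make up at most the proportion \<theta> of each fibre. Outside
  this small set the weight of one word controls the weight of its whole fibre from above.\<close>

lemma sum_light_in_fibre_le:
  fixes W :: "'a \<Rightarrow> real" and f :: "'a \<Rightarrow> 'b"
  assumes fin: "finite T" and W: "\<And>x. x \<in> T \<Longrightarrow> 0 \<le> W x" "sum W T = 1"
    and C: "0 < C" "\<And>b. real (card {x \<in> T. f x = b}) \<le> C" and \<theta>: "0 \<le> \<theta>"
  shows "(\<Sum>x | x \<in> T \<and> W x * C < sum W {y \<in> T. f y = f x} * \<theta>. W x) \<le> \<theta>"
proof -
  define B where "B = {x \<in> T. W x * C < sum W {y \<in> T. f y = f x} * \<theta>}"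
  have finB: "finite B" using fin by (simp add: B_def)
  have "sum W B = (\<Sum>b\<in>f ` B. sum W {x \<in> B. f x = b})"
    using finB by (rule sum.image_gen)
  also have "\<dots> \<le> (\<Sum>b\<in>f ` B. \<theta> * sum W {y \<in> T. f y = b})"
  proof (rule sum_mono)
    fix b
    let ?q = "sum W {y \<in> T. f y = b}"
    have q: "0 \<le> ?q" using W by (intro sum_nonneg) auto
    have "sum W {x \<in> B. f x = b} \<le> (\<Sum>x\<in>{x \<in> B. f x = b}. ?q * \<theta> / C)"
      using C(1) by (intro sum_mono) (auto simp: B_def field_simps)
    also have "\<dots> = real (card {x \<in> B. f x = b}) * (?q * \<theta> / C)" by simp
    also have "\<dots> \<le> real (card {x \<in> T. f x = b}) * (?q * \<theta> / C)"
      using fin q \<theta> C by (intro mult_right_mono of_nat_mono card_mono) (auto simp: B_def)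
    also have "\<dots> \<le> C * (?q * \<theta> / C)"
      using C q \<theta> by (intro mult_right_mono) auto
    finally show "sum W {x \<in> B. f x = b} \<le> \<theta> * ?q" using C(1) by (simp add: mult.commute)
  qed
  also have "\<dots> = \<theta> * (\<Sum>b\<in>f ` B. sum W {y \<in> T. f y = b})" by (simp add: sum_distrib_left)
  also have "\<dots> \<le> \<theta> * (\<Sum>b\<in>f ` T. sum W {y \<in> T. f y = b})"
    using fin W \<theta> by (intro mult_left_mono sum_mono2 sum_nonneg) (auto simp: B_def)
  also have "\<dots> = \<theta>" using sum.image_gen[OF fin, of W f] W by simp
  finally show ?thesis by (simp add: B_def)
qed

lemma prod_list_eq_exp:
  fixes w :: "'a \<Rightarrow> real"
  assumes "\<And>a. a \<in> A \<Longrightarrow> 0 < w a" "set xs \<subseteq> A"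
  shows "prod_list (map w xs) = exp (- sum_list (map (\<lambda>a. - ln (w a)) xs))"
  using assms(2) by (induction xs) (use assms(1) in \<open>auto simp: exp_diff exp_minus inverse_eq_divide\<close>)

text \<open>The factor 5 counts the exceptional events: deviation upwards and downwards of the log
  weight and of Y, and being light in the fibre. Off these, the weight of the word is exp(-kH) up to
  exp(k\<delta>). Its fibre weighs at least as much, and at most M^k exp(k\<delta>) times as much,
  whence the loss 2\<delta> + \<open>ln M\<close>.\<close>

lemma typical_words:
  fixes w Y :: "'a \<Rightarrow> real" and f :: "'a list \<Rightarrow> 'b"
  assumes fin: "finite A" and w: "\<And>a. a \<in> A \<Longrightarrow> 0 < w a" "(\<Sum>a\<in>A. w a) = 1" and \<delta>: "0 < \<delta>"
    and M: "0 < M" "\<And>k b. real (card {xs \<in> words A k. f xs = b}) \<le> M ^ k"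
  defines "H \<equiv> (\<Sum>a\<in>A. w a * (- ln (w a)))" and "L \<equiv> (\<Sum>a\<in>A. w a * Y a)"
    and "W \<equiv> (\<lambda>xs. prod_list (map w xs))"
  shows "\<exists>\<rho>. 0 < \<rho> \<and> \<rho> < 1 \<and> (\<forall>k. \<exists>\<G>\<subseteq>words A k.
     sum W (words A k - \<G>) \<le> 5 * \<rho> ^ k \<and>
     (\<forall>xs\<in>\<G>. \<bar>sum_list (map Y xs) - real k * L\<bar> \<le> real k * \<delta> \<and>
        exp (- (real k * (H + \<delta>))) \<le> sum W {ys \<in> words A k. f ys = f xs} \<and>
        sum W {ys \<in> words A k. f ys = f xs} \<le> exp (- (real k * (H - 2 * \<delta> - ln M)))))"
proof -
  have w0: "\<And>a. a \<in> A \<Longrightarrow> 0 \<le> w a" using w by (auto intro: less_imp_le)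
  note ch = chernoff_words[OF fin w0 w(2) \<delta>]
  have neg: "sum_list (map (\<lambda>a. - X a) xs) = - sum_list (map X xs)" for X :: "'a \<Rightarrow> real" and xs
    by (induction xs) auto
  obtain \<rho>1 where \<rho>1: "0 \<le> \<rho>1" "\<rho>1 < 1" "\<And>k. sum W {xs \<in> words A k. real k * (H + \<delta>) \<le> sum_list (map (\<lambda>a. - ln (w a)) xs)} \<le> \<rho>1 ^ k"
    using ch[of "\<lambda>a. - ln (w a)"] unfolding H_def W_def by blast
  obtain \<rho>2 where \<rho>2: "0 \<le> \<rho>2" "\<rho>2 < 1" "\<And>k. sum W {xs \<in> words A k. real k * (- H + \<delta>) \<le> - sum_list (map (\<lambda>a. - ln (w a)) xs)} \<le> \<rho>2 ^ k"
    using ch[of "\<lambda>a. - (- ln (w a))"] unfolding H_def W_def neg mult_minus_right sum_negf by blast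
  obtain \<rho>3 where \<rho>3: "0 \<le> \<rho>3" "\<rho>3 < 1" "\<And>k. sum W {xs \<in> words A k. real k * (L + \<delta>) \<le> sum_list (map Y xs)} \<le> \<rho>3 ^ k"
    using ch[of Y] unfolding L_def W_def by blast
  obtain \<rho>4 where \<rho>4: "0 \<le> \<rho>4" "\<rho>4 < 1" "\<And>k. sum W {xs \<in> words A k. real k * (- L + \<delta>) \<le> - sum_list (map Y xs)} \<le> \<rho>4 ^ k"
    using ch[of "\<lambda>a. - Y a"] unfolding L_def W_def neg mult_minus_right sum_negf by blast
  define Q where "Q k xs = sum W {ys \<in> words A k. f ys = f xs}" for k xs
  have W0: "0 \<le> W xs" if "xs \<in> words A k" for xs k
    using that w0 unfolding W_def by (intro prod_list_map_nonneg[of A]) (auto simp: words_def)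
  have \<rho>5: "sum W {xs \<in> words A k. W xs * M ^ k < Q k xs * exp (- \<delta>) ^ k} \<le> exp (- \<delta>) ^ k" for k
    unfolding Q_def
  proof (rule sum_light_in_fibre_le)
    show "sum W (words A k) = 1" unfolding W_def sum_words_prod_list w by simp
  qed (use fin M W0 in auto)
  define \<rho> where "\<rho> = Max {\<rho>1, \<rho>2, \<rho>3, \<rho>4, exp (- \<delta>)}"
  have le: "\<rho>1 \<le> \<rho>" "\<rho>2 \<le> \<rho>" "\<rho>3 \<le> \<rho>" "\<rho>4 \<le> \<rho>" "exp (- \<delta>) \<le> \<rho>" by (auto simp: \<rho>_def)
  have "\<rho> < 1" using \<rho>1 \<rho>2 \<rho>3 \<rho>4 \<delta> by (simp add: \<rho>_def)
  moreover have "0 < \<rho>" using le(5) exp_gt_zero[of "- \<delta>"] by linarith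
  moreover have "\<exists>\<G>\<subseteq>words A k. sum W (words A k - \<G>) \<le> 5 * \<rho> ^ k \<and>
     (\<forall>xs\<in>\<G>. \<bar>sum_list (map Y xs) - real k * L\<bar> \<le> real k * \<delta> \<and>
        exp (- (real k * (H + \<delta>))) \<le> Q k xs \<and> Q k xs \<le> exp (- (real k * (H - 2 * \<delta> - ln M))))" for k
  proof -
    let ?B1 = "{xs \<in> words A k. real k * (H + \<delta>) \<le> sum_list (map (\<lambda>a. - ln (w a)) xs)}"
    let ?B2 = "{xs \<in> words A k. real k * (- H + \<delta>) \<le> - sum_list (map (\<lambda>a. - ln (w a)) xs)}"
    let ?B3 = "{xs \<in> words A k. real k * (L + \<delta>) \<le> sum_list (map Y xs)}"
    let ?B4 = "{xs \<in> words A k. real k * (- L + \<delta>) \<le> - sum_list (map Y xs)}"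
    let ?B5 = "{xs \<in> words A k. W xs * M ^ k < Q k xs * exp (- \<delta>) ^ k}"
    define \<G> where "\<G> = words A k - (?B1 \<union> ?B2 \<union> ?B3 \<union> ?B4 \<union> ?B5)"
    have union: "sum W (B \<union> C) \<le> sum W B + sum W C" if "B \<subseteq> words A k" "C \<subseteq> words A k" for B C
    proof -
      have "finite B" "finite C" using that fin by (auto intro: finite_subset[OF _ finite_words])
      moreover have "0 \<le> sum W (B \<inter> C)" using that W0 by (intro sum_nonneg) auto
      ultimately show ?thesis by (simp add: sum_Un)
    qed
    have pw: "r ^ k \<le> \<rho> ^ k" if "0 \<le> r" "r \<le> \<rho>" for r using that by (intro power_mono) auto
    have "words A k - \<G> = ?B1 \<union> ?B2 \<union> ?B3 \<union> ?B4 \<union> ?B5" by (auto simp: \<G>_def)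
    then have "sum W (words A k - \<G>) = sum W (?B1 \<union> ?B2 \<union> ?B3 \<union> ?B4 \<union> ?B5)" by simp
    also have "\<dots> \<le> sum W (?B1 \<union> ?B2 \<union> ?B3 \<union> ?B4) + sum W ?B5" by (intro union) auto
    also have "sum W (?B1 \<union> ?B2 \<union> ?B3 \<union> ?B4) \<le> sum W (?B1 \<union> ?B2 \<union> ?B3) + sum W ?B4" by (intro union) auto
    also have "sum W (?B1 \<union> ?B2 \<union> ?B3) \<le> sum W (?B1 \<union> ?B2) + sum W ?B3" by (intro union) auto
    also have "sum W (?B1 \<union> ?B2) \<le> sum W ?B1 + sum W ?B2" by (intro union) auto
    finally have "sum W (words A k - \<G>) \<le> sum W ?B1 + sum W ?B2 + sum W ?B3 + sum W ?B4 + sum W ?B5"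
      by simp
    then have mass: "sum W (words A k - \<G>) \<le> 5 * \<rho> ^ k"
      using \<rho>1(3)[of k] \<rho>2(3)[of k] \<rho>3(3)[of k] \<rho>4(3)[of k] \<rho>5[of k]
        pw[OF \<rho>1(1) le(1)] pw[OF \<rho>2(1) le(2)] pw[OF \<rho>3(1) le(3)] pw[OF \<rho>4(1) le(4)] pw[OF _ le(5)]
      by (smt (verit) exp_ge_zero)
    have good: "\<bar>sum_list (map Y xs) - real k * L\<bar> \<le> real k * \<delta> \<and>
        exp (- (real k * (H + \<delta>))) \<le> Q k xs \<and> Q k xs \<le> exp (- (real k * (H - 2 * \<delta> - ln M)))" if "xs \<in> \<G>" for xs
    proof -
      define X where "X = sum_list (map (\<lambda>a. - ln (w a)) xs)"
      have xs: "xs \<in> words A k" and X: "X < real k * (H + \<delta>)" "- X < real k * (- H + \<delta>)"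
        and Y: "sum_list (map Y xs) < real k * (L + \<delta>)" "- sum_list (map Y xs) < real k * (- L + \<delta>)"
        and q: "Q k xs * exp (- \<delta>) ^ k \<le> W xs * M ^ k"
        using that unfolding \<G>_def X_def by (auto simp: not_le not_less)
      have WX: "W xs = exp (- X)" unfolding W_def X_def
        using xs w by (intro prod_list_eq_exp[of A]) (auto simp: words_def)
      have "W xs \<le> Q k xs"
        unfolding Q_def using xs fin W0 by (intro member_le_sum) auto
      moreover have "exp (- (real k * (H + \<delta>))) \<le> W xs" unfolding WX using X by simp
      moreover have "Q k xs \<le> exp (- (real k * (H - 2 * \<delta> - ln M)))"
      proof -
        have Mk: "M ^ k = exp (real k * ln M)" using M(1) by (simp add: exp_of_nat_mult)
        have "Q k xs = Q k xs * exp (- \<delta>) ^ k * exp (real k * \<delta>)"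
          by (simp add: mult.assoc exp_of_nat_mult[symmetric] mult_exp_exp)
        also have "\<dots> \<le> W xs * M ^ k * exp (real k * \<delta>)" using q by (intro mult_right_mono) auto
        also have "\<dots> = exp (- X + real k * ln M + real k * \<delta>)" unfolding WX Mk by (simp add: mult_exp_exp)
        also have "\<dots> \<le> exp (- (real k * (H - 2 * \<delta> - ln M)))" using X by (simp add: algebra_simps)
        finally show ?thesis .
      qed
      ultimately show ?thesis using Y by (auto simp: algebra_simps abs_le_iff)
    qed
    show ?thesis using mass good by (intro exI[of _ \<G>]) (auto simp: \<G>_def)
  qed
  ultimately show ?thesis unfolding Q_def by blast
qed

section \<open>Decomposition of the measure over maps, and the dyadic cover\<close>

lemma measure_eq_sum_words:
  fixes \<mu> :: "real measure" and \<phi> :: "'a \<Rightarrow> real \<Rightarrow> real"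
  assumes meas: "\<And>a. a \<in> A \<Longrightarrow> \<phi> a \<in> borel_measurable borel"
    and ss: "\<And>E. E \<in> sets borel \<Longrightarrow> measure \<mu> E = (\<Sum>a\<in>A. w a * measure \<mu> (\<phi> a -` E))"
    and E: "E \<in> sets borel"
  shows "measure \<mu> E =
    (\<Sum>xs\<in>words A k. prod_list (map w xs) * measure \<mu> (compose_list (map \<phi> xs) -` E))"
  using E
proof (induction k arbitrary: E)
  case 0 then show ?case by simp
next
  case (Suc k)
  have "measure \<mu> E = (\<Sum>a\<in>A. w a * measure \<mu> (\<phi> a -` E))" by (rule ss[OF Suc.prems])
  also have "\<dots> = (\<Sum>a\<in>A. w a * (\<Sum>xs\<in>words A k. prod_list (map w xs) *
      measure \<mu> (compose_list (map \<phi> xs) -` (\<phi> a -` E))))"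
  proof (intro sum.cong refl)
    fix a assume "a \<in> A"
    then have "\<phi> a -` E \<in> sets borel" using measurable_sets[OF meas Suc.prems] by simp
    from Suc.IH[OF this]
    show "w a * measure \<mu> (\<phi> a -` E) = w a * (\<Sum>xs\<in>words A k. prod_list (map w xs) *
      measure \<mu> (compose_list (map \<phi> xs) -` (\<phi> a -` E)))" by simp
  qed
  also have "\<dots> = (\<Sum>xs\<in>words A (Suc k). prod_list (map w xs) * measure \<mu> (compose_list (map \<phi> xs) -` E))"
    by (simp add: sum_words_Suc sum_distrib_left vimage_comp mult.assoc)
  finally show ?case .
qed

lemma sum_group_weights:
  fixes W :: "'a \<Rightarrow> real"
  assumes "finite T"
  shows "(\<Sum>x\<in>T. W x * h (f x)) = (\<Sum>b\<in>f ` T. sum W {x \<in> T. f x = b} * h b)"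
proof -
  have "(\<Sum>x\<in>T. W x * h (f x)) = (\<Sum>b\<in>f ` T. \<Sum>x | x \<in> T \<and> f x = b. W x * h (f x))"
    by (rule sum.image_gen[OF assms])
  also have "\<dots> = (\<Sum>b\<in>f ` T. sum W {x \<in> T. f x = b} * h b)"
    by (auto simp: sum_distrib_right intro!: sum.cong)
  finally show ?thesis .
qed

text \<open>Here \<open>\<F>\<close> are the typical maps. A dyadic interval is kept if the atypical maps give it no
  more mass than the typical ones; the discarded mass is then at most twice the atypical mass.\<close>

lemma dyadic_cover:
  fixes \<mu> :: "real measure" and \<M> :: "(real \<Rightarrow> real) set" and Q :: "(real \<Rightarrow> real) \<Rightarrow> real"
  assumes prob: "prob_space \<mu>" and sets: "sets \<mu> = sets borel"
    and K: "K \<in> sets borel" "measure \<mu> K = 1"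
    and fin: "finite \<M>" and sub: "\<F> \<subseteq> \<M>"
    and meas: "\<And>F. F \<in> \<M> \<Longrightarrow> F \<in> borel_measurable borel"
    and Q0: "\<And>F. F \<in> \<M> \<Longrightarrow> 0 \<le> Q F"
    and dec: "\<And>E. E \<in> sets borel \<Longrightarrow> measure \<mu> E = (\<Sum>F\<in>\<M>. Q F * measure \<mu> (F -` E))"
    and rest: "sum Q (\<M> - \<F>) \<le> \<eta>"
    and small: "\<And>F x y. F \<in> \<F> \<Longrightarrow> x \<in> K \<Longrightarrow> y \<in> K \<Longrightarrow> \<bar>F x - F y\<bar> \<le> (1/2) ^ n"
    and Qb: "\<And>F. F \<in> \<F> \<Longrightarrow> Q F \<le> b" and b0: "0 \<le> b"
    and count: "\<And>i. real (card {F \<in> \<F>. F ` K \<inter> dyadic n i \<noteq> {}}) \<le> C"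
  shows "\<exists>D. finite D \<and> card D \<le> 3 * card \<F> \<and>
    (\<forall>i\<in>D. measure \<mu> (dyadic n i) \<le> 2 * (C * b)) \<and>
    1 - 2 * \<eta> \<le> measure \<mu> (\<Union>i\<in>D. dyadic n i)"
proof -
  interpret prob_space \<mu> by fact
  have "K \<noteq> {}" using K by auto
  then obtain x0 where x0: "x0 \<in> K" by auto
  have finF: "finite \<F>" using fin sub finite_subset by auto
  \<comment> \<open>A typical image of K is no longer than one cell, so its indices differ by at
    most one from that of a reference point; hence three cells per map.\<close>
  define I where "I F = {\<lfloor>F x0 * 2 ^ n\<rfloor> - 1 .. \<lfloor>F x0 * 2 ^ n\<rfloor> + 1}" for F :: "real \<Rightarrow> real"
  have I: "\<lfloor>F x * 2 ^ n\<rfloor> \<in> I F" if "F \<in> \<F>" "x \<in> K" for F x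
  proof -
    have "\<bar>F x - F x0\<bar> * 2 ^ n \<le> 1"
      using small[OF that x0] by (simp add: power_one_over field_simps)
    then have "\<bar>F x * 2 ^ n - F x0 * 2 ^ n\<bar> \<le> 1"
      by (simp add: abs_mult left_diff_distrib[symmetric])
    then show ?thesis unfolding I_def atLeastAtMost_iff by linarith
  qed
  define D0 where "D0 = (\<Union>F\<in>\<F>. I F)"
  have finD0: "finite D0" using finF by (auto simp: D0_def I_def)
  have "card D0 \<le> (\<Sum>F\<in>\<F>. card (I F))" unfolding D0_def by (rule card_UN_le[OF finF])
  also have "\<dots> = 3 * card \<F>" by (simp add: I_def)
  finally have cardD0: "card D0 \<le> 3 * card \<F>" .
  define g where "g E = (\<Sum>F\<in>\<F>. Q F * measure \<mu> (F -` E))" for E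
  define h where "h E = (\<Sum>F\<in>\<M> - \<F>. Q F * measure \<mu> (F -` E))" for E
  have split: "measure \<mu> E = g E + h E" if "E \<in> sets borel" for E
    unfolding dec[OF that] g_def h_def using sum.subset_diff[OF sub fin] by (simp add: add.commute)
  have g0: "0 \<le> g E" and h0: "0 \<le> h E" for E
    unfolding g_def h_def using Q0 sub by (auto intro!: sum_nonneg mult_nonneg_nonneg)
  have vm: "F -` E \<in> sets \<mu>" if "F \<in> \<M>" "E \<in> sets borel" for F E
    using measurable_sets[OF meas[OF that(1)] that(2)] sets by simp
  have disj: "disjoint_family_on (\<lambda>i. F -` dyadic n i) D" for F D
    using disjoint_dyadic[of _ _ n] by (auto simp: disjoint_family_on_def)
  have sumI: "(\<Sum>i\<in>D. measure \<mu> (F -` dyadic n i)) = measure \<mu> (F -` (\<Union>i\<in>D. dyadic n i))"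
    if "finite D" "F \<in> \<M>" for F D
    unfolding vimage_UN using that vm disj by (intro finite_measure_finite_Union[symmetric]) auto
  have Kc: "measure \<mu> (F -` E) = 0" if "F ` K \<inter> E = {}" "F \<in> \<M>" "E \<in> sets borel" for F E
  proof -
    have "measure \<mu> (F -` E) \<le> measure \<mu> (space \<mu> - K)"
      using that sets K sets_eq_imp_space_eq[OF sets]
      by (intro finite_measure_mono) (auto simp: image_def)
    also have "\<dots> = 0" using K sets by (simp add: prob_compl)
    finally show ?thesis by (simp add: measure_le_0_iff)
  qed
  define D where "D = {i \<in> D0. h (dyadic n i) \<le> g (dyadic n i)}"
  have finD: "finite D" "D \<subseteq> D0" using finD0 by (auto simp: D_def)
  have gb: "g (dyadic n i) \<le> C * b" for i
  proof -
    let ?S = "{F \<in> \<F>. F ` K \<inter> dyadic n i \<noteq> {}}"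
    have "g (dyadic n i) = (\<Sum>F\<in>?S. Q F * measure \<mu> (F -` dyadic n i))"
      unfolding g_def using finF sub Kc by (intro sum.mono_neutral_right) auto
    also have "\<dots> \<le> (\<Sum>F\<in>?S. b * 1)"
      using Qb Q0 sub b0 by (intro sum_mono mult_mono) auto
    also have "\<dots> \<le> C * b" using count[of i] b0 by (simp add: mult_right_mono)
    finally show ?thesis .
  qed
  have mass: "measure \<mu> (dyadic n i) \<le> 2 * (C * b)" if "i \<in> D" for i
    using split[of "dyadic n i"] gb[of i] that by (simp add: D_def)
  have total: "sum Q \<M> = 1"
  proof -
    have "sum Q \<M> = measure \<mu> UNIV" using dec[of UNIV] prob_space sets_eq_imp_space_eq[OF sets] by simp
    then show ?thesis using prob_space sets_eq_imp_space_eq[OF sets] by simp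
  qed
  have "(\<Sum>i\<in>D0. g (dyadic n i)) = (\<Sum>F\<in>\<F>. Q F * (\<Sum>i\<in>D0. measure \<mu> (F -` dyadic n i)))"
    unfolding g_def sum_distrib_left by (rule sum.swap)
  also have "\<dots> = (\<Sum>F\<in>\<F>. Q F * measure \<mu> (F -` (\<Union>i\<in>D0. dyadic n i)))"
    using sumI[OF finD0] sub by (intro sum.cong) auto
  also have "\<dots> \<ge> (\<Sum>F\<in>\<F>. Q F * 1)"
  proof (intro sum_mono mult_left_mono)
    fix F assume F: "F \<in> \<F>"
    have "K \<subseteq> F -` (\<Union>i\<in>D0. dyadic n i)"
      using I[OF F] F by (auto simp: D0_def dyadic_def)
    then have "measure \<mu> K \<le> measure \<mu> (F -` (\<Union>i\<in>D0. dyadic n i))"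
      using F sub finD0 by (intro finite_measure_mono vm sets.finite_UN) auto
    then show "1 \<le> measure \<mu> (F -` (\<Union>i\<in>D0. dyadic n i))" using K by simp
    show "0 \<le> Q F" using F sub Q0 by auto
  qed
  finally have gD0: "sum Q \<F> \<le> (\<Sum>i\<in>D0. g (dyadic n i))" by simp
  have QF: "1 - \<eta> \<le> sum Q \<F>" using total rest sum.subset_diff[OF sub fin, of Q] by simp
  have "(\<Sum>i\<in>D0 - D. g (dyadic n i)) \<le> (\<Sum>i\<in>D0 - D. h (dyadic n i))"
    by (intro sum_mono) (auto simp: D_def)
  also have "\<dots> \<le> (\<Sum>i\<in>D0. h (dyadic n i))"
    using finD0 h0 by (intro sum_mono2) auto
  also have "\<dots> = (\<Sum>F\<in>\<M> - \<F>. Q F * (\<Sum>i\<in>D0. measure \<mu> (F -` dyadic n i)))"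
    unfolding h_def sum_distrib_left by (rule sum.swap)
  also have "\<dots> \<le> (\<Sum>F\<in>\<M> - \<F>. Q F * 1)"
    using sumI[OF finD0] Q0 by (intro sum_mono mult_left_mono) auto
  also have "\<dots> \<le> \<eta>" using rest by simp
  finally have gout: "(\<Sum>i\<in>D0 - D. g (dyadic n i)) \<le> \<eta>" .
  have "1 - 2 * \<eta> \<le> (\<Sum>i\<in>D0. g (dyadic n i)) - (\<Sum>i\<in>D0 - D. g (dyadic n i))"
    using gD0 QF gout by simp
  also have "\<dots> = (\<Sum>i\<in>D. g (dyadic n i))"
    using sum.subset_diff[OF finD(2) finD0, of "\<lambda>i. g (dyadic n i)"] by simp
  also have "\<dots> \<le> (\<Sum>i\<in>D. measure \<mu> (dyadic n i))"
    using split h0 by (intro sum_mono) auto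
  also have "\<dots> = measure \<mu> (\<Union>i\<in>D. dyadic n i)"
    using finD disjoint_dyadic[of _ _ n] sets
    by (intro finite_measure_finite_Union[symmetric]) (auto simp: disjoint_family_on_def)
  finally have "1 - 2 * \<eta> \<le> measure \<mu> (\<Union>i\<in>D. dyadic n i)" .
  moreover have "card D \<le> 3 * card \<F>" using card_mono[OF finD0 finD(2)] cardD0 by simp
  ultimately show ?thesis using finD mass by blast
qed

section \<open>From compositions of k blocks to dyadic levels\<close>

lemma eventually_le_linear:
  fixes \<kappa> B :: real
  assumes "0 < \<kappa>"
  obtains n0 :: nat where "\<And>n. n \<ge> n0 \<Longrightarrow> B \<le> real n * \<kappa>"
proof -
  obtain n0 :: nat where "B / \<kappa> < real n0" using reals_Archimedean2 by blast
  then have B: "B \<le> real n0 * \<kappa>" using assms by (simp add: field_simps)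
  have "B \<le> real n * \<kappa>" if "n \<ge> n0" for n
  proof -
    have "real n0 * \<kappa> \<le> real n * \<kappa>" using that assms by (intro mult_right_mono) auto
    with B show ?thesis by linarith
  qed
  then show ?thesis using that by blast
qed

text \<open>The depth k of the random walk is matched with the dyadic level n through kL(1-e) close
  to n ln 2. Contraction ratios range between exp(-kL(1+e)) and exp(-kL(1-e)); this spread and the
  errors in the weights shift exponents by multiples of e. The factor 1 + kc, linear in k, is
  absorbed by exp(kLe).\<close>

lemma concentrated_of_levels:
  fixes \<mu> :: "real measure" and \<rho> L e \<alpha> \<epsilon> N c :: real
  assumes prob: "prob_space \<mu>" and sets: "sets \<mu> = sets borel"
    and K: "K \<in> sets borel" "measure \<mu> K = 1"
    and L: "0 < L" and \<alpha>: "0 \<le> \<alpha>" and e: "0 < e" "e \<le> 1/2" "12 * e < \<epsilon>" "2 * e * (\<alpha> + 1) < \<epsilon>"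
    and \<rho>: "0 < \<rho>" "\<rho> < 1" and N: "0 < N" and c: "0 \<le> c"
    and levels: "\<And>k. k \<ge> 1 \<Longrightarrow> \<exists>\<M> Q \<F>. finite \<M> \<and> \<F> \<subseteq> \<M> \<and>
      (\<forall>F\<in>\<M>. F \<in> borel_measurable borel \<and> 0 \<le> Q F) \<and>
      (\<forall>E\<in>sets borel. measure \<mu> E = (\<Sum>F\<in>\<M>. Q F * measure \<mu> (F -` E))) \<and>
      sum Q (\<M> - \<F>) \<le> 5 * \<rho> ^ k \<and>
      (\<forall>F\<in>\<F>. (\<forall>x\<in>K. \<forall>y\<in>K. \<bar>F x - F y\<bar> \<le> exp (- (real k * L * (1 - e)))) \<and>
         exp (- (real k * L * (\<alpha> + e))) \<le> Q F \<and> Q F \<le> exp (- (real k * L * (\<alpha> - 3 * e)))) \<and>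
      (\<forall>u. \<forall>s\<ge>0. real (card {F \<in> \<F>. F ` K \<inter> {u..u + s} \<noteq> {}})
         \<le> N * (1 + real k * c) * (s * exp (real k * L * (1 + e)) + 1))"
  shows "concentrated \<mu> \<alpha> \<epsilon>"
proof -
  interpret prob_space \<mu> by fact
  have Le: "0 < L * (1 - e)" using L e by simp
  \<comment> \<open>The least depth at which typical images of K fit into the length 2^(-n) of a
    cell. Rounding up costs at most L in the exponent.\<close>
  define k where "k n = nat \<lceil>real n * ln 2 / (L * (1 - e))\<rceil>" for n
  have k_lower: "real n * ln 2 \<le> real (k n) * L * (1 - e)" for n
  proof -
    have "real n * ln 2 / (L * (1 - e)) \<le> real (k n)" unfolding k_def by linarith
    then show ?thesis using Le by (simp add: field_simps)
  qed
  have k_upper: "real (k n) * L * (1 - e) \<le> real n * ln 2 + L" for n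
  proof -
    have "0 \<le> real n * ln 2 / (L * (1 - e))" using Le by (intro divide_nonneg_pos) auto
    then have "real (k n) \<le> real n * ln 2 / (L * (1 - e)) + 1" unfolding k_def by linarith
    then have "real (k n) * (L * (1 - e)) \<le> (real n * ln 2 / (L * (1 - e)) + 1) * (L * (1 - e))"
      using Le by (intro mult_right_mono) auto
    also have "\<dots> = real n * ln 2 + L * (1 - e)" using L e by (simp add: distrib_right)
    also have "\<dots> \<le> real n * ln 2 + L" using L e by (simp add: algebra_simps)
    finally show ?thesis by (simp add: mult.assoc)
  qed
  define \<eta> where "\<eta> n = 2 * (5 * \<rho> ^ k n)" for n
  have "summable \<eta>"
  proof (rule summable_comparison_test')
    define r where "r = \<rho> powr (ln 2 / (L * (1 - e)))"
    have "r < 1" using \<rho> Le by (simp add: r_def powr01_less_one)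
    then show "summable (\<lambda>n. 10 * r ^ n)" by (intro summable_mult summable_geometric) (simp add: r_def)
    fix n
    have "\<rho> ^ k n = \<rho> powr real (k n)" using \<rho> by (simp add: powr_realpow)
    also have "\<dots> \<le> \<rho> powr (ln 2 / (L * (1 - e)) * real n)"
      using \<rho> k_lower[of n] Le by (intro powr_mono') (auto simp: field_simps)
    also have "\<dots> = r ^ n" using \<rho> by (simp add: r_def powr_powr powr_realpow[symmetric])
    finally show "norm (\<eta> n) \<le> 10 * r ^ n" using \<rho> by (simp add: \<eta>_def)
  qed
  define C3 where "C3 = 4 * N * (1 + c / (L * e)) * exp L"
  have C3: "0 < C3" using N c L e unfolding C3_def by (intro mult_pos_pos add_pos_nonneg) auto
  have pos: "0 < ln 2 * (\<epsilon> - 2 * e * (\<alpha> + 1))" "0 < ln 2 * (\<epsilon> - 12 * e)"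
    using e by (intro mult_pos_pos; simp)+
  obtain n1 where n1: "\<And>n. n \<ge> n1 \<Longrightarrow> ln 3 + 2 * L * (\<alpha> + e) \<le> real n * (ln 2 * (\<epsilon> - 2 * e * (\<alpha> + 1)))"
    using eventually_le_linear[OF pos(1), of "ln 3 + 2 * L * (\<alpha> + e)"] by blast
  obtain n2 where n2: "\<And>n. n \<ge> n2 \<Longrightarrow> ln C3 + 12 * e * L \<le> real n * (ln 2 * (\<epsilon> - 12 * e))"
    using eventually_le_linear[OF pos(2), of "ln C3 + 12 * e * L"] by blast
  have main: "\<exists>D. finite D \<and> real (card D) \<le> 2 powr (real n * (\<alpha> + \<epsilon>)) \<and>
      (\<forall>i\<in>D. measure \<mu> (dyadic n i) \<le> 2 powr (- (real n * (\<alpha> - \<epsilon>)))) \<and>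
      1 - \<eta> n \<le> measure \<mu> (\<Union>i\<in>D. dyadic n i)" if n: "n \<ge> Max {1, n1, n2}" for n
  proof -
    have n': "n \<ge> 1" "n \<ge> n1" "n \<ge> n2" using n by auto
    define y where "y = real n * ln 2"
    define x where "x = real (k n) * L"
    have y: "0 < y" using n' by (simp add: y_def)
    have half: "(1/2) ^ n = exp (- y)"
      by (simp add: y_def exp_minus exp_of_nat_mult power_one_over inverse_eq_divide)
    have two: "2 powr (real n * z) = exp (y * z)" for z by (simp add: powr_def y_def)
    have xy: "y \<le> x * (1 - e)" "x * (1 - e) \<le> y + L"
      using k_lower[of n] k_upper[of n] by (auto simp: x_def y_def)
    have x0: "0 \<le> x" using L by (simp add: x_def)
    have "x * (1 - e) \<le> x * 1" using x0 e by (intro mult_left_mono) auto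
    then have yx: "y \<le> x" using xy by simp
    have "x * (1/2) \<le> x * (1 - e)" using x0 e by (intro mult_left_mono) auto
    then have x2: "x \<le> 2 * y + 2 * L" using xy by simp
    have "0 < x" using yx y by linarith
    then have "k n \<ge> 1" by (cases "k n") (auto simp: x_def)
    from levels[OF this, folded x_def] obtain \<M> Q \<F> where lev: "finite \<M>" "\<F> \<subseteq> \<M>"
      "\<forall>F\<in>\<M>. F \<in> borel_measurable borel \<and> 0 \<le> Q F"
      "\<forall>E\<in>sets borel. measure \<mu> E = (\<Sum>F\<in>\<M>. Q F * measure \<mu> (F -` E))"
      "sum Q (\<M> - \<F>) \<le> 5 * \<rho> ^ k n"
      "\<forall>F\<in>\<F>. (\<forall>u\<in>K. \<forall>v\<in>K. \<bar>F u - F v\<bar> \<le> exp (- (x * (1 - e)))) \<and>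
         exp (- (x * (\<alpha> + e))) \<le> Q F \<and> Q F \<le> exp (- (x * (\<alpha> - 3 * e)))"
      "\<forall>u. \<forall>s\<ge>0. real (card {F \<in> \<F>. F ` K \<inter> {u..u + s} \<noteq> {}})
         \<le> N * (1 + real (k n) * c) * (s * exp (x * (1 + e)) + 1)"
      by (elim exE conjE) (rule that)
    have M: "finite \<M>" "\<F> \<subseteq> \<M>"
      "\<And>F. F \<in> \<M> \<Longrightarrow> F \<in> borel_measurable borel" "\<And>F. F \<in> \<M> \<Longrightarrow> 0 \<le> Q F"
      "\<And>E. E \<in> sets borel \<Longrightarrow> measure \<mu> E = (\<Sum>F\<in>\<M>. Q F * measure \<mu> (F -` E))"
      "sum Q (\<M> - \<F>) \<le> 5 * \<rho> ^ k n"
      "\<And>F u v. F \<in> \<F> \<Longrightarrow> u \<in> K \<Longrightarrow> v \<in> K \<Longrightarrow> \<bar>F u - F v\<bar> \<le> exp (- (x * (1 - e)))"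
      "\<And>F. F \<in> \<F> \<Longrightarrow> exp (- (x * (\<alpha> + e))) \<le> Q F"
      "\<And>F. F \<in> \<F> \<Longrightarrow> Q F \<le> exp (- (x * (\<alpha> - 3 * e)))"
      "\<And>u s. 0 \<le> s \<Longrightarrow> real (card {F \<in> \<F>. F ` K \<inter> {u..u + s} \<noteq> {}})
         \<le> N * (1 + real (k n) * c) * (s * exp (x * (1 + e)) + 1)"
      using lev by simp_all
    define C where "C = N * (1 + real (k n) * c) * ((1/2) ^ n * exp (x * (1 + e)) + 1)"
    have finF: "finite \<F>" by (rule finite_subset[OF M(2,1)])
    have count: "real (card {F \<in> \<F>. F ` K \<inter> dyadic n i \<noteq> {}}) \<le> C" for i
    proof -
      let ?u = "real_of_int i / 2 ^ n"
      have "dyadic n i \<subseteq> {?u..?u + (1/2) ^ n}"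
        unfolding dyadic_eq_atLeastLessThan by (auto simp: power_one_over add_divide_distrib)
      then have "card {F \<in> \<F>. F ` K \<inter> dyadic n i \<noteq> {}} \<le> card {F \<in> \<F>. F ` K \<inter> {?u..?u + (1/2) ^ n} \<noteq> {}}"
        using finF by (intro card_mono) auto
      then show ?thesis using M(10)[of "(1/2) ^ n" ?u] unfolding C_def by (simp add: order_trans[OF of_nat_mono])
    qed
    have "\<exists>D. finite D \<and> card D \<le> 3 * card \<F> \<and>
      (\<forall>i\<in>D. measure \<mu> (dyadic n i) \<le> 2 * (C * exp (- (x * (\<alpha> - 3 * e))))) \<and>
      1 - 2 * (5 * \<rho> ^ k n) \<le> measure \<mu> (\<Union>i\<in>D. dyadic n i)"
    proof (rule dyadic_cover[OF prob sets K M(1,2,3,4,5,6) _ M(9) _ count])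
      fix F u v assume "F \<in> \<F>" "u \<in> K" "v \<in> K"
      then have "\<bar>F u - F v\<bar> \<le> exp (- (x * (1 - e)))" by (rule M(7))
      also have "\<dots> \<le> (1/2) ^ n" unfolding half using xy by simp
      finally show "\<bar>F u - F v\<bar> \<le> (1/2) ^ n" .
    qed auto
    then obtain D where D: "finite D" "card D \<le> 3 * card \<F>"
      "\<And>i. i \<in> D \<Longrightarrow> measure \<mu> (dyadic n i) \<le> 2 * (C * exp (- (x * (\<alpha> - 3 * e))))"
      "1 - \<eta> n \<le> measure \<mu> (\<Union>i\<in>D. dyadic n i)" unfolding \<eta>_def by blast
    have "real (card D) \<le> 2 powr (real n * (\<alpha> + \<epsilon>))"
    proof -
      have "real (card \<F>) * exp (- (x * (\<alpha> + e))) = (\<Sum>F\<in>\<F>. exp (- (x * (\<alpha> + e))))" by simp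
      also have "\<dots> \<le> sum Q \<F>" using M(8) by (intro sum_mono) auto
      also have "\<dots> \<le> sum Q \<M>" using M(1,2,4) by (intro sum_mono2) auto
      also have "\<dots> = 1"
        using M(5)[of UNIV] prob_space sets_eq_imp_space_eq[OF sets] by simp
      finally have "real (card \<F>) * exp (- (x * (\<alpha> + e))) \<le> 1" .
      then have "real (card \<F>) \<le> exp (x * (\<alpha> + e))"
        unfolding exp_minus by (simp only: divide_inverse[symmetric] pos_divide_le_eq[OF exp_gt_zero] mult_1)
      then have "real (card D) \<le> 3 * exp (x * (\<alpha> + e))" using D(2) by linarith
      also have "\<dots> = exp (ln 3 + x * (\<alpha> + e))" by (simp add: exp_add)
      also have "\<dots> \<le> exp (y * (\<alpha> + \<epsilon>))"
      proof -
        \<comment> \<open>Passing from x to y divides the exponent \<alpha> + e by 1 - e. For e at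
          most 1/2 the result is at most \<alpha> + 2e(\<alpha>+1), the source of the hypothesis on
          2e(\<alpha>+1).\<close>
        have id: "(1 - e) * (\<alpha> + 2 * e * (\<alpha> + 1)) = \<alpha> + e + e * (\<alpha> + 1) * (1 - 2 * e)"
          by (simp add: algebra_simps)
        have "0 \<le> e * (\<alpha> + 1) * (1 - 2 * e)" using e \<alpha> by simp
        then have "\<alpha> + e \<le> (1 - e) * (\<alpha> + 2 * e * (\<alpha> + 1))" using id by linarith
        then have "x * (\<alpha> + e) \<le> x * ((1 - e) * (\<alpha> + 2 * e * (\<alpha> + 1)))"
          using x0 by (rule mult_left_mono)
        also have "\<dots> = x * (1 - e) * (\<alpha> + 2 * e * (\<alpha> + 1))" by (simp only: mult.assoc)
        also have "\<dots> \<le> (y + L) * (\<alpha> + 2 * e * (\<alpha> + 1))"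
          using xy \<alpha> e by (intro mult_right_mono) auto
        also have "\<dots> = y * (\<alpha> + 2 * e * (\<alpha> + 1)) + L * (\<alpha> + 2 * e * (\<alpha> + 1))"
          by (simp only: distrib_right)
        also have "L * (\<alpha> + 2 * e * (\<alpha> + 1)) \<le> 2 * L * (\<alpha> + e)"
        proof -
          have "e * \<alpha> \<le> 1/2 * \<alpha>" using e \<alpha> by (intro mult_right_mono) auto
          then have "\<alpha> + 2 * e * (\<alpha> + 1) \<le> 2 * (\<alpha> + e)" by (simp add: algebra_simps)
          from mult_left_mono[OF this, of L] L show ?thesis by simp
        qed
        finally have "ln 3 + x * (\<alpha> + e) \<le> ln 3 + 2 * L * (\<alpha> + e) + y * (\<alpha> + 2 * e * (\<alpha> + 1))"
          by simp
        also have "\<dots> \<le> y * (\<epsilon> - 2 * e * (\<alpha> + 1)) + y * (\<alpha> + 2 * e * (\<alpha> + 1))"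
          using n1[OF n'(2)] by (simp add: y_def mult.assoc)
        also have "\<dots> = y * (\<alpha> + \<epsilon>)" by (simp add: algebra_simps)
        finally show ?thesis by simp
      qed
      finally show ?thesis unfolding two .
    qed
    moreover have "measure \<mu> (dyadic n i) \<le> 2 powr (- (real n * (\<alpha> - \<epsilon>)))" if "i \<in> D" for i
    proof -
      have a1: "1 + real (k n) * c \<le> (1 + c / (L * e)) * exp (x * e)"
      proof -
        have exp: "1 \<le> exp (x * e)" "x * e \<le> exp (x * e)"
          using exp_ge_add_one_self[of "x * e"] mult_nonneg_nonneg[OF x0 less_imp_le[OF e(1)]]
          by linarith+
        have "real (k n) * c = c / (L * e) * (x * e)" using L e by (simp add: x_def)
        also have "\<dots> \<le> c / (L * e) * exp (x * e)"
          using c L e exp by (intro mult_left_mono) auto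
        finally show ?thesis using exp(1) by (simp only: distrib_right mult_1 add_mono)
      qed
      have a2: "(1/2) ^ n * exp (x * (1 + e)) + 1 \<le> 2 * exp (2 * x * e + L)"
      proof -
        have "(1/2) ^ n * exp (x * (1 + e)) = exp (x * (1 + e) - y)"
          unfolding half by (simp add: exp_diff exp_minus field_simps)
        also have "\<dots> \<le> exp (2 * x * e + L)" using xy by (simp add: algebra_simps)
        finally show ?thesis using x0 e L by (smt (verit) mult_nonneg_nonneg one_le_exp_iff)
      qed
      have "measure \<mu> (dyadic n i) \<le> 2 * (C * exp (- (x * (\<alpha> - 3 * e))))" by (rule D(3)[OF that])
      also have "\<dots> \<le> 2 * (N * ((1 + c / (L * e)) * exp (x * e)) * (2 * exp (2 * x * e + L)) * exp (- (x * (\<alpha> - 3 * e))))"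
        unfolding C_def using a1 a2 N c L e
        by (intro mult_left_mono mult_right_mono mult_mono) auto
      also have "\<dots> = C3 * (exp (x * e) * exp (2 * x * e) * exp (- (x * (\<alpha> - 3 * e))))"
        by (simp add: C3_def exp_add)
      \<comment> \<open>The 6e is made of e for the factor 1 + kc, 2e for the spread of scales and
        3e for the weight bound. As x is at most 2y + 2L it becomes 12e in terms of y, the source of
        the hypothesis on 12e.\<close>
      also have "\<dots> = C3 * exp (6 * e * x - x * \<alpha>)"
        by (simp add: mult_exp_exp algebra_simps)
      also have "\<dots> \<le> C3 * exp (6 * e * (2 * y + 2 * L) - y * \<alpha>)"
      proof -
        have "6 * e * x \<le> 6 * e * (2 * y + 2 * L)" using x2 e by (intro mult_left_mono) auto
        moreover have "y * \<alpha> \<le> x * \<alpha>" using yx \<alpha> by (intro mult_right_mono)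
        ultimately show ?thesis using C3 by simp
      qed
      also have "\<dots> = exp (ln C3 + 12 * e * L + 12 * e * y - y * \<alpha>)"
        using C3 by (simp add: exp_add exp_diff algebra_simps)
      also have "\<dots> \<le> exp (- (y * (\<alpha> - \<epsilon>)))"
        using n2[OF n'(3)] by (simp add: y_def algebra_simps)
      also have "\<dots> = 2 powr (- (real n * (\<alpha> - \<epsilon>)))"
        using two[of "- (\<alpha> - \<epsilon>)"] by (simp only: mult_minus_right)
      finally show ?thesis .
    qed
    ultimately show ?thesis using D by blast
  qed
  define P where "P n D \<longleftrightarrow> finite D \<and> real (card D) \<le> 2 powr (real n * (\<alpha> + \<epsilon>)) \<and>
      (\<forall>i\<in>D. measure \<mu> (dyadic n i) \<le> 2 powr (- (real n * (\<alpha> - \<epsilon>)))) \<and>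
      1 - \<eta> n \<le> measure \<mu> (\<Union>i\<in>D. dyadic n i)" for n D
  have "\<forall>n. \<exists>D. n \<ge> Max {1, n1, n2} \<longrightarrow> P n D" using main unfolding P_def by blast
  then obtain D where "\<And>n. n \<ge> Max {1, n1, n2} \<Longrightarrow> P n (D n)" by metis
  then show ?thesis unfolding concentrated_def P_def using \<open>summable \<eta>\<close> by blast
qed

text \<open>At a late level both families carry more than 3/4 of the mass, so their common cells
  carry at least 1/2. There are at most 2^(n(\<alpha>+\<epsilon>)) of these, each of mass at most
  2^(-n(\<alpha>'-\<epsilon>')); a larger \<alpha>' would force their total down to 1/4.\<close>

lemma concentrated_unique:
  assumes prob: "prob_space \<mu>" and sets: "sets \<mu> = sets borel"
    and 1: "concentrated \<mu> \<alpha> \<epsilon>" and 2: "concentrated \<mu> \<alpha>' \<epsilon>'"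
  shows "\<alpha>' \<le> \<alpha> + \<epsilon> + \<epsilon>'"
proof (rule ccontr)
  assume "\<not> \<alpha>' \<le> \<alpha> + \<epsilon> + \<epsilon>'"
  define \<kappa> where "\<kappa> = \<alpha>' - \<alpha> - \<epsilon> - \<epsilon>'"
  have \<kappa>: "0 < \<kappa>" using \<open>\<not> \<alpha>' \<le> \<alpha> + \<epsilon> + \<epsilon>'\<close> by (simp add: \<kappa>_def)
  interpret prob_space \<mu> by fact
  obtain \<eta> D n0 where D: "summable \<eta>" "\<And>n. n \<ge> n0 \<Longrightarrow> finite (D n)"
    "\<And>n. n \<ge> n0 \<Longrightarrow> real (card (D n)) \<le> 2 powr (real n * (\<alpha> + \<epsilon>))"
    "\<And>n. n \<ge> n0 \<Longrightarrow> 1 - \<eta> n \<le> measure \<mu> (\<Union>i\<in>D n. dyadic n i)"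
    using 1 unfolding concentrated_def by blast
  obtain \<eta>' D' n0' where D': "summable \<eta>'" "\<And>n. n \<ge> n0' \<Longrightarrow> finite (D' n)"
    "\<And>n i. n \<ge> n0' \<Longrightarrow> i \<in> D' n \<Longrightarrow> measure \<mu> (dyadic n i) \<le> 2 powr (- (real n * (\<alpha>' - \<epsilon>')))"
    "\<And>n. n \<ge> n0' \<Longrightarrow> 1 - \<eta>' n \<le> measure \<mu> (\<Union>i\<in>D' n. dyadic n i)"
    using 2 unfolding concentrated_def by blast
  have "\<forall>\<^sub>F n in sequentially. \<eta> n < 1/4" "\<forall>\<^sub>F n in sequentially. \<eta>' n < 1/4"
    using order_tendstoD(2)[OF summable_LIMSEQ_zero[OF D(1)], of "1/4"]
      order_tendstoD(2)[OF summable_LIMSEQ_zero[OF D'(1)], of "1/4"] by auto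
  moreover obtain n1 where n1: "\<And>n. n \<ge> n1 \<Longrightarrow> 2 \<le> real n * \<kappa>"
    using eventually_le_linear[OF \<kappa>] by blast
  ultimately have "\<forall>\<^sub>F n in sequentially. \<eta> n < 1/4 \<and> \<eta>' n < 1/4 \<and> n \<ge> n0 \<and> n \<ge> n0' \<and> n \<ge> n1"
    by (auto simp: eventually_conj_iff eventually_ge_at_top)
  then obtain n where n: "\<eta> n < 1/4" "\<eta>' n < 1/4" "n \<ge> n0" "n \<ge> n0'" "n \<ge> n1"
    unfolding eventually_sequentially by blast
  let ?A = "\<Union>i\<in>D n. dyadic n i" and ?B = "\<Union>i\<in>D' n. dyadic n i"
  have AB: "?A \<in> sets \<mu>" "?B \<in> sets \<mu>" using D(2)[OF n(3)] D'(2)[OF n(4)] sets by auto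
  have sub: "?A \<inter> ?B \<subseteq> (\<Union>i\<in>D n \<inter> D' n. dyadic n i)" by (auto simp: dyadic_def)
  have "measure \<mu> (?A \<union> ?B) + measure \<mu> (?A \<inter> ?B) = measure \<mu> ?A + measure \<mu> ?B"
    using finite_measure_Union'[OF AB] finite_measure_Diff'[OF AB(2,1)] by (simp add: Int_commute)
  then have "1/2 \<le> measure \<mu> (?A \<inter> ?B)"
    using D(4)[OF n(3)] D'(4)[OF n(4)] n(1,2) prob_le_1[of "?A \<union> ?B"] by linarith
  moreover have "measure \<mu> (?A \<inter> ?B) \<le> measure \<mu> (\<Union>i\<in>D n \<inter> D' n. dyadic n i)"
    by (rule finite_measure_mono[OF sub], rule sets.finite_UN) (use D(2)[OF n(3)] sets in simp_all)
  moreover have "measure \<mu> (\<Union>i\<in>D n \<inter> D' n. dyadic n i) \<le> (\<Sum>i\<in>D n \<inter> D' n. measure \<mu> (dyadic n i))"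
  proof (rule finite_measure_subadditive_finite)
    show "finite (D n \<inter> D' n)" using D(2)[OF n(3)] by simp
    show "dyadic n ` (D n \<inter> D' n) \<subseteq> sets \<mu>" unfolding sets by (simp add: image_subset_iff)
  qed
  moreover have "(\<Sum>i\<in>D n \<inter> D' n. measure \<mu> (dyadic n i)) \<le> (\<Sum>i\<in>D n \<inter> D' n. 2 powr (- (real n * (\<alpha>' - \<epsilon>'))))"
    using D'(3)[OF n(4)] by (intro sum_mono) auto
  moreover have "(\<Sum>i\<in>D n \<inter> D' n. 2 powr (- (real n * (\<alpha>' - \<epsilon>'))))
      \<le> real (card (D n)) * 2 powr (- (real n * (\<alpha>' - \<epsilon>')))"
    using D(2)[OF n(3)] by (simp add: mult_right_mono card_mono)
  moreover have "real (card (D n)) * 2 powr (- (real n * (\<alpha>' - \<epsilon>')))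
      \<le> 2 powr (real n * (\<alpha> + \<epsilon>)) * 2 powr (- (real n * (\<alpha>' - \<epsilon>')))"
    using D(3)[OF n(3)] by (intro mult_right_mono) auto
  moreover have "2 powr (real n * (\<alpha> + \<epsilon>)) * 2 powr (- (real n * (\<alpha>' - \<epsilon>'))) = 2 powr (- (real n * \<kappa>))"
    by (simp add: powr_add[symmetric] \<kappa>_def algebra_simps)
  moreover have "2 powr (- (real n * \<kappa>)) \<le> 2 powr (- 2)" using n1[OF n(5)] by (intro powr_mono) auto
  moreover have "2 powr (- 2) = (1/4::real)" by (simp add: powr_minus powr_numeral)
  ultimately show False by linarith
qed

lemma concentrated_mono:
  assumes "concentrated \<mu> \<alpha> \<epsilon>" "\<bar>\<alpha> - \<beta>\<bar> + \<epsilon> \<le> \<epsilon>'"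
  shows "concentrated \<mu> \<beta> \<epsilon>'"
proof -
  have a: "2 powr (real n * (\<alpha> + \<epsilon>)) \<le> 2 powr (real n * (\<beta> + \<epsilon>'))" for n
    using assms(2) by (intro powr_mono mult_left_mono) auto
  have "real n * (\<beta> - \<epsilon>') \<le> real n * (\<alpha> - \<epsilon>)" for n
    using assms(2) by (intro mult_left_mono) auto
  then have b: "2 powr (- (real n * (\<alpha> - \<epsilon>))) \<le> 2 powr (- (real n * (\<beta> - \<epsilon>')))" for n
    by (intro powr_mono) auto
  show ?thesis using assms(1) unfolding concentrated_def by (meson a b order_trans)
qed

text \<open>Removes the dependence of the exponent on \<epsilon>. Uniqueness, used in both
  directions, gives \<bar>a i - a j\<bar> at most e i + e j; the limit of this Cauchy sequence is
  close enough to a late member to inherit its concentration.\<close>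

lemma concentrated_all_scales:
  assumes prob: "prob_space \<mu>" and sets: "sets \<mu> = sets borel"
    and ex: "\<And>\<epsilon>. 0 < \<epsilon> \<Longrightarrow> \<exists>\<alpha>\<ge>0. concentrated \<mu> \<alpha> \<epsilon>"
  shows "\<exists>\<alpha>\<ge>0. \<forall>\<epsilon>>0. concentrated \<mu> \<alpha> \<epsilon>"
proof -
  define e where "e j = 1 / (real j + 1)" for j
  have e: "0 < e j" for j by (simp add: e_def)
  have "\<forall>j. \<exists>\<alpha>\<ge>0. concentrated \<mu> \<alpha> (e j)" using ex e by blast
  then obtain a where a: "\<And>j. 0 \<le> a j" "\<And>j. concentrated \<mu> (a j) (e j)" by metis
  have close: "\<bar>a i - a j\<bar> \<le> e i + e j" for i j
    using concentrated_unique[OF prob sets a(2)[of i] a(2)[of j]]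
      concentrated_unique[OF prob sets a(2)[of j] a(2)[of i]] by linarith
  have small: "\<exists>M. \<forall>j\<ge>M. e j < \<epsilon>" if \<epsilon>: "0 < \<epsilon>" for \<epsilon>
  proof -
    obtain M :: nat where M: "1 / \<epsilon> < real M" using reals_Archimedean2 by blast
    have "e j < \<epsilon>" if "j \<ge> M" for j
    proof -
      have "1 / \<epsilon> < real j + 1" using M that by linarith
      then show ?thesis using \<epsilon> unfolding e_def by (simp add: field_simps)
    qed
    then show ?thesis by blast
  qed
  have "Cauchy a"
  proof (rule metric_CauchyI)
    fix \<epsilon> :: real assume "0 < \<epsilon>"
    then obtain M where M: "\<And>j. j \<ge> M \<Longrightarrow> e j < \<epsilon> / 2" using small[of "\<epsilon> / 2"] by auto
    have "dist (a i) (a j) < \<epsilon>" if "i \<ge> M" "j \<ge> M" for i j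
      using close[of i j] M[OF that(1)] M[OF that(2)] by (simp add: dist_real_def)
    then show "\<exists>M. \<forall>i\<ge>M. \<forall>j\<ge>M. dist (a i) (a j) < \<epsilon>" by blast
  qed
  then obtain \<alpha> where lim: "a \<longlonglongrightarrow> \<alpha>" using Cauchy_convergent convergentD by blast
  have "0 \<le> \<alpha>" using lim a(1) by (intro LIMSEQ_le_const) auto
  moreover have "concentrated \<mu> \<alpha> \<epsilon>" if "0 < \<epsilon>" for \<epsilon>
  proof -
    obtain M1 where M1: "\<And>j. j \<ge> M1 \<Longrightarrow> e j < \<epsilon> / 2" using small[OF half_gt_zero[OF \<open>0 < \<epsilon>\<close>]] by blast
    obtain M2 where M2: "\<And>j. j \<ge> M2 \<Longrightarrow> \<bar>a j - \<alpha>\<bar> < \<epsilon> / 2"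
      using LIMSEQ_D[OF lim half_gt_zero[OF \<open>0 < \<epsilon>\<close>]] by auto
    show ?thesis
      using concentrated_mono[OF a(2)[of "max M1 M2"], of \<alpha> \<epsilon>] M1[of "max M1 M2"] M2[of "max M1 M2"] by simp
  qed
  ultimately show ?thesis by blast
qed

section \<open>Self-similar measures under weak separation\<close>

lemma word_map_eq_compose_list: "word_map r d \<sigma> = compose_list (map (sim r d) \<sigma>)"
  by (induction \<sigma>) auto

lemma word_ratio_simps [simp]:
  "word_ratio r [] = 1" "word_ratio r (i # \<sigma>) = r i * word_ratio r \<sigma>"
  "word_ratio r (\<sigma> @ \<tau>) = word_ratio r \<sigma> * word_ratio r \<tau>"
  by (simp_all add: word_ratio_def)

lemma word_map_affine: "word_map r d \<sigma> x = word_ratio r \<sigma> * x + word_map r d \<sigma> 0"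
proof (induction \<sigma>)
  case (Cons i \<sigma>)
  have "word_map r d (i # \<sigma>) x = r i * word_map r d \<sigma> x + d i" by (simp add: sim_def)
  also have "\<dots> = r i * (word_ratio r \<sigma> * x + word_map r d \<sigma> 0) + d i" by (simp only: Cons.IH[symmetric])
  finally show ?case by (simp add: sim_def algebra_simps)
qed simp

lemma word_map_diff: "word_map r d \<sigma> x - word_map r d \<sigma> y = word_ratio r \<sigma> * (x - y)"
  using word_map_affine[of r d \<sigma> x] word_map_affine[of r d \<sigma> y] by (simp add: algebra_simps)

lemma word_map_append: "word_map r d (\<sigma> @ \<tau>) = word_map r d \<sigma> \<circ> word_map r d \<tau>"
  by (induction \<sigma>) (auto simp: fun_eq_iff)

lemma word_map_measurable [measurable]: "word_map r d \<sigma> \<in> borel_measurable borel"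
proof -
  have "(\<lambda>x. word_ratio r \<sigma> * x + word_map r d \<sigma> 0) \<in> borel_measurable borel" by measurable
  then show ?thesis by (simp only: word_map_affine[symmetric])
qed

text \<open>The contraction ratio read off from the map itself, so that it is defined for a block
  map without a choice of word.\<close>

definition slope :: "(real \<Rightarrow> real) \<Rightarrow> real" where
  "slope F = \<bar>F 1 - F 0\<bar>"

lemma slope_word_map [simp]: "slope (word_map r d \<sigma>) = \<bar>word_ratio r \<sigma>\<bar>"
  by (simp add: slope_def word_map_diff)

locale wsc_ifs = prob_space \<mu> for \<mu> :: "real measure" +
  fixes I :: "'i set" and r d p :: "'i \<Rightarrow> real" and K :: "real set"
  assumes ifs: "similarity_ifs I r"
    and attractor: "is_attractor I r d K"
    and hull: "convex hull K = {0..1}"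
    and wsc: "weak_separation I r d K"
    and p: "probability_vector I p"
    and self_similar: "is_self_similar_measure I r d p \<mu>"
begin

lemma finite_I: "finite I" and I_nonempty: "I \<noteq> {}"
  using ifs by (auto simp: similarity_ifs_def)

lemma sets_mu: "sets \<mu> = sets borel"
  using self_similar by (simp add: is_self_similar_measure_def)

lemma K_compact: "compact K" and K_nonempty: "K \<noteq> {}"
  using attractor by (auto simp: is_attractor_def)

lemma K_borel: "K \<in> sets borel"
  using K_compact by (rule borel_compact)

lemma sim_in_K: "i \<in> I \<Longrightarrow> x \<in> K \<Longrightarrow> sim r d i x \<in> K"
  using attractor unfolding is_attractor_def by blast

lemma K_dist_le_1:
  assumes "x \<in> K" "y \<in> K"
  shows "\<bar>x - y\<bar> \<le> 1"
proof -
  have "x \<in> {0..1}" "y \<in> {0..1}" using hull_subset[of K convex] hull assms by auto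
  then show ?thesis by auto
qed

section \<open>Uniform bounds on ratios and weights, and the mass of K\<close>

definition rmax :: real where "rmax = Max ((\<lambda>i. \<bar>r i\<bar>) ` I)"
definition rmin :: real where "rmin = Min ((\<lambda>i. \<bar>r i\<bar>) ` I)"
definition pmin :: real where "pmin = Min (p ` I)"

lemma rmax: "0 < rmax" "rmax < 1" "i \<in> I \<Longrightarrow> \<bar>r i\<bar> \<le> rmax"
  and rmin: "0 < rmin" "i \<in> I \<Longrightarrow> rmin \<le> \<bar>r i\<bar>"
proof -
  have r: "0 < \<bar>r i\<bar>" "\<bar>r i\<bar> < 1" if "i \<in> I" for i using ifs that by (auto simp: similarity_ifs_def)
  have "rmax \<in> (\<lambda>i. \<bar>r i\<bar>) ` I" "rmin \<in> (\<lambda>i. \<bar>r i\<bar>) ` I"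
    unfolding rmax_def rmin_def using finite_I I_nonempty by (auto intro!: Max_in Min_in)
  then show "0 < rmax" "rmax < 1" "0 < rmin" using r by auto
  show "i \<in> I \<Longrightarrow> \<bar>r i\<bar> \<le> rmax" "i \<in> I \<Longrightarrow> rmin \<le> \<bar>r i\<bar>"
    unfolding rmax_def rmin_def using finite_I by auto
qed

lemma rmin_le_rmax: "rmin \<le> rmax"
  using I_nonempty rmin(2) rmax(3) by force

lemma p_pos: "i \<in> I \<Longrightarrow> 0 < p i" and p_sum: "(\<Sum>i\<in>I. p i) = 1"
  using p by (auto simp: probability_vector_def)

lemma pmin: "0 < pmin" "i \<in> I \<Longrightarrow> pmin \<le> p i" "pmin \<le> 1"
proof -
  have "pmin \<in> p ` I" unfolding pmin_def using finite_I I_nonempty by (auto intro!: Min_in)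
  then obtain j where j: "j \<in> I" "pmin = p j" by auto
  then show "0 < pmin" using p_pos by auto
  show "i \<in> I \<Longrightarrow> pmin \<le> p i" unfolding pmin_def using finite_I by auto
  have "p j \<le> (\<Sum>i\<in>I. p i)" using j finite_I p_pos by (intro member_le_sum) (auto intro: less_imp_le)
  then show "pmin \<le> 1" using j p_sum by simp
qed

lemma word_ratio_bounds:
  assumes "set \<sigma> \<subseteq> I"
  shows "rmin ^ length \<sigma> \<le> \<bar>word_ratio r \<sigma>\<bar>" "\<bar>word_ratio r \<sigma>\<bar> \<le> rmax ^ length \<sigma>"
proof -
  have "rmin ^ length \<sigma> \<le> \<bar>word_ratio r \<sigma>\<bar> \<and> \<bar>word_ratio r \<sigma>\<bar> \<le> rmax ^ length \<sigma>"
    using assms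
  proof (induction \<sigma>)
    case (Cons i \<sigma>)
    then show ?case using rmin rmax by (auto simp: abs_mult intro!: mult_mono)
  qed simp
  then show "rmin ^ length \<sigma> \<le> \<bar>word_ratio r \<sigma>\<bar>" "\<bar>word_ratio r \<sigma>\<bar> \<le> rmax ^ length \<sigma>" by auto
qed

lemma word_ratio_nonzero: "set \<sigma> \<subseteq> I \<Longrightarrow> 0 < \<bar>word_ratio r \<sigma>\<bar>"
  using word_ratio_bounds(1)[of \<sigma>] rmin(1) by (metis less_le_trans zero_less_power)

lemma inj_word_map: "set \<sigma> \<subseteq> I \<Longrightarrow> inj (word_map r d \<sigma>)"
  using word_ratio_nonzero[of \<sigma>] word_map_diff[of r d \<sigma>]
  by (intro injI) (metis abs_zero eq_iff_diff_eq_0 less_irrefl mult_eq_0_iff)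

lemma word_map_in_K: "set \<sigma> \<subseteq> I \<Longrightarrow> x \<in> K \<Longrightarrow> word_map r d \<sigma> x \<in> K"
  by (induction \<sigma>) (auto intro: sim_in_K)

text \<open>The mass outside the R-neighbourhood of K does not decrease when R is replaced by R / rmax.\<close>

lemma measure_K: "measure \<mu> K = 1"
proof -
  define V where "V R = {x. R < infdist x K}" for R :: real
  have V: "V R \<in> sets \<mu>" for R
  proof -
    have "open (V R)" unfolding V_def by (intro open_Collect_less continuous_intros)
    then show ?thesis using sets_mu by simp
  qed
  have sim_V: "sim r d i -` V R \<subseteq> V (R / rmax)" if "i \<in> I" for i R
  proof
    fix x assume "x \<in> sim r d i -` V R"
    then have x: "R < infdist (sim r d i x) K" by (simp add: V_def)
    obtain y where y: "y \<in> K" "infdist x K = dist x y"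
      using infdist_attains_inf[OF compact_imp_closed[OF K_compact] K_nonempty] by metis
    have "infdist (sim r d i x) K \<le> dist (sim r d i x) (sim r d i y)"
      using sim_in_K[OF that y(1)] by (rule infdist_le)
    also have "\<dots> = \<bar>r i\<bar> * infdist x K"
      unfolding y(2) by (simp add: sim_def dist_real_def abs_mult flip: right_diff_distrib)
    also have "\<dots> \<le> rmax * infdist x K" using rmax(3)[OF that] infdist_nonneg by (rule mult_right_mono)
    finally have "R < rmax * infdist x K" using x by linarith
    then show "x \<in> V (R / rmax)" using rmax(1) by (simp add: V_def field_simps)
  qed
  have step: "measure \<mu> (V R) \<le> measure \<mu> (V (R / rmax))" for R
  proof -
    have "measure \<mu> (V R) = (\<Sum>i\<in>I. p i * measure \<mu> (sim r d i -` V R))"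
      using self_similar V[of R] sets_mu unfolding is_self_similar_measure_def by auto
    also have "\<dots> \<le> (\<Sum>i\<in>I. p i * measure \<mu> (V (R / rmax)))"
      using sim_V V p_pos by (intro sum_mono mult_left_mono finite_measure_mono) (auto intro: less_imp_le)
    also have "\<dots> = measure \<mu> (V (R / rmax))" by (simp add: p_sum flip: sum_distrib_right)
    finally show ?thesis .
  qed
  \<comment> \<open>Iterating \<open>step\<close> sends the radius to infinity, where the
    neighbourhood complements decrease to the empty set.\<close>
  have zero: "measure \<mu> (V R) = 0" if "0 < R" for R
  proof -
    have le: "measure \<mu> (V R) \<le> measure \<mu> (V (R / rmax ^ n))" for n
    proof (induction n)
      case (Suc n)
      then show ?case using step[of "R / rmax ^ n"] by (simp add: mult.commute)
    qed simp
    have dec: "decseq (\<lambda>n. V (R / rmax ^ n))"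
    proof (rule decseq_SucI)
      fix n
      have "rmax ^ Suc n \<le> rmax ^ n" using rmax by (intro power_decreasing) auto
      then have "R / rmax ^ n \<le> R / rmax ^ Suc n"
        using rmax \<open>0 < R\<close> by (intro divide_left_mono) auto
      then show "V (R / rmax ^ Suc n) \<subseteq> V (R / rmax ^ n)" by (auto simp: V_def)
    qed
    have "(\<lambda>n. measure \<mu> (V (R / rmax ^ n))) \<longlonglongrightarrow> measure \<mu> (\<Inter>n. V (R / rmax ^ n))"
      using V dec by (intro finite_Lim_measure_decseq) auto
    moreover have "(\<Inter>n. V (R / rmax ^ n)) = {}"
    proof (rule ccontr)
      assume "(\<Inter>n. V (R / rmax ^ n)) \<noteq> {}"
      then obtain x where x: "\<And>n. R / rmax ^ n < infdist x K" by (auto simp: V_def)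
      have pos: "0 < infdist x K" using x[of 0] \<open>0 < R\<close> by simp
      obtain n where "rmax ^ n < R / infdist x K"
        using real_arch_pow_inv[of "R / infdist x K" rmax] pos \<open>0 < R\<close> rmax by auto
      then have "infdist x K < R / rmax ^ n" using pos rmax by (simp add: field_simps)
      then show False using x[of n] by simp
    qed
    ultimately have "measure \<mu> (V R) \<le> 0" using le by (intro LIMSEQ_le_const) auto
    then show ?thesis by (simp add: measure_le_0_iff)
  qed
  have "space \<mu> - K \<subseteq> (\<Union>n. V (1 / (real n + 1)))"
  proof
    fix x assume "x \<in> space \<mu> - K"
    then have "0 < infdist x K"
      using infdist_pos_not_in_closed[OF compact_imp_closed[OF K_compact] K_nonempty, of x] by auto
    then obtain n where "1 / (real n + 1) < infdist x K"
      using nat_approx_posE[of "infdist x K"] by (metis of_nat_Suc add.commute)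
    then show "x \<in> (\<Union>n. V (1 / (real n + 1)))" by (auto simp: V_def)
  qed
  then have "measure \<mu> (space \<mu> - K) \<le> measure \<mu> (\<Union>n. V (1 / (real n + 1)))"
    using V by (intro finite_measure_mono) auto
  also have "\<dots> \<le> 0"
    by (rule measure_UN_le) (simp_all add: V zero)
  finally show ?thesis using prob_compl[of K] K_borel sets_mu prob_le_1[of K] by simp
qed

definition l0 :: real where "l0 = - ln rmax"

lemma l0_pos: "0 < l0"
  using rmax by (simp add: l0_def)

text \<open>Every word with ratio at least a lies in \<^const>\<open>Lambda\<close> for some scale \<open>t = rmax ^ j \<ge> a\<close>, and there are
  only about \<open>ln a / ln rmax\<close> such scales.\<close>

lemma card_maps_near_interval:
  obtains N :: real where "0 < N"
    "\<And>a u s \<S>. 0 < a \<Longrightarrow> a \<le> 1 \<Longrightarrow> 0 \<le> s \<Longrightarrow>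
       \<S> \<subseteq> {word_map r d \<sigma> |\<sigma>. set \<sigma> \<subseteq> I \<and> \<sigma> \<noteq> [] \<and> a \<le> \<bar>word_ratio r \<sigma>\<bar> \<and>
              word_map r d \<sigma> ` K \<inter> {u..u + s} \<noteq> {}} \<Longrightarrow>
       real (card \<S>) \<le> N * (1 + (- ln a) / l0) * (s / a + 1)"
proof -
  obtain N0 :: nat where N0: "\<And>x t. 0 < t \<Longrightarrow> finite (level_maps I r d K t (ball x t))"
    "\<And>x t. 0 < t \<Longrightarrow> card (level_maps I r d K t (ball x t)) \<le> N0"
    using wsc unfolding weak_separation_def by blast
  \<comment> \<open>\<open>Suc N0\<close> in place of \<open>N0\<close> makes the constant
    positive.\<close>
  have "real (card \<S>) \<le> real (Suc N0) * (1 + (- ln a) / l0) * (s / a + 1)"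
    if a: "0 < a" "a \<le> 1" and s: "0 \<le> s" and \<S>: "\<S> \<subseteq> {word_map r d \<sigma> |\<sigma>. set \<sigma> \<subseteq> I \<and> \<sigma> \<noteq> [] \<and> a \<le> \<bar>word_ratio r \<sigma>\<bar> \<and>
              word_map r d \<sigma> ` K \<inter> {u..u + s} \<noteq> {}}" for a u s \<S>
  proof -
    define J where "J = {..nat \<lfloor>(- ln a) / l0\<rfloor>}"
    define T where "T = {..nat \<lfloor>s / a\<rfloor>}"
    \<comment> \<open>At scale t = \<open>rmax ^ j\<close> the interval is covered by balls of
      radius t centred at u, u + t, u + 2t and so on. Every relevant scale exceeds a, so the indices
      up to s/a in T suffice for all of them.\<close>
    define X where "X j i = level_maps I r d K (rmax ^ j) (ball (u + real i * rmax ^ j) (rmax ^ j))" for j i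
    have X: "finite (X j i)" "card (X j i) \<le> N0" for j i
      unfolding X_def using N0 rmax(1) by auto
    have "\<S> \<subseteq> (\<Union>j\<in>J. \<Union>i\<in>T. X j i)"
    proof
      fix f assume "f \<in> \<S>"
      then obtain \<sigma> y where \<sigma>: "f = word_map r d \<sigma>" "set \<sigma> \<subseteq> I" "\<sigma> \<noteq> []" "a \<le> \<bar>word_ratio r \<sigma>\<bar>"
        and y: "y \<in> f ` K" "u \<le> y" "y \<le> u + s"
        using \<S> by fastforce
      define q where "q = \<bar>word_ratio r (butlast \<sigma>)\<bar>"
      have \<sigma>': "\<sigma> = butlast \<sigma> @ [last \<sigma>]" using \<sigma>(3) by simp
      have I': "set (butlast \<sigma>) \<subseteq> I" "last \<sigma> \<in> I" using \<sigma>(2,3) by (auto dest: in_set_butlastD)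
      have q: "0 < q" unfolding q_def using I' by (intro word_ratio_nonzero)
      have eq: "\<bar>word_ratio r \<sigma>\<bar> = q * \<bar>r (last \<sigma>)\<bar>"
        unfolding q_def by (subst \<sigma>') (simp only: word_ratio_simps abs_mult mult_1_right)
      \<comment> \<open>The scale is fitted to the parent of \<sigma>: its ratio q reaches
        \<open>rmax ^ j\<close>, and by minimality of j the last letter, contracting by
        \<open>rmax\<close> or more, takes the ratio strictly below. For j = 0 this needs \<sigma>
        nonempty.\<close>
      define j where "j = (LEAST j. rmax ^ j \<le> q)"
      have "\<exists>j. rmax ^ j \<le> q" using real_arch_pow_inv[OF q rmax(2)] by (auto intro: less_imp_le)
      then have j1: "rmax ^ j \<le> q" unfolding j_def by (rule LeastI_ex)
      have j2: "\<bar>word_ratio r \<sigma>\<bar> < rmax ^ j"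
      proof (cases j)
        case 0
        have "\<bar>word_ratio r \<sigma>\<bar> \<le> rmax ^ length \<sigma>" using \<sigma> by (intro word_ratio_bounds)
        also have "\<dots> < 1" using rmax \<sigma> by (intro power_less_one_iff[THEN iffD2]) auto
        finally show ?thesis using 0 by simp
      next
        case (Suc j')
        then have "\<not> rmax ^ j' \<le> q" using not_less_Least[of j' "\<lambda>j. rmax ^ j \<le> q"] by (simp add: j_def)
        then have "q * rmax < rmax ^ j" using Suc rmax by simp
        moreover have "q * \<bar>r (last \<sigma>)\<bar> \<le> q * rmax" using rmax(3)[OF I'(2)] q by simp
        ultimately show ?thesis unfolding eq by linarith
      qed
      have aj: "a < rmax ^ j" using \<sigma> j2 by linarith
      then have "ln a < ln (rmax ^ j)" using a rmax by simp
      also have "ln (rmax ^ j) = real j * ln rmax" using rmax by (simp add: ln_realpow)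
      finally have "real j \<le> (- ln a) / l0" using l0_pos by (simp add: field_simps l0_def)
      then have jJ: "j \<in> J" unfolding J_def by (simp add: le_nat_floor)
      define i where "i = nat \<lfloor>(y - u) / rmax ^ j\<rfloor>"
      have t: "0 < rmax ^ j" using rmax by simp
      have nn: "0 \<le> (y - u) / rmax ^ j" using y t by (intro divide_nonneg_pos) auto
      have i1: "real i \<le> (y - u) / rmax ^ j" "(y - u) / rmax ^ j < real i + 1"
        unfolding i_def using nn by linarith+
      have "(y - u) / rmax ^ j \<le> s / a" using y a aj s by (intro frac_le) auto
      then have iT: "i \<in> T" using i1 unfolding T_def by (simp add: le_nat_floor)
      have "real i * rmax ^ j \<le> y - u" "y - u < (real i + 1) * rmax ^ j"
        using i1 t by (auto simp: pos_le_divide_eq pos_divide_less_eq)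
      then have "y \<in> ball (u + real i * rmax ^ j) (rmax ^ j)"
        using t by (auto simp: dist_real_def abs_if algebra_simps)
      moreover have "\<sigma> \<in> Lambda I r (rmax ^ j)"
        unfolding Lambda_def using \<sigma> j1 j2 by (auto simp: q_def)
      ultimately have "f \<in> X j i"
        unfolding X_def level_maps_def using \<sigma>(1) y(1) by blast
      then show "f \<in> (\<Union>j\<in>J. \<Union>i\<in>T. X j i)" using jJ iT by blast
    qed
    then have "card \<S> \<le> card (\<Union>j\<in>J. \<Union>i\<in>T. X j i)"
      using X by (intro card_mono) (auto simp: J_def T_def)
    also have "\<dots> \<le> (\<Sum>j\<in>J. card (\<Union>i\<in>T. X j i))" by (rule card_UN_le) (simp add: J_def)
    also have "\<dots> \<le> (\<Sum>j\<in>J. \<Sum>i\<in>T. card (X j i))"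
      by (intro sum_mono card_UN_le) (simp add: T_def)
    also have "\<dots> \<le> (\<Sum>j\<in>J. \<Sum>i\<in>T. Suc N0)"
      using X(2) by (intro sum_mono) (simp add: le_SucI)
    also have "\<dots> = card J * card T * Suc N0" by (simp only: sum_constant of_nat_id mult.assoc)
    finally have "real (card \<S>) \<le> real (card J * card T * Suc N0)" by (rule of_nat_mono)
    also have "\<dots> = real (card J) * real (card T) * real (Suc N0)" by (simp only: of_nat_mult)
    also have "\<dots> \<le> (1 + (- ln a) / l0) * (s / a + 1) * real (Suc N0)"
    proof (intro mult_right_mono mult_mono)
      have "ln a \<le> 0" using a by simp
      then have n1: "0 \<le> (- ln a) / l0" using l0_pos by (intro divide_nonneg_pos) auto
      then show "real (card J) \<le> 1 + (- ln a) / l0" unfolding J_def card_atMost by linarith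
      show "0 \<le> 1 + (- ln a) / l0" using n1 by simp
      have "0 \<le> s / a" using s a by simp
      then show "real (card T) \<le> s / a + 1" unfolding T_def card_atMost by linarith
    qed auto
    finally show ?thesis by (simp only: mult.assoc mult.commute mult.left_commute)
  qed
  then show ?thesis by (rule that[rotated]) simp_all
qed

section \<open>The random walk on block maps and its exponent\<close>

lemma compose_list_word_maps:
  assumes "G \<in> words (word_map r d ` words I m) k"
  shows "\<exists>\<sigma>\<in>words I (k * m). compose_list G = word_map r d \<sigma> \<and>
    - ln (slope (compose_list G)) = sum_list (map (\<lambda>g. - ln (slope g)) G)"
  using assms
proof (induction k arbitrary: G)
  case 0
  then show ?case by (auto simp: slope_def fun_eq_iff)
next
  case (Suc k)
  then obtain \<tau> G' where G: "G = word_map r d \<tau> # G'" "\<tau> \<in> words I m" "G' \<in> words (word_map r d ` words I m) k"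
    by (auto simp: words_Suc)
  obtain \<sigma> where \<sigma>: "\<sigma> \<in> words I (k * m)" "compose_list G' = word_map r d \<sigma>"
    "- ln (slope (compose_list G')) = sum_list (map (\<lambda>g. - ln (slope g)) G')"
    using Suc.IH[OF G(3)] by blast
  have c: "compose_list G = word_map r d (\<tau> @ \<sigma>)" using G \<sigma> by (simp add: word_map_append)
  have "0 < \<bar>word_ratio r \<tau>\<bar>" "0 < \<bar>word_ratio r \<sigma>\<bar>"
    using G(2) \<sigma>(1) by (simp_all only: words_def mem_Collect_eq word_ratio_nonzero)
  then have "- ln (slope (compose_list G)) = - ln (slope (word_map r d \<tau>)) - ln (slope (compose_list G'))"
    unfolding c \<sigma>(2) by (simp add: abs_mult ln_mult)
  then show ?case using c G \<sigma> by (intro bexI[of _ "\<tau> @ \<sigma>"]) (auto simp: words_def)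
qed

text \<open>A logarithm of a linear function is negligible against m. With b = e \<open>l0\<close>
  the fibre multiplicity of one block then costs at most e L in the exponent.\<close>

lemma exists_block_length:
  fixes N c b :: real
  assumes "0 < N" "0 \<le> c" "0 < b"
  obtains m :: nat where "1 \<le> m" "ln (N * (1 + real m * c)) \<le> real m * b"
proof -
  define x where "x = exp (- b)"
  have x: "0 < x" "x < 1" using assms by (auto simp: x_def)
  have "(\<lambda>m. N * x ^ m + N * c * (real m * x ^ m)) \<longlonglongrightarrow> N * 0 + N * c * 0"
    using x by (intro tendsto_intros LIMSEQ_realpow_zero powser_times_n_limit_0) auto
  then have "\<forall>\<^sub>F m in sequentially. N * x ^ m + N * c * (real m * x ^ m) < 1"
    by (intro order_tendstoD) auto
  then obtain M where M: "\<And>m. m \<ge> M \<Longrightarrow> N * x ^ m + N * c * (real m * x ^ m) < 1"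
    unfolding eventually_sequentially by blast
  define m where "m = max M 1"
  have "N * (1 + real m * c) * x ^ m < 1" using M[of m] by (simp add: m_def algebra_simps)
  moreover have "x ^ m = exp (- (real m * b))" by (simp add: x_def exp_of_nat_mult[symmetric])
  ultimately have "N * (1 + real m * c) * exp (- (real m * b)) < 1" by simp
  then have "N * (1 + real m * c) < exp (real m * b)"
    unfolding exp_minus by (simp only: divide_inverse[symmetric] pos_divide_less_eq[OF exp_gt_zero] mult_1)
  moreover have "0 < N * (1 + real m * c)" using assms by (intro mult_pos_pos add_pos_nonneg) auto
  ultimately have "ln (N * (1 + real m * c)) \<le> real m * b"
    by (metis exp_le_cancel_iff exp_ln less_imp_le)
  then show ?thesis by (rule that[rotated]) (simp add: m_def)
qed

lemma exists_concentrated: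
  assumes \<epsilon>: "0 < \<epsilon>"
  shows "\<exists>\<alpha>\<ge>0. concentrated \<mu> \<alpha> \<epsilon>"
proof -
  obtain N :: real where N: "0 < N" and count: "\<And>a u s \<S>. 0 < a \<Longrightarrow> a \<le> 1 \<Longrightarrow> 0 \<le> s \<Longrightarrow>
       \<S> \<subseteq> {word_map r d \<sigma> |\<sigma>. set \<sigma> \<subseteq> I \<and> \<sigma> \<noteq> [] \<and> a \<le> \<bar>word_ratio r \<sigma>\<bar> \<and>
              word_map r d \<sigma> ` K \<inter> {u..u + s} \<noteq> {}} \<Longrightarrow>
       real (card \<S>) \<le> N * (1 + (- ln a) / l0) * (s / a + 1)"
    by (rule card_maps_near_interval) blast
  \<comment> \<open>An a priori bound for H / L, independent of the block length: each block map has
    weight at least \<open>pmin ^ m\<close>, so H is at most m (- ln \<open>pmin\<close>), while L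
    is at least m \<open>l0\<close>. It breaks a circle: e must be small relative to \<alpha>, m
    depends on e, and \<alpha> depends on m.\<close>
  define A where "A = (- ln pmin) / l0"
  have lnp: "0 \<le> - ln pmin" using pmin by simp
  have A0: "0 \<le> A" unfolding A_def using lnp l0_pos by (intro divide_nonneg_pos)
  \<comment> \<open>The factor 13 leaves room for the strict inequality 12e < \<epsilon>; the factor
    A + 1 serves 2e(\<alpha>+1) < \<epsilon> for every \<alpha> up to A.\<close>
  define e where "e = min (1/2) (\<epsilon> / (13 * (A + 1)))"
  have "0 < e" using \<epsilon> A0 by (simp add: e_def)
  moreover have "e \<le> 1/2" unfolding e_def by (rule min.cobounded1)
  ultimately have e: "0 < e" "e \<le> 1/2" .
  have "e * (13 * (A + 1)) \<le> \<epsilon> / (13 * (A + 1)) * (13 * (A + 1))"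
    using A0 by (intro mult_right_mono) (auto simp: e_def)
  then have eA: "13 * e * (A + 1) \<le> \<epsilon>" using A0 by (simp add: mult.assoc mult.left_commute)
  have "e * 1 \<le> e * (A + 1)" using e A0 by (intro mult_left_mono) auto
  then have e12: "12 * e < \<epsilon>" using eA e by linarith
  define c1 where "c1 = (- ln rmin) / l0"
  have "rmin < 1" using rmin_le_rmax rmax(2) by linarith
  then have "0 \<le> - ln rmin" using rmin(1) by simp
  then have c1: "0 \<le> c1" unfolding c1_def using l0_pos by (intro divide_nonneg_pos)
  obtain m :: nat where m: "1 \<le> m" "ln (N * (1 + real m * c1)) \<le> real m * (e * l0)"
    using exists_block_length[OF N c1 mult_pos_pos[OF e(1) l0_pos]] by blast

  define T where "T = words I m"
  define \<Gamma> where "\<Gamma> = word_map r d ` T"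
  define w where "w g = sum (\<lambda>\<tau>. prod_list (map p \<tau>)) {\<tau> \<in> T. word_map r d \<tau> = g}" for g
  define Y where "Y g = - ln (slope g)" for g
  have finT: "finite T" "finite \<Gamma>" using finite_I by (auto simp: T_def \<Gamma>_def)
  have pT: "pmin ^ m \<le> prod_list (map p \<tau>)" if "\<tau> \<in> T" for \<tau>
  proof -
    have "pmin ^ length \<tau> \<le> prod_list (map p \<tau>)" if "set \<tau> \<subseteq> I" for \<tau>
      using that by (induction \<tau>) (use pmin in \<open>auto intro!: mult_mono less_imp_le[OF p_pos]\<close>)
    then show ?thesis using that by (auto simp: T_def words_def)
  qed
  have pm: "0 < pmin ^ m" using pmin by simp
  have pT0: "0 \<le> prod_list (map p \<tau>)" if "\<tau> \<in> T" for \<tau> using pT[OF that] pm by linarith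
  have w_ge: "pmin ^ m \<le> w g" if g: "g \<in> \<Gamma>" for g
  proof -
    obtain \<tau> where \<tau>: "\<tau> \<in> T" "g = word_map r d \<tau>" using g by (auto simp: \<Gamma>_def)
    have "prod_list (map p \<tau>) \<le> w g"
      unfolding w_def using \<tau> finT pT0 by (intro member_le_sum) auto
    then show ?thesis using pT[OF \<tau>(1)] by linarith
  qed
  have w_pos: "0 < w g" if "g \<in> \<Gamma>" for g using w_ge[OF that] pm by linarith
  have w_sum: "(\<Sum>g\<in>\<Gamma>. w g) = 1"
  proof -
    have "(\<Sum>g\<in>\<Gamma>. w g) = (\<Sum>\<tau>\<in>T. prod_list (map p \<tau>))"
      unfolding \<Gamma>_def w_def by (rule sum.image_gen[OF finT(1), symmetric])
    also have "\<dots> = 1" unfolding T_def sum_words_prod_list p_sum by simp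
    finally show ?thesis .
  qed
  have w_le: "w g \<le> 1" if "g \<in> \<Gamma>" for g
    using member_le_sum[OF that, of w] w_pos finT w_sum by (auto intro: less_imp_le)
  have ss\<Gamma>: "measure \<mu> E = (\<Sum>g\<in>\<Gamma>. w g * measure \<mu> (g -` E))" if "E \<in> sets borel" for E
  proof -
    have "measure \<mu> E = (\<Sum>\<tau>\<in>words I m. prod_list (map p \<tau>) * measure \<mu> (compose_list (map (sim r d) \<tau>) -` E))"
    proof (rule measure_eq_sum_words[OF _ _ that])
      fix i show "sim r d i \<in> borel_measurable borel" unfolding sim_def by measurable
    qed (use self_similar in \<open>auto simp: is_self_similar_measure_def\<close>)
    also have "\<dots> = (\<Sum>\<tau>\<in>T. prod_list (map p \<tau>) * measure \<mu> (word_map r d \<tau> -` E))"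
      unfolding T_def word_map_eq_compose_list ..
    also have "\<dots> = (\<Sum>g\<in>\<Gamma>. w g * measure \<mu> (g -` E))"
      unfolding \<Gamma>_def w_def by (rule sum_group_weights[OF finT(1)])
    finally show ?thesis .
  qed
  have Y_ge: "real m * l0 \<le> Y g" if g: "g \<in> \<Gamma>" for g
  proof -
    obtain \<tau> where \<tau>: "set \<tau> \<subseteq> I" "length \<tau> = m" "g = word_map r d \<tau>"
      using g by (auto simp: \<Gamma>_def T_def words_def)
    have "ln \<bar>word_ratio r \<tau>\<bar> \<le> ln (rmax ^ m)"
      using word_ratio_bounds(2)[OF \<tau>(1)] word_ratio_nonzero[OF \<tau>(1)] rmax \<tau>(2) by simp
    also have "\<dots> = real m * ln rmax" using rmax by (simp add: ln_realpow)
    finally show ?thesis unfolding Y_def \<tau>(3) l0_def by simp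
  qed

  define H where "H = (\<Sum>g\<in>\<Gamma>. w g * (- ln (w g)))"
  define L where "L = (\<Sum>g\<in>\<Gamma>. w g * Y g)"
  have "(\<Sum>g\<in>\<Gamma>. w g * (real m * l0)) \<le> L"
    unfolding L_def using Y_ge w_pos by (intro sum_mono mult_left_mono) (auto intro: less_imp_le)
  then have L_ge: "real m * l0 \<le> L" by (simp add: w_sum flip: sum_distrib_right)
  have ml0: "0 < real m * l0" using m l0_pos by simp
  then have L: "0 < L" using L_ge by linarith
  have H0: "0 \<le> H" unfolding H_def
    using w_pos w_le by (intro sum_nonneg mult_nonneg_nonneg) (auto intro: less_imp_le)
  have "H \<le> (\<Sum>g\<in>\<Gamma>. w g * (real m * (- ln pmin)))"
    unfolding H_def
  proof (intro sum_mono mult_left_mono)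
    fix g assume g: "g \<in> \<Gamma>"
    have "ln (pmin ^ m) \<le> ln (w g)" using w_ge[OF g] pm w_pos[OF g] by simp
    then show "- ln (w g) \<le> real m * (- ln pmin)" using pmin by (simp add: ln_realpow)
    show "0 \<le> w g" using w_pos[OF g] by simp
  qed
  then have H_le: "H \<le> real m * (- ln pmin)" by (simp only: w_sum sum_distrib_right[symmetric] mult_1)
  define \<alpha> where "\<alpha> = H / L"
  have \<alpha>0: "0 \<le> \<alpha>" using H0 L by (simp add: \<alpha>_def)
  have "\<alpha> \<le> real m * (- ln pmin) / (real m * l0)"
    unfolding \<alpha>_def using H_le L_ge ml0 mult_nonneg_nonneg[OF of_nat_0_le_iff lnp, of m]
    by (intro frac_le)
  then have \<alpha>A: "\<alpha> \<le> A" using m by (simp add: A_def)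
  have "2 * e * (\<alpha> + 1) \<le> 2 * e * (A + 1)" using \<alpha>A e by (intro mult_left_mono) auto
  also have "\<dots> < 13 * e * (A + 1)" using e A0 by (intro mult_strict_right_mono) auto
  finally have e2: "2 * e * (\<alpha> + 1) < \<epsilon>" using eA by linarith

  define M where "M = N * (1 + real m * c1)"
  have M: "0 < M" unfolding M_def using N c1 by (intro mult_pos_pos add_pos_nonneg) auto
  obtain x0 where x0: "x0 \<in> K" using K_nonempty by auto
  have \<Gamma>K: "g ` K \<subseteq> K" if "g \<in> \<Gamma>" for g
    using that word_map_in_K by (auto simp: \<Gamma>_def T_def words_def)
  have \<Gamma>inj: "inj g" if "g \<in> \<Gamma>" for g
    using that inj_word_map by (auto simp: \<Gamma>_def T_def words_def)
  \<comment> \<open>The counting bound for the degenerate interval s = 0, at the smallest possible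
    ratio of a block, \<open>rmin ^ m\<close>. Only the number of scales survives, which makes M
    linear in m.\<close>
  have near: "real (card {g \<in> \<Gamma>. y \<in> g ` K}) \<le> M" for y
  proof -
    have "real (card {g \<in> \<Gamma>. y \<in> g ` K}) \<le> N * (1 + (- ln (rmin ^ m)) / l0) * (0 / rmin ^ m + 1)"
    proof (rule count[of "rmin ^ m" 0 _ y])
      show "0 < rmin ^ m" using rmin by simp
      show "rmin ^ m \<le> 1" using rmin rmin_le_rmax rmax by (intro power_le_one) auto
      show "{g \<in> \<Gamma>. y \<in> g ` K} \<subseteq> {word_map r d \<sigma> |\<sigma>. set \<sigma> \<subseteq> I \<and> \<sigma> \<noteq> [] \<and> rmin ^ m \<le> \<bar>word_ratio r \<sigma>\<bar> \<and>
              word_map r d \<sigma> ` K \<inter> {y..y + 0} \<noteq> {}}"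
      proof
        fix g assume g: "g \<in> {g \<in> \<Gamma>. y \<in> g ` K}"
        then obtain \<tau> where \<tau>: "set \<tau> \<subseteq> I" "length \<tau> = m" "g = word_map r d \<tau>"
          by (auto simp: \<Gamma>_def T_def words_def)
        then show "g \<in> {word_map r d \<sigma> |\<sigma>. set \<sigma> \<subseteq> I \<and> \<sigma> \<noteq> [] \<and> rmin ^ m \<le> \<bar>word_ratio r \<sigma>\<bar> \<and>
              word_map r d \<sigma> ` K \<inter> {y..y + 0} \<noteq> {}}"
          using g m word_ratio_bounds(1)[OF \<tau>(1)] by (auto intro!: exI[of _ \<tau>])
      qed
    qed simp
    also have "\<dots> = M" using rmin by (simp add: M_def c1_def ln_realpow)
    finally show ?thesis .
  qed
  have fibre: "real (card {G \<in> words \<Gamma> k. compose_list G = F}) \<le> M ^ k" for k F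
    using finT(2) \<Gamma>inj \<Gamma>K x0 near by (rule card_compose_list_fibre)
  define W where "W G = prod_list (map w G)" for G
  have \<delta>: "0 < e * L" using e L by simp
  obtain \<rho> where \<rho>: "0 < \<rho>" "\<rho> < 1" and typical: "\<And>k. \<exists>\<G>\<subseteq>words \<Gamma> k.
     sum W (words \<Gamma> k - \<G>) \<le> 5 * \<rho> ^ k \<and>
     (\<forall>G\<in>\<G>. \<bar>sum_list (map Y G) - real k * L\<bar> \<le> real k * (e * L) \<and>
        exp (- (real k * (H + e * L))) \<le> sum W {G' \<in> words \<Gamma> k. compose_list G' = compose_list G} \<and>
        sum W {G' \<in> words \<Gamma> k. compose_list G' = compose_list G} \<le> exp (- (real k * (H - 2 * (e * L) - ln M))))"
    using typical_words[OF finT(2) w_pos w_sum \<delta> M fibre, of Y]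
    unfolding H_def L_def W_def by blast
  have "ln M \<le> e * L"
  proof -
    have "ln M \<le> e * (real m * l0)" using m(2) by (simp add: M_def mult.left_commute)
    also have "\<dots> \<le> e * L" using L_ge e by (intro mult_left_mono) auto
    finally show ?thesis .
  qed
  have HL: "H = \<alpha> * L" using L by (simp add: \<alpha>_def)
  have "concentrated \<mu> \<alpha> \<epsilon>"
  proof (rule concentrated_of_levels[OF prob_space_axioms sets_mu K_borel measure_K L \<alpha>0 e e12 e2 \<rho> N])
    \<comment> \<open>The number of scales down to exp(-kL(1+e)) is at most 1 +
      kL(1+e)/\<open>l0\<close>, and 1 + e is at most 2.\<close>
    show "0 \<le> 2 * L / l0" using L l0_pos by simp
    fix k :: nat assume k: "1 \<le> k"
    obtain \<G> where \<G>: "\<G> \<subseteq> words \<Gamma> k" "sum W (words \<Gamma> k - \<G>) \<le> 5 * \<rho> ^ k"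
      "\<And>G. G \<in> \<G> \<Longrightarrow> \<bar>sum_list (map Y G) - real k * L\<bar> \<le> real k * (e * L)"
      "\<And>G. G \<in> \<G> \<Longrightarrow> exp (- (real k * (H + e * L))) \<le> sum W {G' \<in> words \<Gamma> k. compose_list G' = compose_list G}"
      "\<And>G. G \<in> \<G> \<Longrightarrow> sum W {G' \<in> words \<Gamma> k. compose_list G' = compose_list G} \<le> exp (- (real k * (H - 2 * (e * L) - ln M)))"
      using typical[of k] by blast
    define \<M> where "\<M> = compose_list ` words \<Gamma> k"
    define Q where "Q F = sum W {G \<in> words \<Gamma> k. compose_list G = F}" for F
    define \<F> where "\<F> = compose_list ` \<G>"
    have fin: "finite (words \<Gamma> k)" using finT by simp
    have W0: "0 \<le> W G" if "G \<in> words \<Gamma> k" for G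
      unfolding W_def using that w_pos by (intro prod_list_map_nonneg[of \<Gamma>]) (auto simp: words_def intro: less_imp_le)
    have map: "\<exists>\<sigma>. set \<sigma> \<subseteq> I \<and> \<sigma> \<noteq> [] \<and> compose_list G = word_map r d \<sigma> \<and>
        - ln \<bar>word_ratio r \<sigma>\<bar> = sum_list (map Y G)" if G: "G \<in> words \<Gamma> k" for G
    proof -
      obtain \<sigma> where "\<sigma> \<in> words I (k * m)" "compose_list G = word_map r d \<sigma>"
        "- ln (slope (compose_list G)) = sum_list (map Y G)"
        using compose_list_word_maps[OF G[unfolded \<Gamma>_def T_def]] unfolding Y_def by blast
      then show ?thesis using k m(1) by (intro exI[of _ \<sigma>]) (auto simp: words_def)
    qed
    have \<F>_map: "\<exists>\<sigma>. set \<sigma> \<subseteq> I \<and> \<sigma> \<noteq> [] \<and> F = word_map r d \<sigma> \<and>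
        exp (- (real k * L * (1 + e))) \<le> \<bar>word_ratio r \<sigma>\<bar> \<and> \<bar>word_ratio r \<sigma>\<bar> \<le> exp (- (real k * L * (1 - e)))"
      if F: "F \<in> \<F>" for F
    proof -
      obtain G where G: "G \<in> \<G>" "F = compose_list G" using F by (auto simp: \<F>_def)
      then obtain \<sigma> where \<sigma>: "set \<sigma> \<subseteq> I" "\<sigma> \<noteq> []" "compose_list G = word_map r d \<sigma>"
        "- ln \<bar>word_ratio r \<sigma>\<bar> = sum_list (map Y G)" using map[of G] \<G>(1) by blast
      have "\<bar>- ln \<bar>word_ratio r \<sigma>\<bar> - real k * L\<bar> \<le> real k * (e * L)" unfolding \<sigma>(4) by (rule \<G>(3)[OF G(1)])
      then have "- (real k * L * (1 + e)) \<le> ln \<bar>word_ratio r \<sigma>\<bar>" "ln \<bar>word_ratio r \<sigma>\<bar> \<le> - (real k * L * (1 - e))"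
        by (auto simp: abs_le_iff algebra_simps)
      then have "exp (- (real k * L * (1 + e))) \<le> exp (ln \<bar>word_ratio r \<sigma>\<bar>)"
        "exp (ln \<bar>word_ratio r \<sigma>\<bar>) \<le> exp (- (real k * L * (1 - e)))" by simp_all
      then show ?thesis using \<sigma> G(2) word_ratio_nonzero[OF \<sigma>(1)] by (intro exI[of _ \<sigma>]) simp
    qed
    show "\<exists>\<M> Q \<F>. finite \<M> \<and> \<F> \<subseteq> \<M> \<and>
      (\<forall>F\<in>\<M>. F \<in> borel_measurable borel \<and> 0 \<le> Q F) \<and>
      (\<forall>E\<in>sets borel. measure \<mu> E = (\<Sum>F\<in>\<M>. Q F * measure \<mu> (F -` E))) \<and>
      sum Q (\<M> - \<F>) \<le> 5 * \<rho> ^ k \<and>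
      (\<forall>F\<in>\<F>. (\<forall>x\<in>K. \<forall>y\<in>K. \<bar>F x - F y\<bar> \<le> exp (- (real k * L * (1 - e)))) \<and>
         exp (- (real k * L * (\<alpha> + e))) \<le> Q F \<and> Q F \<le> exp (- (real k * L * (\<alpha> - 3 * e)))) \<and>
      (\<forall>u. \<forall>s\<ge>0. real (card {F \<in> \<F>. F ` K \<inter> {u..u + s} \<noteq> {}})
         \<le> N * (1 + real k * (2 * L / l0)) * (s * exp (real k * L * (1 + e)) + 1))"
    proof (rule exI[of _ \<M>], rule exI[of _ Q], rule exI[of _ \<F>], intro conjI ballI allI impI)
      show "finite \<M>" using fin by (simp add: \<M>_def)
      show "\<F> \<subseteq> \<M>" using \<G>(1) by (auto simp: \<F>_def \<M>_def)
      show "F \<in> borel_measurable borel" if "F \<in> \<M>" for F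
        using that map unfolding \<M>_def by (metis imageE word_map_measurable)
      show "0 \<le> Q F" if "F \<in> \<M>" for F unfolding Q_def using W0 by (intro sum_nonneg) auto
      show "measure \<mu> E = (\<Sum>F\<in>\<M>. Q F * measure \<mu> (F -` E))" if "E \<in> sets borel" for E
      proof -
        have "measure \<mu> E = (\<Sum>G\<in>words \<Gamma> k. W G * measure \<mu> (compose_list (map (\<lambda>g. g) G) -` E))"
          unfolding W_def
        proof (rule measure_eq_sum_words[OF _ ss\<Gamma> that])
          show "g \<in> borel_measurable borel" if "g \<in> \<Gamma>" for g
            using that by (auto simp: \<Gamma>_def)
        qed
        then show ?thesis
          unfolding \<M>_def Q_def
          using sum_group_weights[OF fin, of W "\<lambda>F. measure \<mu> (F -` E)" compose_list] by simp
      qed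
      show "sum Q (\<M> - \<F>) \<le> 5 * \<rho> ^ k"
      proof -
        \<comment> \<open>A map is typical as soon as one word in its fibre is. The fibres of the
          other maps therefore consist of atypical words only, and their total weight is at most the
          atypical mass.\<close>
        let ?B = "{G \<in> words \<Gamma> k. compose_list G \<notin> \<F>}"
        have "sum Q (\<M> - \<F>) = (\<Sum>F\<in>compose_list ` ?B. sum W {G \<in> ?B. compose_list G = F})"
          unfolding \<M>_def Q_def by (intro sum.cong) auto
        also have "\<dots> = sum W ?B" using fin by (intro sum.image_gen[symmetric]) simp
        also have "\<dots> \<le> sum W (words \<Gamma> k - \<G>)"
          using fin W0 by (intro sum_mono2) (auto simp: \<F>_def)
        finally show ?thesis using \<G>(2) by linarith
      qed
    next
      fix F x y assume F: "F \<in> \<F>" and xy: "x \<in> K" "y \<in> K"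
      obtain \<sigma> where \<sigma>: "F = word_map r d \<sigma>" "\<bar>word_ratio r \<sigma>\<bar> \<le> exp (- (real k * L * (1 - e)))"
        using \<F>_map[OF F] by blast
      have "\<bar>F x - F y\<bar> = \<bar>word_ratio r \<sigma>\<bar> * \<bar>x - y\<bar>" unfolding \<sigma>(1) word_map_diff by (rule abs_mult)
      also have "\<dots> \<le> \<bar>word_ratio r \<sigma>\<bar> * 1" using K_dist_le_1[OF xy] by (intro mult_left_mono) auto
      finally show "\<bar>F x - F y\<bar> \<le> exp (- (real k * L * (1 - e)))" using \<sigma>(2) by simp
    next
      fix F assume "F \<in> \<F>"
      then obtain G where G: "G \<in> \<G>" "F = compose_list G" by (auto simp: \<F>_def)
      have "real k * L * (\<alpha> + e) = real k * (H + e * L)" unfolding HL by (simp add: algebra_simps)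
      then show "exp (- (real k * L * (\<alpha> + e))) \<le> Q F"
        using \<G>(4)[OF G(1)] unfolding Q_def G(2) by (simp only:)
      \<comment> \<open>Two of the three e in the claim come from the typical words; the third pays
        for \<open>ln M\<close>.\<close>
      have "Q F \<le> exp (- (real k * (H - 2 * (e * L) - ln M)))"
        using \<G>(5)[OF G(1)] unfolding Q_def G(2) .
      also have "\<dots> \<le> exp (- (real k * L * (\<alpha> - 3 * e)))"
      proof -
        have "\<alpha> * L - 3 * (e * L) \<le> H - 2 * (e * L) - ln M" using \<open>ln M \<le> e * L\<close> HL by linarith
        then have "real k * (\<alpha> * L - 3 * (e * L)) \<le> real k * (H - 2 * (e * L) - ln M)"
          by (intro mult_left_mono) auto
        then show ?thesis by (simp add: algebra_simps)
      qed
      finally show "Q F \<le> exp (- (real k * L * (\<alpha> - 3 * e)))" .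
    next
      fix u s :: real assume s: "0 \<le> s"
      let ?a = "exp (- (real k * L * (1 + e)))"
      let ?S = "{F \<in> \<F>. F ` K \<inter> {u..u + s} \<noteq> {}}"
      have kL: "0 \<le> real k * L * (1 + e)" using L e by simp
      have "real (card ?S) \<le> N * (1 + (- ln ?a) / l0) * (s / ?a + 1)"
      proof (rule count[of ?a s ?S u])
        show "?a \<le> 1" using kL by simp
        show "?S \<subseteq> {word_map r d \<sigma> |\<sigma>. set \<sigma> \<subseteq> I \<and> \<sigma> \<noteq> [] \<and> ?a \<le> \<bar>word_ratio r \<sigma>\<bar> \<and>
              word_map r d \<sigma> ` K \<inter> {u..u + s} \<noteq> {}}"
          using \<F>_map by blast
      qed (use s in auto)
      also have "\<dots> = N * (1 + real k * L * (1 + e) / l0) * (s * exp (real k * L * (1 + e)) + 1)"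
        unfolding ln_exp minus_minus by (simp only: exp_minus divide_inverse inverse_inverse_eq)
      also have "\<dots> \<le> N * (1 + real k * (2 * L / l0)) * (s * exp (real k * L * (1 + e)) + 1)"
      proof (intro mult_right_mono mult_left_mono)
        have "real k * L * (1 + e) \<le> real k * L * 2" using L e by (intro mult_left_mono) auto
        then have "real k * L * (1 + e) / l0 \<le> real k * L * 2 / l0"
          using l0_pos by (intro divide_right_mono) auto
        then show "1 + real k * L * (1 + e) / l0 \<le> 1 + real k * (2 * L / l0)" by (simp add: algebra_simps)
      qed (use N s in auto)
      finally show "real (card ?S) \<le> N * (1 + real k * (2 * L / l0)) * (s * exp (real k * L * (1 + e)) + 1)" .
    qed
  qed
  then show ?thesis using \<alpha>0 by blast
qed

end

theorem corollary1p3: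
  fixes I :: "'i set" and r d p :: "'i \<Rightarrow> real"
    and K :: "real set" and \<mu> :: "real measure"
  assumes "similarity_ifs I r"
    and "is_attractor I r d K"
    and "\<nexists>x. K = {x}"
    and "convex hull K = {0..1}"
    and "weak_separation I r d K"
    and "probability_vector I p"
    and "is_self_similar_measure I r d p \<mu>"
  shows "\<exists>Km :: nat \<Rightarrow> real set.
           (\<forall>m. compact (Km m) \<and> Km m \<subseteq> Km (Suc m) \<and> Km (Suc m) \<subseteq> K) \<and>
           (\<lambda>m. measure \<mu> (Km m)) \<longlonglongrightarrow> 1 \<and>
           (\<forall>m. multifractal_formalism (restrict_to \<mu> (Km m))) \<and>
           (\<forall>m n. \<forall>q. Lq_spectrum (restrict_to \<mu> (Km m)) q = Lq_spectrum (restrict_to \<mu> (Km n)) q) \<and>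
           (\<forall>m n. local_dims (restrict_to \<mu> (Km m)) = local_dims (restrict_to \<mu> (Km n)))"
proof -
  interpret prob_space \<mu> using assms(7) by (simp add: is_self_similar_measure_def)
  interpret wsc_ifs \<mu> I r d p K by unfold_locales (use assms in auto)
  obtain \<alpha> where \<alpha>: "0 \<le> \<alpha>" "\<And>\<epsilon>. 0 < \<epsilon> \<Longrightarrow> concentrated \<mu> \<alpha> \<epsilon>"
    using concentrated_all_scales[OF prob_space_axioms sets_mu exists_concentrated] by blast
  show ?thesis
    by (rule multifractal_decomposition_of_concentrated[OF prob_space_axioms sets_mu K_compact measure_K \<alpha>(2,1)])
qed

end
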